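(* Let $\mathcal{H}$ be a complex infinite-dimensional Hilbert space and let $\mathbf{T}=(T_1,T_2)$ be a commuting pair of bounded linear operators on $\mathcal{H}$, with spherical Aluthge transform $\widehat{\mathbf{T}}$. Then $$\sigma_{Te}(\mathbf{T})=\sigma_{Te}(\widehat{\mathbf{T}}),$$ where $\sigma_{Te}$ denotes the Taylor essential spectrum. Moreover, for each $\lambda\in\mathbb{C}^2$ with $\lambda\notin\sigma_{Te}(\mathbf{T})$, $$\operatorname{ind}(\mathbf{T}-\lambda)=\operatorname{ind}(\widehat{\mathbf{T}}-\lambda),$$ where $\operatorname{ind}$ denotes the Fredholm index.
   Context: Canonical joint polar decomposition: for a commuting pair $\mathbf{T}=(T_1,T_2)$ of bounded operators on $\mathcal{H}$, consider the polar decomposition of the column operator $\begin{pmatrix} T_1 \\ T_2 \end{pmatrix}:\mathcal{H}\to\mathcal{H}\oplus\mathcal{H}$, namely $\begin{pmatrix} T_1 \\ T_2 \end{pmatrix}=\begin{pmatrix} V_1 \\ V_2 \end{pmatrix}P$, where $P=\sqrt{T_1^*T_1+T_2^*T_2}$ and $\begin{pmatrix} V_1 \\ V_2 \end{pmatrix}:\mathcal{H}\to\mathcal{H}\oplus\mathcal{H}$ is a partial isometry, subject to $\ker T_1\cap\ker T_2=\ker V_1\cap\ker V_2=\ker P$. The spherical Aluthge transform of $\mathbf{T}$ is $\widehat{\mathbf{T}}:=(\sqrt{P}V_1\sqrt{P},\sqrt{P}V_2\sqrt{P})$, which is necessarily a commuting pair. For a commuting pair $\mathbf{S}=(S_1,S_2)$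 on $\mathcal{H}$, the Koszul complex $K(\mathbf{S},\mathcal{H})$ is $$0\to\mathcal{H}\xrightarrow{\begin{pmatrix} S_1 \\ S_2 \end{pmatrix}}\mathcal{H}\oplus\mathcal{H}\xrightarrow{(-S_2\ \ S_1)}\mathcal{H}\to 0.$$ The pair $\mathbf{S}$ is Fredholm if each map in $K(\mathbf{S},\mathcal{H})$ has closed range and all the homology quotients are finite-dimensional. For $\lambda=(\lambda_1,\lambda_2)\in\mathbb{C}^2$ write $\mathbf{S}-\lambda:=(S_1-\lambda_1,S_2-\lambda_2)$. The Taylor essential spectrum of $\mathbf{S}$ is $$\sigma_{Te}(\mathbf{S}):=\{\lambda\in\mathbb{C}^2:\mathbf{S}-\lambda\text{ is not Fredholm}\}.$$ The Fredholm index $\operatorname{ind}(\mathbf{S})$ of a Fredholm pair $\mathbf{S}$ is the Euler characteristic of its Koszul complex, i.e. the alternating sum $\dim H_{\mathrm{left}}-\dim H_{\mathrm{middle}}+\dim H_{\mathrm{right}}$ of the dimensions of the homology spaces at the left, middle and right copies $\mathcal{H}$, $\mathcal{H}\oplus\mathcal{H}$, $\mathcal{H}$ (the overall sign convention is immaterial here, provided the same one is used for both pairs). *)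

theory Defs
  imports "HOL-Analysis.Analysis"
begin

section \<open>Complex Hilbert spaces\<close>

text \<open>
  The underlying real Hilbert space structure (norm, topology, completeness) is that of the
  library; its inner product is the real part of the complex one, which is linear in the first
  argument. Positivity and \<^prop>\<open>norm x = sqrt (inner x x)\<close> are inherited from \<^class>\<open>real_inner\<close>.
\<close>

class complex_hilbert_space = real_inner + complete_space +
  fixes scaleC :: "complex \<Rightarrow> 'a \<Rightarrow> 'a" (infixr "*\<^sub>C" 75)
    and cinner :: "'a \<Rightarrow> 'a \<Rightarrow> complex"
  assumes scaleC_add_right: "c *\<^sub>C (x + y) = c *\<^sub>C x + c *\<^sub>C y"
    and scaleC_add_left: "(c + d) *\<^sub>C x = c *\<^sub>C x + d *\<^sub>C x"
    and scaleC_scaleC: "c *\<^sub>C d *\<^sub>C x = (c * d) *\<^sub>C x"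
    and scaleC_of_real: "complex_of_real r *\<^sub>C x = r *\<^sub>R x"
    and cinner_add_left: "cinner (x + y) z = cinner x z + cinner y z"
    and cinner_scaleC_left: "cinner (c *\<^sub>C x) y = c * cinner x y"
    and cinner_commute: "cinner x y = cnj (cinner y x)"
    and inner_eq_Re_cinner: "inner x y = Re (cinner x y)"

subclass (in complex_hilbert_space) banach ..

global_interpretation complex_vs: vector_space "scaleC :: complex \<Rightarrow> 'a \<Rightarrow> 'a::complex_hilbert_space"
proof
  fix x :: 'a
  show "1 *\<^sub>C x = x"
    using scaleC_of_real[of 1 x] by simp
qed (simp_all add: scaleC_add_right scaleC_add_left scaleC_scaleC)

text \<open>The Hilbert space direct sum; the norm of \<^typ>\<open>'a \<times> 'b\<close> in the library is the Euclidean one.\<close>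

instantiation prod :: (complex_hilbert_space, complex_hilbert_space) complex_hilbert_space
begin

definition scaleC_prod :: "complex \<Rightarrow> 'a \<times> 'b \<Rightarrow> 'a \<times> 'b" where
  "scaleC_prod c x = (c *\<^sub>C fst x, c *\<^sub>C snd x)"

definition cinner_prod :: "'a \<times> 'b \<Rightarrow> 'a \<times> 'b \<Rightarrow> complex" where
  "cinner_prod x y = cinner (fst x) (fst y) + cinner (snd x) (snd y)"

instance
proof
  fix x y :: "'a \<times> 'b"
  show "cinner x y = cnj (cinner y x)"
    unfolding cinner_prod_def complex_cnj_add
    by (metis cinner_commute)
qed (simp_all add: scaleC_prod_def cinner_prod_def inner_prod_def scaleR_prod_def prod_eq_iff
      scaleC_add_right scaleC_add_left scaleC_scaleC scaleC_of_real cinner_add_left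
      cinner_scaleC_left inner_eq_Re_cinner algebra_simps)

end


section \<open>Bounded operators\<close>

definition bounded_clinear ::
  "('a::complex_hilbert_space \<Rightarrow> 'b::complex_hilbert_space) \<Rightarrow> bool" where
  "bounded_clinear T \<longleftrightarrow> bounded_linear T \<and> (\<forall>c x. T (c *\<^sub>C x) = c *\<^sub>C T x)"

definition cadjoint ::
  "('a::complex_hilbert_space \<Rightarrow> 'b::complex_hilbert_space) \<Rightarrow> 'b \<Rightarrow> 'a" where
  "cadjoint T = (THE S. \<forall>x y. cinner (T x) y = cinner x (S y))"

definition positive_operator :: "('a::complex_hilbert_space \<Rightarrow> 'a) \<Rightarrow> bool" where
  "positive_operator A \<longleftrightarrow>
    bounded_clinear A \<and> (\<forall>x. cinner (A x) x \<in> \<real> \<and> 0 \<le> Re (cinner (A x) x))"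

definition operator_sqrt :: "('a::complex_hilbert_space \<Rightarrow> 'a) \<Rightarrow> 'a \<Rightarrow> 'a" where
  "operator_sqrt A = (THE B. positive_operator B \<and> B \<circ> B = A)"

definition partial_isometry ::
  "('a::complex_hilbert_space \<Rightarrow> 'b::complex_hilbert_space) \<Rightarrow> bool" where
  "partial_isometry V \<longleftrightarrow>
    bounded_clinear V \<and> (\<forall>x. (\<forall>y\<in>V -` {0}. cinner x y = 0) \<longrightarrow> norm (V x) = norm x)"


section \<open>Pairs of operators and the spherical Aluthge transform\<close>

type_synonym 'a operator_pair = "('a \<Rightarrow> 'a) \<times> ('a \<Rightarrow> 'a)"

definition commuting_pair :: "'a::complex_hilbert_space operator_pair \<Rightarrow> bool" where
  "commuting_pair = (\<lambda>(T1, T2).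
    bounded_clinear T1 \<and> bounded_clinear T2 \<and> T1 \<circ> T2 = T2 \<circ> T1)"

definition joint_modulus :: "'a::complex_hilbert_space operator_pair \<Rightarrow> 'a \<Rightarrow> 'a" where
  "joint_modulus = (\<lambda>(T1, T2). operator_sqrt (\<lambda>x. cadjoint T1 (T1 x) + cadjoint T2 (T2 x)))"

definition column :: "'a::complex_hilbert_space operator_pair \<Rightarrow> 'a \<Rightarrow> 'a \<times> 'a" where
  "column = (\<lambda>(T1, T2) x. (T1 x, T2 x))"

definition is_joint_polar_part ::
  "'a::complex_hilbert_space operator_pair \<Rightarrow> 'a operator_pair \<Rightarrow> bool" where
  "is_joint_polar_part = (\<lambda>(T1, T2) (V1, V2).
    column (T1, T2) = column (V1, V2) \<circ> joint_modulus (T1, T2) \<and>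
    partial_isometry (column (V1, V2)) \<and>
    T1 -` {0} \<inter> T2 -` {0} = V1 -` {0} \<inter> V2 -` {0} \<and>
    V1 -` {0} \<inter> V2 -` {0} = joint_modulus (T1, T2) -` {0})"

definition joint_polar_part ::
  "'a::complex_hilbert_space operator_pair \<Rightarrow> 'a operator_pair" where
  "joint_polar_part T = (THE V. is_joint_polar_part T V)"

definition spherical_aluthge ::
  "'a::complex_hilbert_space operator_pair \<Rightarrow> 'a operator_pair" where
  "spherical_aluthge T =
    (let R = operator_sqrt (joint_modulus T); (V1, V2) = joint_polar_part T
     in (R \<circ> V1 \<circ> R, R \<circ> V2 \<circ> R))"


section \<open>Quotients of subspaces\<close>

text \<open>
  For subspaces \<open>L \<subseteq> K\<close>, the elements of \<open>B\<close> represent, without repetition, a basis of the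
  quotient space \<open>K / L\<close>: they are linearly independent modulo \<open>L\<close>, and their cosets span.
\<close>

definition quotient_basis :: "'a::complex_hilbert_space set \<Rightarrow> 'a set \<Rightarrow> 'a set \<Rightarrow> bool" where
  "quotient_basis K L B \<longleftrightarrow>
    B \<subseteq> K \<and> complex_vs.independent B \<and> complex_vs.span B \<inter> L = {0} \<and>
    (\<forall>x\<in>K. \<exists>b\<in>complex_vs.span B. x - b \<in> L)"

definition finite_dim_quotient :: "'a::complex_hilbert_space set \<Rightarrow> 'a set \<Rightarrow> bool" where
  "finite_dim_quotient K L \<longleftrightarrow> (\<exists>B. finite B \<and> quotient_basis K L B)"

definition quotient_dim :: "'a::complex_hilbert_space set \<Rightarrow> 'a set \<Rightarrow> nat" where
  "quotient_dim K L = card (SOME B. quotient_basis K L B)"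


section \<open>The Koszul complex\<close>

text \<open>The second map of the Koszul complex is the row \<open>(- S2, S1)\<close>; the first one is \<^const>\<open>column\<close>.\<close>

definition koszul_row :: "'a::complex_hilbert_space operator_pair \<Rightarrow> 'a \<times> 'a \<Rightarrow> 'a" where
  "koszul_row = (\<lambda>(S1, S2) (x, y). - S2 x + S1 y)"

text \<open>
  The zero maps at both ends of the complex have closed range. The homology spaces are
  \<open>ker (column S) / 0\<close>, \<open>ker (koszul_row S) / ran (column S)\<close> and \<open>\<H> / ran (koszul_row S)\<close>.
\<close>

definition fredholm_pair :: "'a::complex_hilbert_space operator_pair \<Rightarrow> bool" where
  "fredholm_pair S \<longleftrightarrow>
    closed (range (column S)) \<and> closed (range (koszul_row S)) \<and>
    finite_dim_quotient (column S -` {0}) {0} \<and>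
    finite_dim_quotient (koszul_row S -` {0}) (range (column S)) \<and>
    finite_dim_quotient UNIV (range (koszul_row S))"

definition fredholm_index :: "'a::complex_hilbert_space operator_pair \<Rightarrow> int" where
  "fredholm_index S =
    int (quotient_dim (column S -` {0}) {0})
    - int (quotient_dim (koszul_row S -` {0}) (range (column S)))
    + int (quotient_dim UNIV (range (koszul_row S)))"

definition shift_pair ::
  "'a::complex_hilbert_space operator_pair \<Rightarrow> complex \<times> complex \<Rightarrow> 'a operator_pair" where
  "shift_pair = (\<lambda>(S1, S2) (l1, l2). (\<lambda>x. S1 x - l1 *\<^sub>C x, \<lambda>x. S2 x - l2 *\<^sub>C x))"

definition taylor_essential_spectrum ::
  "'a::complex_hilbert_space operator_pair \<Rightarrow> (complex \<times> complex) set" where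
  "taylor_essential_spectrum S = {l. \<not> fredholm_pair (shift_pair S l)}"

end

theory Submission
  imports Defs
begin

text \<open>
  With \<open>R = sqrt P\<close> one has \<open>T\<^sub>j = V\<^sub>j R R\<close>, and the transform has the components \<open>H\<^sub>j = R V\<^sub>j R\<close>; thus \<open>R\<close>
  and \<open>V\<^sub>j R\<close> are chain maps between the Koszul complexes of the two pairs, in opposite directions.
  After subtracting \<open>\<lambda>\<close>, their composites are \<open>\<lambda>\<^sub>j\<close> up to null-homotopic maps, so for \<open>\<lambda> \<noteq> 0\<close> they
  induce isomorphisms on homology. For \<open>\<lambda> = 0\<close>, if either pair is Fredholm then \<open>R\<close> has closed range
  and finite-dimensional kernel \<open>N\<close>; so \<open>H\<close> is similar to the compression of \<open>T\<close> to the orthogonal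
  complement of \<open>N\<close> (extended by \<open>0\<close>), and passing to it changes the homology by finite dimensions
  which cancel in the Euler characteristic. Closedness of the ranges is automatic once the homology
  is finite-dimensional, by the open mapping theorem.
\<close>

section \<open>Dimensions of quotient spaces\<close>

text \<open>All commutation rests on the identity \<open>V1 P V2 = V2 P V1\<close> with
  \<open>P = R R\<close>, which is forced by the commutation of the given pair. It makes the
  transform commute and lets \<open>V\<^sub>j R\<close> intertwine both components, not only the one
  with its own index. The two composites are exactly \<open>T\<^sub>j\<close> and
  \<open>H\<^sub>j\<close>, that is, \<open>\<lambda>\<^sub>j\<close> plus the j-th shifted
  operator. At the origin the scalar is 0 and this argument is void. The homology spaces can then
  really differ: if T1 is the direct sum of a nilpotent 2 by 2 Jordan block and an identity, and T2
  = 0, the transform has a larger joint kernel. Only the alternating sum can be compared. The closed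
  range of \<open>R\<close> is reached from a different end in each direction: from \<open>T\<close>
  through \<open>norm (R (R x)) = norm (column (T1, T2) x)\<close>, from \<open>H\<close> because
  \<open>range R\<close> contains the closed range of its row map with finite codimension. Square
  root, adjoint and polar part are definite descriptions, so existence and uniqueness of each are
  proved before the Koszul complexes enter.\<close>

interpretation complex_vs_pair: vector_space_pair
  "scaleC :: complex \<Rightarrow> 'a \<Rightarrow> 'a::complex_hilbert_space"
  "scaleC :: complex \<Rightarrow> 'b \<Rightarrow> 'b::complex_hilbert_space"
  by unfold_locales

abbreviation clinear :: "('a::complex_hilbert_space \<Rightarrow> 'b::complex_hilbert_space) \<Rightarrow> bool" where
  "clinear \<equiv> Vector_Spaces.linear scaleC scaleC"

abbreviation csubspace :: "'a::complex_hilbert_space set \<Rightarrow> bool" where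
  "csubspace \<equiv> complex_vs.subspace"

abbreviation cspan :: "'a::complex_hilbert_space set \<Rightarrow> 'a set" where
  "cspan \<equiv> complex_vs.span"

text \<open>A relation, so that finiteness and value travel together: \<open>quotient_dim\<close> is
  a choice by \<open>SOME\<close> and carries information only once the quotient is known to be
  finite-dimensional.\<close>

definition has_quotient_dim :: "'a::complex_hilbert_space set \<Rightarrow> 'a set \<Rightarrow> nat \<Rightarrow> bool" where
  "has_quotient_dim K L n \<longleftrightarrow> (\<exists>B. finite B \<and> card B = n \<and> quotient_basis K L B)"

lemma independent_Un_disjoint_span:
  fixes A B :: "'a::complex_hilbert_space set"
  assumes "complex_vs.independent A" "complex_vs.independent B" "cspan A \<inter> cspan B = {0}"
  shows "complex_vs.independent (A \<union> B)"
proof -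
  \<comment> \<open>Stated for arbitrary \<open>A\<close> and \<open>B\<close>, because it is
    applied a second time with the two sets exchanged.\<close>
  have *: "a \<notin> cspan (A \<union> B - {a})"
    if a: "a \<in> A" and A: "complex_vs.independent A" and AB: "cspan A \<inter> cspan B = {0}"
    for a and A B :: "'a set"
  proof
    assume "a \<in> cspan (A \<union> B - {a})"
    then have "a \<in> cspan ((A - {a}) \<union> B)"
      using complex_vs.span_mono[of "A \<union> B - {a}" "(A - {a}) \<union> B"] by auto
    then obtain u v where uv: "a = u + v" "u \<in> cspan (A - {a})" "v \<in> cspan B"
      by (auto simp: complex_vs.span_Un)
    have "u \<in> cspan A"
      using uv(2) complex_vs.span_mono[of "A - {a}" A] by auto
    then have "a - u \<in> cspan A"
      using a by (simp add: complex_vs.span_diff complex_vs.span_base)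
    with uv(1,3) AB have "v = 0" by auto
    with uv have "a \<in> cspan (A - {a})" by simp
    with a A show False by (auto simp: complex_vs.dependent_def)
  qed
  show ?thesis
    unfolding complex_vs.dependent_def
    using *[of _ A B] *[of _ B A] assms by (auto simp: Un_commute Int_commute)
qed

text \<open>Exchange argument modulo \<open>L\<close>: replace every element of \<open>B'\<close> by
  a representative in \<open>cspan B\<close> of the same coset. The linear extension
  \<open>g\<close> moves vectors of \<open>cspan B'\<close> only by elements of \<open>L\<close>,
  which meets that span trivially; so \<open>g\<close> is injective there and \<open>g\<close> maps
  \<open>B'\<close> to an independent set inside a finitely spanned space. Finiteness of
  \<open>B'\<close> is part of the conclusion.\<close>

lemma quotient_basis_card_le:
  assumes L: "csubspace L" and fin: "finite B"
    and B: "quotient_basis K L B" and B': "quotient_basis K L B'"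
  shows "finite B' \<and> card B' \<le> card B"
proof -
  have "\<forall>b\<in>B'. \<exists>h\<in>cspan B. b - h \<in> L"
    using B B' by (auto simp: quotient_basis_def)
  then obtain h where h: "\<And>b. b \<in> B' \<Longrightarrow> h b \<in> cspan B" "\<And>b. b \<in> B' \<Longrightarrow> b - h b \<in> L"
    by metis
  from B' have indB': "complex_vs.independent B'" by (simp add: quotient_basis_def)
  then obtain g where g: "clinear g" "\<And>b. b \<in> B' \<Longrightarrow> g b = h b"
    using complex_vs_pair.linear_independent_extend[of B' h] by auto
  interpret g: Vector_Spaces.linear scaleC scaleC g by fact
  have near: "v - g v \<in> L" if "v \<in> cspan B'" for v
  proof -
    have "csubspace {v. v - g v \<in> L}"
    proof (rule complex_vs.subspaceI; unfold mem_Collect_eq)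
      show "0 - g 0 \<in> L" using L by (simp add: g.zero complex_vs.subspace_0)
      fix x y c assume x: "x - g x \<in> L"
      show "c *\<^sub>C x - g (c *\<^sub>C x) \<in> L"
        using complex_vs.subspace_scale[OF L x, of c]
        by (simp only: g.scale complex_vs.scale_right_diff_distrib)
      assume "y - g y \<in> L"
      from complex_vs.subspace_add[OF L x this] show "x + y - g (x + y) \<in> L"
        by (simp only: g.add add_diff_add)
    qed
    moreover have "B' \<subseteq> {v. v - g v \<in> L}" using h(2) g(2) by auto
    ultimately have "cspan B' \<subseteq> {v. v - g v \<in> L}" by (rule complex_vs.span_minimal[rotated])
    from subsetD[OF this that] show ?thesis by simp
  qed
  have sub: "g ` B' \<subseteq> cspan B" using g(2) h by auto
  have inj: "inj_on g (cspan B')"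
  proof (rule inj_onI)
    fix x y assume xy: "x \<in> cspan B'" "y \<in> cspan B'" "g x = g y"
    then have "x - y \<in> cspan B'" by (simp add: complex_vs.span_diff)
    moreover have "x - y \<in> L"
      using near[OF \<open>x - y \<in> cspan B'\<close>] xy by (simp add: g.diff)
    ultimately have "x - y \<in> cspan B' \<inter> L" by simp
    moreover have "cspan B' \<inter> L = {0}" using B' by (simp add: quotient_basis_def)
    ultimately have "x - y \<in> {0}" by metis
    then show "x = y" by simp
  qed
  have "complex_vs.independent (g ` B')"
    using complex_vs_pair.linear_independent_injective_image[OF g(1) indB' inj] .
  from complex_vs.independent_span_bound[OF fin this sub]
  have "finite (g ` B')" "card (g ` B') \<le> card B" by auto
  moreover have "inj_on g B'"
    using inj_on_subset[OF inj complex_vs.span_superset] .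
  ultimately show ?thesis by (simp add: card_image finite_image_iff)
qed

lemma has_quotient_dim_quotient_basis:
  assumes "csubspace L" "has_quotient_dim K L n" "quotient_basis K L B"
  shows "finite B \<and> card B = n"
proof -
  obtain A where A: "finite A" "card A = n" "quotient_basis K L A"
    using assms(2) by (auto simp: has_quotient_dim_def)
  then have "finite B" "card B \<le> n"
    using quotient_basis_card_le[OF assms(1) A(1,3) assms(3)] by auto
  moreover have "n \<le> card B"
    using quotient_basis_card_le[OF assms(1) \<open>finite B\<close> assms(3) A(3)] A(2) by auto
  ultimately show ?thesis by simp
qed

lemma has_quotient_dim_unique:
  assumes "csubspace L" "has_quotient_dim K L n" "has_quotient_dim K L m"
  shows "n = m"
  using assms(3) has_quotient_dim_quotient_basis[OF assms(1,2)]
  by (auto simp: has_quotient_dim_def)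

lemma quotient_dim_eqI:
  assumes "csubspace L" "has_quotient_dim K L n"
  shows "quotient_dim K L = n"
proof -
  have "quotient_basis K L (SOME B. quotient_basis K L B)"
    using assms(2) unfolding has_quotient_dim_def by (intro someI_ex[of "quotient_basis K L"]) auto
  from has_quotient_dim_quotient_basis[OF assms this] show ?thesis
    by (simp add: quotient_dim_def)
qed

lemma finite_dim_quotient_iff: "finite_dim_quotient K L \<longleftrightarrow> (\<exists>n. has_quotient_dim K L n)"
  by (auto simp: finite_dim_quotient_def has_quotient_dim_def)

lemma quotient_basis_exists:
  assumes K: "csubspace K" and L: "csubspace L" and LK: "L \<subseteq> K"
  obtains B where "quotient_basis K L B"
proof -
  obtain A where A: "A \<subseteq> L" "complex_vs.independent A" "L \<subseteq> cspan A"
    using complex_vs.maximal_independent_subset by blast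
  obtain C where C: "A \<subseteq> C" "C \<subseteq> K" "complex_vs.independent C" "K \<subseteq> cspan C"
    using complex_vs.maximal_independent_subset_extend[OF subset_trans[OF A(1) LK] A(2)] .
  have spA: "cspan A = L"
    using A(3) complex_vs.span_minimal[OF A(1) L] by auto
  \<comment> \<open>On \<open>K\<close>, \<open>f\<close> acts as the projection along
    \<open>L\<close>: it kills the basis \<open>A\<close> of \<open>L\<close> and fixes the added
    vectors. A vector of \<open>L\<close> in the span of \<open>C - A\<close> is therefore both
    fixed and killed.\<close>
  obtain f where f: "clinear f" "\<And>b. b \<in> C \<Longrightarrow> f b = (if b \<in> A then 0 else b)"
    using complex_vs_pair.linear_independent_extend[OF C(3), of "\<lambda>b. if b \<in> A then 0 else b"] by auto
  interpret f: Vector_Spaces.linear scaleC scaleC f by fact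
  have f0: "f x = 0" if "x \<in> L" for x
  proof (rule f.eq_0_on_span[of A])
    show "x \<in> cspan A" using that spA by simp
    show "f b = 0" if "b \<in> A" for b using f(2)[of b] C(1) that by auto
  qed
  have fid: "f x = x" if "x \<in> cspan (C - A)" for x
    using complex_vs_pair.linear_eq_on[OF f(1) complex_vs.linear_ident that] f(2) by simp
  have "quotient_basis K L (C - A)"
    unfolding quotient_basis_def
  proof (intro conjI ballI)
    show "C - A \<subseteq> K" using C(2) by auto
    show "complex_vs.independent (C - A)"
      using C(3) by (rule complex_vs.independent_mono) auto
    show "cspan (C - A) \<inter> L = {0}"
    proof -
      have "0 \<in> cspan (C - A) \<inter> L"
        using L by (simp add: complex_vs.span_zero complex_vs.subspace_0)
      moreover have "x = 0" if "x \<in> cspan (C - A)" "x \<in> L" for x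
        using fid[OF that(1)] f0[OF that(2)] by simp
      ultimately show ?thesis by auto
    qed
    fix x assume "x \<in> K"
    then have "x \<in> cspan ((C - A) \<union> A)"
      using C(1,4) by (auto simp: Un_absorb2)
    then obtain b a where "x = b + a" "b \<in> cspan (C - A)" "a \<in> L"
      unfolding complex_vs.span_Un spA by blast
    then show "\<exists>b\<in>cspan (C - A). x - b \<in> L" by (intro bexI[of _ b]) auto
  qed
  then show thesis by (rule that)
qed

text \<open>The hypotheses say that \<open>f\<close> induces an isomorphism of \<open>K / L\<close>
  onto \<open>K' / L'\<close>: \<open>kernel\<close> gives injectivity on cosets and
  \<open>onto\<close> surjectivity. In particular \<open>f\<close> is injective on the span of a set
  of representatives.\<close>

lemma quotient_basis_image:
  assumes f: "clinear f" and L': "csubspace L'" and K: "csubspace K"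
    and maps: "\<And>x. x \<in> K \<Longrightarrow> f x \<in> K'"
    and kernel: "\<And>x. x \<in> K \<Longrightarrow> f x \<in> L' \<longleftrightarrow> x \<in> L"
    and onto: "\<And>y. y \<in> K' \<Longrightarrow> \<exists>x\<in>K. y - f x \<in> L'"
    and B: "quotient_basis K L B"
  shows "quotient_basis K' L' (f ` B) \<and> inj_on f B"
proof -
  interpret f: Vector_Spaces.linear scaleC scaleC f by fact
  have BK: "cspan B \<subseteq> K"
    using B complex_vs.span_minimal[OF _ K] by (auto simp: quotient_basis_def)
  have zero: "v = 0" if "v \<in> cspan B" "f v \<in> L'" for v
    using that kernel[of v] BK B by (auto simp: quotient_basis_def)
  have inj: "inj_on f (cspan B)"
  proof (rule inj_onI)
    fix x y assume "x \<in> cspan B" "y \<in> cspan B" "f x = f y"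
    then show "x = y"
      using zero[of "x - y"] L' by (simp add: complex_vs.span_diff f.diff complex_vs.subspace_0)
  qed
  have "quotient_basis K' L' (f ` B)"
    unfolding quotient_basis_def
  proof (intro conjI ballI)
    show "f ` B \<subseteq> K'" using maps B by (auto simp: quotient_basis_def)
    show "complex_vs.independent (f ` B)"
      using complex_vs_pair.linear_independent_injective_image[OF f _ inj] B
      by (simp add: quotient_basis_def)
    show "cspan (f ` B) \<inter> L' = {0}"
    proof -
      have "0 \<in> cspan (f ` B) \<inter> L'" using L' by (simp add: complex_vs.span_zero complex_vs.subspace_0)
      moreover have "w = 0" if w: "w \<in> cspan (f ` B)" "w \<in> L'" for w
      proof -
        obtain v where "v \<in> cspan B" "w = f v" using w(1) by (auto simp: f.span_image)
        then show ?thesis using zero[of v] w(2) f.zero by simp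
      qed
      ultimately show ?thesis by auto
    qed
    fix y assume "y \<in> K'"
    then obtain x where x: "x \<in> K" "y - f x \<in> L'" using onto by blast
    then obtain b where b: "b \<in> cspan B" "x - b \<in> L"
      using B by (auto simp: quotient_basis_def)
    have "x - b \<in> K" using complex_vs.subspace_diff[OF K x(1)] b(1) BK by blast
    then have "f (x - b) \<in> L'" using kernel b by auto
    then have "(y - f x) + f (x - b) \<in> L'" by (rule complex_vs.subspace_add[OF L' x(2)])
    then show "\<exists>b\<in>cspan (f ` B). y - b \<in> L'"
      using b by (auto simp: f.span_image f.diff)
  qed
  then show ?thesis using inj_on_subset[OF inj complex_vs.span_superset] by blast
qed

text \<open>Bases of \<open>K / L\<close> exist also in infinite dimension, so transporting one of
  them settles both directions and finiteness need not be assumed on either side.\<close>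

lemma has_quotient_dim_iso:
  assumes f: "clinear f" and K: "csubspace K" and L: "csubspace L" "L \<subseteq> K" and L': "csubspace L'"
    and maps: "\<And>x. x \<in> K \<Longrightarrow> f x \<in> K'"
    and kernel: "\<And>x. x \<in> K \<Longrightarrow> f x \<in> L' \<longleftrightarrow> x \<in> L"
    and onto: "\<And>y. y \<in> K' \<Longrightarrow> \<exists>x\<in>K. y - f x \<in> L'"
  shows "has_quotient_dim K' L' n \<longleftrightarrow> has_quotient_dim K L n"
proof -
  obtain B where B: "quotient_basis K L B"
    using quotient_basis_exists[OF K L] .
  from quotient_basis_image[OF f L' K maps kernel onto B]
  have fB: "quotient_basis K' L' (f ` B)" "inj_on f B" by auto
  have "has_quotient_dim K' L' n \<longleftrightarrow> finite (f ` B) \<and> card (f ` B) = n"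
    using has_quotient_dim_quotient_basis[OF L' _ fB(1)] fB(1) by (auto simp: has_quotient_dim_def)
  moreover have "has_quotient_dim K L n \<longleftrightarrow> finite B \<and> card B = n"
    using has_quotient_dim_quotient_basis[OF L(1) _ B] B by (auto simp: has_quotient_dim_def)
  ultimately show ?thesis using fB(2) by (simp add: finite_image_iff card_image)
qed

lemma quotient_basis_tower:
  assumes M: "csubspace M" and L: "csubspace L" "L \<subseteq> M" "M \<subseteq> K"
    and A: "quotient_basis K M A" and B: "quotient_basis M L B"
  shows "quotient_basis K L (A \<union> B) \<and> A \<inter> B = {}"
proof -
  have BM: "cspan B \<subseteq> M"
    using B complex_vs.span_minimal[OF _ M] by (auto simp: quotient_basis_def)
  have AM: "cspan A \<inter> M = {0}" using A by (simp add: quotient_basis_def)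
  then have AB: "cspan A \<inter> cspan B = {0}"
    using BM complex_vs.span_zero by auto
  have "quotient_basis K L (A \<union> B)"
    unfolding quotient_basis_def
  proof (intro conjI ballI)
    show "A \<union> B \<subseteq> K" using A B L by (auto simp: quotient_basis_def)
    show "complex_vs.independent (A \<union> B)"
      using independent_Un_disjoint_span[OF _ _ AB] A B by (simp add: quotient_basis_def)
    have "x = 0" if x: "x \<in> cspan (A \<union> B)" "x \<in> L" for x
    proof -
      from x obtain u v where uv: "x = u + v" "u \<in> cspan A" "v \<in> cspan B"
        by (auto simp: complex_vs.span_Un)
      have "x - v \<in> M" using complex_vs.subspace_diff[OF M, of x v] x(2) uv(3) L(2) BM by blast
      with uv AM have "u = 0" by auto
      with uv x B show ?thesis by (auto simp: quotient_basis_def)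
    qed
    then show "cspan (A \<union> B) \<inter> L = {0}"
      using complex_vs.span_zero[of "A \<union> B"] complex_vs.subspace_0[OF L(1)] by blast
    fix x assume "x \<in> K"
    then obtain a where a: "a \<in> cspan A" "x - a \<in> M" using A by (auto simp: quotient_basis_def)
    then obtain b where b: "b \<in> cspan B" "x - a - b \<in> L" using B by (auto simp: quotient_basis_def)
    have "a + b \<in> cspan (A \<union> B)" using a b by (auto simp: complex_vs.span_Un)
    moreover have "x - (a + b) \<in> L" using b(2) by (simp add: diff_diff_eq)
    ultimately show "\<exists>c\<in>cspan (A \<union> B). x - c \<in> L" by blast
  qed
  moreover have "A \<inter> B = {}"
  proof -
    have "A \<inter> B \<subseteq> {0}"
      using AB complex_vs.span_superset[of A] complex_vs.span_superset[of B] by blast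
    moreover have "0 \<notin> A" using A complex_vs.dependent_zero by (auto simp: quotient_basis_def)
    ultimately show ?thesis by auto
  qed
  ultimately show ?thesis ..
qed

lemma has_quotient_dim_tower:
  assumes "csubspace M" "csubspace L" "L \<subseteq> M" "M \<subseteq> K"
    and "has_quotient_dim K M m" "has_quotient_dim M L l"
  shows "has_quotient_dim K L (m + l)"
proof -
  obtain A B where "finite A" "card A = m" "quotient_basis K M A"
    "finite B" "card B = l" "quotient_basis M L B"
    using assms(5,6) by (auto simp: has_quotient_dim_def)
  with quotient_basis_tower[OF assms(1-4), of A B] show ?thesis
    unfolding has_quotient_dim_def by (intro exI[of _ "A \<union> B"]) (auto simp: card_Un_disjoint)
qed

text \<open>Converse of the tower law: bases of \<open>K / M\<close> and \<open>M / L\<close> exist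
  in any case, and their disjoint union is a basis of \<open>K / L\<close>, whose size is known.
  This is how finiteness descends to the steps of a filtration.\<close>

lemma has_quotient_dim_split:
  assumes K: "csubspace K" and M: "csubspace M" and L: "csubspace L" "L \<subseteq> M" "M \<subseteq> K"
    and n: "has_quotient_dim K L n"
  obtains m l where "has_quotient_dim K M m" "has_quotient_dim M L l" "n = m + l"
proof -
  obtain A where A: "quotient_basis K M A" using quotient_basis_exists[OF K M L(3)] .
  obtain B where B: "quotient_basis M L B" using quotient_basis_exists[OF M L(1,2)] .
  from quotient_basis_tower[OF M L A B] have AB: "quotient_basis K L (A \<union> B)" "A \<inter> B = {}" by auto
  have fin: "finite (A \<union> B)" "card (A \<union> B) = n"
    using has_quotient_dim_quotient_basis[OF L(1) n AB(1)] by auto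
  then have "finite A" "finite B" "n = card A + card B"
    using card_Un_disjoint[OF _ _ AB(2)] by auto
  with A B show thesis by (intro that[of "card A" "card B"]) (auto simp: has_quotient_dim_def)
qed

lemma has_quotient_dim_subspace:
  assumes "csubspace K" "csubspace M" "M \<subseteq> K" "has_quotient_dim K {0} n"
  obtains l where "has_quotient_dim M {0} l"
  using has_quotient_dim_split[OF assms(1,2) complex_vs.subspace_single_0 _ assms(3,4)]
    complex_vs.subspace_0[OF assms(2)] by auto

section \<open>Projections and adjoints in real Hilbert spaces\<close>

lemma nearest_point_in_closed_subspace:
  fixes M :: "'a::{real_inner, complete_space} set"
  assumes M: "closed M" "subspace M"
  obtains p where "p \<in> M" "\<And>m. m \<in> M \<Longrightarrow> norm (x - p) \<le> norm (x - m)"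
proof -
  define D where "D = (\<lambda>m. (norm (x - m))\<^sup>2) ` M"
  have "0 \<in> M" using M(2) by (rule subspace_0)
  then have ne: "D \<noteq> {}" by (auto simp: D_def)
  have bdd: "bdd_below D" by (auto simp: D_def bdd_below_def intro!: exI[of _ 0])
  define d where "d = Inf D"
  have d: "d \<le> (norm (x - m))\<^sup>2" if "m \<in> M" for m
    unfolding d_def by (rule cInf_lower[OF _ bdd]) (use that in \<open>auto simp: D_def\<close>)
  have "\<exists>m\<in>M. (norm (x - m))\<^sup>2 < d + 1 / Suc n" for n
    using cInf_lessD[OF ne, of "d + 1 / Suc n"] unfolding d_def[symmetric] by (auto simp: D_def)
  then obtain m where m: "\<And>n. m n \<in> M" "\<And>n. (norm (x - m n))\<^sup>2 < d + 1 / Suc n"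
    by metis
  have near: "(norm (m i - m j))\<^sup>2 \<le> 2 * (1 / Suc i + 1 / Suc j)" for i j
  proof -
    have mid: "(1/2) *\<^sub>R (m i + m j) \<in> M"
      using m(1) M(2) by (simp add: subspace_add subspace_scale)
    \<comment> \<open>Parallelogram law; the midpoint lies in the subspace, so its squared distance
      to \<open>x\<close> is at least the infimum \<open>d\<close>, and the terms in
      \<open>d\<close> cancel.\<close>
    have "(norm (m i - m j))\<^sup>2 = 2 * (norm (x - m i))\<^sup>2 + 2 * (norm (x - m j))\<^sup>2
        - 4 * (norm (x - (1/2) *\<^sub>R (m i + m j)))\<^sup>2"
      by (simp add: power2_norm_eq_inner inner_diff_left inner_diff_right inner_add_left
          inner_add_right inner_commute algebra_simps)
    also have "\<dots> \<le> 2 * (1 / Suc i + 1 / Suc j)"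
      using m(2)[of i] m(2)[of j] d[OF mid] by simp
    finally show ?thesis .
  qed
  have "Cauchy m"
  proof (rule metric_CauchyI)
    fix e :: real assume e: "0 < e"
    obtain n where n: "4 / e\<^sup>2 < real n" using reals_Archimedean2 by blast
    have "dist (m i) (m j) < e" if "i \<ge> n" "j \<ge> n" for i j
    proof -
      have npos: "0 < real n" using n e by (meson divide_pos_pos less_trans zero_less_numeral zero_less_power)
      have "1 / Suc i \<le> 1 / real n" "1 / Suc j \<le> 1 / real n"
        using that npos by (auto intro!: divide_left_mono)
      then have "(norm (m i - m j))\<^sup>2 \<le> 4 / real n" using near[of i j] by simp
      also have "\<dots> < e\<^sup>2" using n npos e by (simp add: field_simps)
      finally show ?thesis using e by (simp add: dist_norm power2_less_imp_less)
    qed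
    then show "\<exists>N. \<forall>i\<ge>N. \<forall>j\<ge>N. dist (m i) (m j) < e" by blast
  qed
  then obtain p where p: "m \<longlonglongrightarrow> p" using Cauchy_convergent convergent_def by blast
  have pM: "p \<in> M" using closed_sequentially[OF M(1) _ p] m(1) by simp
  have "(\<lambda>n. d + 1 / Suc n) \<longlonglongrightarrow> d + 0"
    by (intro tendsto_add tendsto_const LIMSEQ_inverse_real_of_nat[unfolded inverse_eq_divide])
  moreover have "(\<lambda>n. (norm (x - m n))\<^sup>2) \<longlonglongrightarrow> (norm (x - p))\<^sup>2"
    by (intro tendsto_intros p)
  ultimately have "(norm (x - p))\<^sup>2 \<le> d"
    using m(2) by (intro LIMSEQ_le[of _ _ "\<lambda>n. d + 1 / Suc n" d]) (auto intro!: less_imp_le)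
  then have "(norm (x - p))\<^sup>2 \<le> (norm (x - m))\<^sup>2" if "m \<in> M" for m
    using d[OF that] by linarith
  then have "norm (x - p) \<le> norm (x - m)" if "m \<in> M" for m
    using that by (meson norm_ge_zero power2_le_imp_le)
  with pM show thesis by (rule that)
qed

lemma orthogonal_decomposition_exists:
  fixes M :: "'a::{real_inner, complete_space} set"
  assumes "closed M" "subspace M"
  shows "\<exists>p\<in>M. \<forall>m\<in>M. inner (x - p) m = 0"
proof -
  obtain p where p: "p \<in> M" "\<And>m. m \<in> M \<Longrightarrow> norm (x - p) \<le> norm (x - m)"
    using nearest_point_in_closed_subspace[OF assms, of x] by blast
  have "inner (x - p) m = 0" if m: "m \<in> M" for m
  proof -
    \<comment> \<open>Moving \<open>p\<close> by \<open>t\<close> in direction \<open>m\<close>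
      cannot decrease the distance. The denominator \<open>q + 1\<close> in place of
      \<open>q\<close> keeps \<open>t\<close> meaningful for \<open>m = 0\<close>.\<close>
    define s q t where "s = inner (x - p) m" and "q = inner m m" and "t = s / (q + 1)"
    have q: "q \<ge> 0" by (simp add: q_def)
    have "norm (x - p) \<le> norm (x - (p + t *\<^sub>R m))"
      using p m assms(2) by (intro p(2)) (simp add: subspace_add subspace_scale)
    then have "(norm (x - p))\<^sup>2 \<le> (norm ((x - p) - t *\<^sub>R m))\<^sup>2"
      by (simp add: diff_diff_eq power_mono)
    also have "\<dots> = (norm (x - p))\<^sup>2 - 2 * t * s + t\<^sup>2 * q"
      unfolding s_def q_def power2_norm_eq_inner
      by (simp add: inner_diff_left[of "x - p"] inner_diff_right[of _ "x - p"] inner_commute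
          algebra_simps power2_eq_square)
    finally have "2 * t * s \<le> t\<^sup>2 * q" by simp
    moreover have s: "s = t * (q + 1)" using q by (simp add: t_def)
    ultimately have "2 * t\<^sup>2 * (q + 1) \<le> t\<^sup>2 * q" by (simp add: power2_eq_square algebra_simps)
    then have "t\<^sup>2 * (q + 2) \<le> 0" by (simp add: algebra_simps)
    then have "t = 0" using q by (simp add: mult_le_0_iff)
    with s show ?thesis by (simp add: s_def)
  qed
  with p(1) show ?thesis by blast
qed

text \<open>Based on the real inner product only; on complex subspaces real and complex
  orthogonality coincide (\<open>csubspace_inner_zero_iff\<close>), so the same map serves as the
  complex orthogonal projection. The choice is determined when \<open>M\<close> is a closed
  subspace.\<close>

definition hproj :: "'a::{real_inner, complete_space} set \<Rightarrow> 'a \<Rightarrow> 'a" where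
  "hproj M x = (SOME p. p \<in> M \<and> (\<forall>m\<in>M. inner (x - p) m = 0))"

context
  fixes M :: "'a::{real_inner, complete_space} set"
  assumes M: "closed M" "subspace M"
begin

lemma hproj_in: "hproj M x \<in> M"
  and hproj_orthogonal: "m \<in> M \<Longrightarrow> inner (x - hproj M x) m = 0"
proof -
  have "hproj M x \<in> M \<and> (\<forall>m\<in>M. inner (x - hproj M x) m = 0)"
    unfolding hproj_def using orthogonal_decomposition_exists[OF M, of x]
    by (intro someI_ex[of "\<lambda>p. p \<in> M \<and> (\<forall>m\<in>M. inner (x - p) m = 0)"]) auto
  then show "hproj M x \<in> M" "m \<in> M \<Longrightarrow> inner (x - hproj M x) m = 0" by auto
qed

lemma hproj_unique:
  assumes "p \<in> M" "\<And>m. m \<in> M \<Longrightarrow> inner (x - p) m = 0"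
  shows "hproj M x = p"
proof -
  define r where "r = hproj M x - p"
  have r: "r \<in> M" using hproj_in[of x] assms(1) M(2) by (simp add: r_def subspace_diff)
  have "inner r r = inner (x - p) r - inner (x - hproj M x) r"
    by (simp add: r_def inner_diff_left)
  also have "\<dots> = 0" using assms(2)[OF r] hproj_orthogonal[OF r] by simp
  finally show ?thesis by (simp add: r_def)
qed

lemma hproj_ident: "x \<in> M \<Longrightarrow> hproj M x = x"
  by (rule hproj_unique) auto

lemma inner_hproj: "m \<in> M \<Longrightarrow> inner (hproj M x) m = inner x m"
  using hproj_orthogonal[of m x] by (simp add: inner_diff_left)

lemma hproj_norm_le: "norm (hproj M x) \<le> norm x"
proof -
  have "(norm (hproj M x))\<^sup>2 = inner x (hproj M x)"
    by (simp add: power2_norm_eq_inner inner_hproj hproj_in)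
  also have "\<dots> \<le> norm x * norm (hproj M x)" by (rule norm_cauchy_schwarz)
  finally show ?thesis
    by (cases "norm (hproj M x) = 0") (auto simp: power2_eq_square)
qed

lemma bounded_linear_hproj: "bounded_linear (hproj M)"
proof (rule bounded_linear_intro[of _ 1])
  fix x y :: 'a and r :: real
  show "hproj M (x + y) = hproj M x + hproj M y"
    using hproj_in M(2)
    by (intro hproj_unique) (simp_all add: subspace_add inner_diff_left inner_add_left inner_hproj)
  show "hproj M (r *\<^sub>R x) = r *\<^sub>R hproj M x"
    using hproj_in M(2)
    by (intro hproj_unique) (simp_all add: subspace_scale inner_diff_left inner_hproj)
qed (simp add: hproj_norm_le)

end

lemma hproj_eq_0_iff:
  assumes "closed M" "subspace M"
  shows "hproj M x = 0 \<longleftrightarrow> (\<forall>m\<in>M. inner x m = 0)"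
  using hproj_unique[OF assms, of 0 x] inner_hproj[OF assms, of _ x] assms(2)
  by (auto simp: subspace_0)

lemma riesz_representation:
  fixes f :: "'a::{real_inner, complete_space} \<Rightarrow> real"
  assumes "bounded_linear f"
  obtains z where "\<And>x. f x = inner x z"
proof (cases "\<forall>x. f x = 0")
  case True
  then show thesis by (intro that[of 0]) simp
next
  case False
  interpret f: bounded_linear f by fact
  from False obtain x where x: "f x \<noteq> 0" by auto
  define M where "M = f -` {0}"
  have M: "closed M" "subspace M"
    unfolding M_def
    by (auto simp: subspace_def f.add f.scaleR f.zero
        intro!: continuous_closed_vimage linear_continuous_at assms)
  \<comment> \<open>\<open>u\<close> is orthogonal to the kernel \<open>M\<close> of
    \<open>f\<close>, and every \<open>y\<close> differs from \<open>(f y / f u) *\<^sub>R u\<close>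
    by an element of \<open>M\<close>; so \<open>f\<close> is a multiple of the inner product with
    \<open>u\<close>.\<close>
  define u where "u = x - hproj M x"
  have fu: "f u = f x" using hproj_in[OF M, of x] by (simp add: u_def f.diff M_def)
  have orth: "inner m u = 0" if "m \<in> M" for m
    using hproj_orthogonal[OF M that, of x] by (simp add: u_def inner_commute)
  have u: "inner u u \<noteq> 0" using fu x f.zero by auto
  have "f y = inner y ((f u / inner u u) *\<^sub>R u)" for y
  proof -
    have "y - (f y / f u) *\<^sub>R u \<in> M" using fu x by (simp add: M_def f.diff f.scaleR)
    from orth[OF this] have "inner y u = f y / f u * inner u u" by (simp add: inner_diff_left)
    then show ?thesis using u fu x by (simp add: field_simps)
  qed
  then show thesis by (rule that)
qed

lemma adjoint_exists:
  fixes f :: "'a::{real_inner, complete_space} \<Rightarrow> 'b::{real_inner, complete_space}"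
  assumes "bounded_linear f"
  obtains g where "bounded_linear g" "\<And>x y. inner (f x) y = inner x (g y)"
proof -
  interpret f: bounded_linear f by fact
  have "\<exists>z. \<forall>x. inner (f x) y = inner x z" for y
  proof -
    have "bounded_linear (\<lambda>x. inner (f x) y)"
      using bounded_linear_compose[OF bounded_linear_inner_left assms] .
    from riesz_representation[OF this] show ?thesis by metis
  qed
  then obtain g where g: "\<And>x y. inner (f x) y = inner x (g y)" by metis
  obtain K where K: "\<And>x. norm (f x) \<le> norm x * K" "K > 0" using f.pos_bounded by blast
  have "bounded_linear g"
  proof (rule bounded_linear_intro[of _ K])
    fix x y and r :: real
    have "\<forall>z. inner z (g (x + y)) = inner z (g x + g y)"
      by (simp add: g[symmetric] inner_add_right)
    then show "g (x + y) = g x + g y" by (simp only: vector_eq_ldot)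
    have "\<forall>z. inner z (g (r *\<^sub>R x)) = inner z (r *\<^sub>R g x)"
      by (simp add: g[symmetric])
    then show "g (r *\<^sub>R x) = r *\<^sub>R g x" by (simp only: vector_eq_ldot)
    have "(norm (g x))\<^sup>2 = inner (f (g x)) x" by (simp add: power2_norm_eq_inner g)
    also have "\<dots> \<le> norm (f (g x)) * norm x" by (rule norm_cauchy_schwarz)
    also have "\<dots> \<le> (norm (g x) * K) * norm x" by (intro mult_right_mono K) auto
    finally show "norm (g x) \<le> norm x * K"
      by (cases "norm (g x) = 0") (use K in \<open>auto simp: power2_eq_square algebra_simps\<close>)
  qed
  then show thesis using g by (rule that)
qed

lemma subspace_closure:
  fixes S :: "'a::real_normed_vector set"
  assumes S: "subspace S"
  shows "subspace (closure S)"
  unfolding subspace_def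
proof (intro conjI ballI allI)
  show "0 \<in> closure S" using subspace_0[OF S] closure_subset by blast
  fix x and c :: real assume "x \<in> closure S"
  then obtain u where u: "\<And>n. u n \<in> S" "u \<longlonglongrightarrow> x" unfolding closure_sequential by blast
  show "c *\<^sub>R x \<in> closure S"
    unfolding closure_sequential
    by (rule exI[of _ "\<lambda>n. c *\<^sub>R u n"]) (auto intro!: tendsto_intros u subspace_scale S)
  fix y assume "y \<in> closure S"
  then obtain v where v: "\<And>n. v n \<in> S" "v \<longlonglongrightarrow> y" unfolding closure_sequential by blast
  show "x + y \<in> closure S"
    unfolding closure_sequential
    by (rule exI[of _ "\<lambda>n. u n + v n"]) (auto intro!: tendsto_intros u v subspace_add S)
qed

section \<open>Surjective operators\<close>

text \<open>Uniform boundedness principle: the closed sets \<open>E n\<close> cover the space, so by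
  Baire one of them contains a ball. Comparing its centre with the point at distance
  \<open>r\<close> from it in the direction of \<open>y\<close> bounds the norm of
  \<open>y\<close>.\<close>

lemma uniformly_bounded_functionals:
  fixes Y :: "'a::{real_inner, complete_space} set"
  assumes "\<And>z. \<exists>c. \<forall>y\<in>Y. \<bar>inner y z\<bar> \<le> c"
  obtains C where "\<And>y. y \<in> Y \<Longrightarrow> norm y \<le> C"
proof -
  define E where "E n = {z. \<forall>y\<in>Y. \<bar>inner y z\<bar> \<le> real n}" for n
  have closed: "closed (E n)" for n
  proof -
    have "E n = (\<Inter>y\<in>Y. {z. \<bar>inner y z\<bar> \<le> real n})" by (auto simp: E_def)
    then show ?thesis by (auto intro!: closed_INT closed_Collect_le continuous_intros)
  qed
  have "(\<Union>n. E n) = UNIV"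
  proof -
    have "z \<in> (\<Union>n. E n)" for z
    proof -
      obtain c where c: "\<forall>y\<in>Y. \<bar>inner y z\<bar> \<le> c" using assms by blast
      obtain n where "c \<le> real n" using real_arch_simple by blast
      with c have "z \<in> E n" by (auto simp: E_def intro: order_trans)
      then show ?thesis by blast
    qed
    then show ?thesis by blast
  qed
  moreover have "Met_TC.mtopology interior_of (\<Union>(range E)) = {}" if "\<And>n. interior (E n) = {}"
    by (rule Met_TC.metric_Baire_category_alt)
      (use that closed in \<open>auto simp: complete_UNIV\<close>)
  ultimately have "\<exists>n. interior (E n) \<noteq> {}" by fastforce
  then obtain n z where "z \<in> interior (E n)" by blast
  then obtain r where r: "r > 0" "cball z r \<subseteq> E n" by (meson mem_interior_cball)
  have "norm y \<le> 2 * real n / r" if y: "y \<in> Y" for y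
  proof (cases "y = 0")
    case False
    define v where "v = (r / norm y) *\<^sub>R y"
    have "z \<in> E n" "z + v \<in> E n"
      using r False by (auto simp: v_def dist_norm)
    then have "\<bar>inner y z\<bar> \<le> real n" "\<bar>inner y z + inner y v\<bar> \<le> real n"
      using y by (auto simp: E_def inner_add_right)
    moreover have "inner y v = r * norm y"
      using False by (simp add: v_def power2_norm_eq_inner[symmetric] power2_eq_square)
    ultimately have "r * norm y \<le> 2 * real n" by simp
    then show ?thesis using r by (simp add: field_simps)
  qed (use r in simp)
  then show thesis by (rule that)
qed

text \<open>The set \<open>Y\<close> of all \<open>y\<close> with \<open>norm (g y) \<le> 1\<close>
  is weakly bounded: every \<open>z\<close> is some \<open>f x\<close>, and
  \<open>inner y (f x) = inner (g y) x\<close> is at most \<open>norm x\<close> in modulus. Hence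
  \<open>Y\<close> is norm bounded, and rescaling gives the estimate.\<close>

lemma surjective_adjoint_bounded_below:
  fixes f :: "'a::{real_inner, complete_space} \<Rightarrow> 'b::{real_inner, complete_space}"
  assumes f: "bounded_linear f" "surj f" and g: "bounded_linear g"
    and adj: "\<And>x y. inner (f x) y = inner x (g y)"
  obtains C where "C \<ge> 0" "\<And>y. norm y \<le> C * norm (g y)"
proof -
  interpret g: bounded_linear g by fact
  define Y where "Y = {y. norm (g y) \<le> 1}"
  have "\<exists>c. \<forall>y\<in>Y. \<bar>inner y z\<bar> \<le> c" for z
  proof -
    obtain x where x: "z = f x" using f(2) by blast
    have "\<bar>inner y z\<bar> \<le> norm x" if "y \<in> Y" for y
    proof -
      have "\<bar>inner y z\<bar> = \<bar>inner x (g y)\<bar>" by (simp add: x adj[symmetric] inner_commute)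
      also have "\<dots> \<le> norm x * norm (g y)" by (rule Cauchy_Schwarz_ineq2)
      also have "\<dots> \<le> norm x * 1" using that by (intro mult_left_mono) (auto simp: Y_def)
      finally show ?thesis by simp
    qed
    then show ?thesis by blast
  qed
  then obtain C where C: "\<And>y. y \<in> Y \<Longrightarrow> norm y \<le> C"
    using uniformly_bounded_functionals by blast
  have C0: "C \<ge> 0" using C[of 0] by (simp add: Y_def g.zero)
  have "norm y \<le> C * norm (g y)" for y
  proof (cases "g y = 0")
    case True
    have "y = 0"
    proof -
      \<comment> \<open>All multiples of a vector killed by \<open>g\<close> lie in
        \<open>Y\<close>; if \<open>y\<close> were nonzero, this one would have norm
        \<open>C + 1\<close>, beyond the bound for \<open>Y\<close>.\<close>
      have "norm (((C + 1) / norm y) *\<^sub>R y) \<le> C"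
        by (rule C) (simp add: Y_def g.scaleR True)
      then show ?thesis using C0 by (cases "y = 0") auto
    qed
    then show ?thesis using g.zero by simp
  next
    case False
    have "norm ((1 / norm (g y)) *\<^sub>R y) \<le> C"
      by (rule C) (simp add: Y_def g.scaleR False)
    then show ?thesis using False by (simp add: field_simps)
  qed
  with C0 show thesis by (rule that)
qed

text \<open>
  The preimage of least norm lies in the closure of the range of the adjoint \<open>g\<close> of \<open>f\<close>, and
  \<open>(norm (g y))\<^sup>2 = inner (f (g y)) y\<close> together with the lower bound for \<open>g\<close> controls its norm.
\<close>

lemma surjective_bounded_preimage:
  fixes f :: "'a::{real_inner, complete_space} \<Rightarrow> 'b::{real_inner, complete_space}"
  assumes f: "bounded_linear f" "surj f"
  obtains C where "\<And>y. \<exists>x. f x = y \<and> norm x \<le> C * norm y"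
proof -
  interpret f: bounded_linear f by fact
  obtain g where g: "bounded_linear g" and adj: "\<And>x y. inner (f x) y = inner x (g y)"
    using adjoint_exists[OF f(1)] by blast
  obtain C where C: "C \<ge> 0" "\<And>y. norm y \<le> C * norm (g y)"
    using surjective_adjoint_bounded_below[OF f g adj] by blast
  interpret g: bounded_linear g by fact
  define M where "M = closure (range g)"
  have "subspace (range g)"
    using linear_subspace_image[OF g.linear subspace_UNIV] by simp
  then have M: "closed M" "subspace M"
    by (auto simp: M_def subspace_closure)
  have "\<exists>x. f x = y \<and> norm x \<le> C * norm y" for y
  proof -
    obtain x1 where x1: "f x1 = y" using f(2) by (metis surjD)
    define x where "x = hproj M x1"
    have "g z \<in> M" for z
      unfolding M_def using closure_subset[of "range g"] by (rule subsetD) simp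
    then have "inner (f (x1 - x)) z = 0" for z
      using hproj_orthogonal[OF M, of "g z" x1] by (simp add: adj x_def)
    from this[of "f (x1 - x)"] have fx: "f x = y" by (simp add: f.diff x1)
    have "x \<in> M" by (simp add: x_def hproj_in M)
    then obtain z where z: "\<And>n. z n \<in> range g" "z \<longlonglongrightarrow> x"
      unfolding M_def closure_sequential by blast
    then have "\<exists>v. z n = g v" for n by blast
    then obtain w where w: "\<And>n. z n = g (w n)" by metis
    have "inner x (z n) \<le> norm y * (C * norm (z n))" for n
    proof -
      have "inner x (z n) = inner y (w n)" by (simp add: w adj[symmetric] fx)
      also have "\<dots> \<le> norm y * norm (w n)" by (rule norm_cauchy_schwarz)
      also have "\<dots> \<le> norm y * (C * norm (z n))" using C(2) by (intro mult_left_mono) (auto simp: w)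
      finally show ?thesis .
    qed
    moreover have "(\<lambda>n. inner x (z n)) \<longlonglongrightarrow> inner x x"
      "(\<lambda>n. norm y * (C * norm (z n))) \<longlonglongrightarrow> norm y * (C * norm x)"
      by (intro tendsto_intros z)+
    ultimately have "inner x x \<le> norm y * (C * norm x)" by (intro LIMSEQ_le) auto
    then have "norm x * norm x \<le> (C * norm y) * norm x"
      by (simp add: power2_norm_eq_inner[symmetric] power2_eq_square algebra_simps)
    then have "norm x \<le> C * norm y" using C(1) by (cases "norm x = 0") auto
    with fx show ?thesis by blast
  qed
  then show thesis by (rule that)
qed

section \<open>Bounded operators on complex Hilbert spaces\<close>

lemma cinner_scaleC_right: "cinner x (c *\<^sub>C y) = cnj c * cinner x y"
  by (metis cinner_commute cinner_scaleC_left complex_cnj_mult)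

lemma inner_scaleC_left: "inner (c *\<^sub>C x) y = inner x (cnj c *\<^sub>C y)"
  by (simp add: inner_eq_Re_cinner cinner_scaleC_left cinner_scaleC_right)

lemma cinner_eq_inner: "cinner x y = Complex (inner x y) (inner x (\<i> *\<^sub>C y))"
  by (simp add: complex_eq_iff inner_eq_Re_cinner cinner_scaleC_right)

lemma cinner_self: "cinner x x = complex_of_real ((norm x)\<^sup>2)"
proof -
  have "Im (cinner x x) = 0"
    using arg_cong[OF cinner_commute[of x x], of Im] by simp
  then show ?thesis by (simp add: complex_eq_iff power2_norm_eq_inner inner_eq_Re_cinner)
qed

lemma norm_scaleC: "norm (c *\<^sub>C x) = cmod c * norm x"
proof -
  have "complex_of_real ((norm (c *\<^sub>C x))\<^sup>2) = c * cnj c * complex_of_real ((norm x)\<^sup>2)"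
    by (simp only: cinner_self[symmetric] cinner_scaleC_left cinner_scaleC_right mult.assoc mult.left_commute)
  also have "\<dots> = complex_of_real ((cmod c * norm x)\<^sup>2)"
    by (simp only: complex_norm_square[symmetric] of_real_mult of_real_power power_mult_distrib)
  finally have "(norm (c *\<^sub>C x))\<^sup>2 = (cmod c * norm x)\<^sup>2" by (simp only: of_real_eq_iff)
  then show ?thesis by simp
qed

lemma clinear_iff: "clinear f \<longleftrightarrow> (\<forall>x y. f (x + y) = f x + f y) \<and> (\<forall>c x. f (c *\<^sub>C x) = c *\<^sub>C f x)"
  by (simp add: Vector_Spaces.linear_iff complex_vs.vector_space_axioms)

lemma bounded_clinear_iff: "bounded_clinear f \<longleftrightarrow> bounded_linear f \<and> clinear f"
  by (auto simp: bounded_clinear_def clinear_iff linear_simps(1))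

lemma bounded_clinear_bounded_linear: "bounded_clinear f \<Longrightarrow> bounded_linear f"
  and bounded_clinear_clinear: "bounded_clinear f \<Longrightarrow> clinear f"
  by (simp_all add: bounded_clinear_iff)

lemma bounded_clinear_intro:
  assumes "clinear f" "\<And>x. norm (f x) \<le> norm x * K"
  shows "bounded_clinear f"
proof -
  have "f (r *\<^sub>R x) = r *\<^sub>R f x" for r x
    using assms(1) by (simp add: clinear_iff scaleC_of_real[symmetric])
  then have "bounded_linear f"
    using assms by (intro bounded_linear_intro[of f K]) (auto simp: clinear_iff)
  with assms(1) show ?thesis by (simp add: bounded_clinear_iff)
qed

lemma bounded_clinear_compose:
  "bounded_clinear f \<Longrightarrow> bounded_clinear g \<Longrightarrow> bounded_clinear (\<lambda>x. f (g x))"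
  by (simp add: bounded_clinear_def bounded_linear_compose)

lemma bounded_clinear_add:
  "bounded_clinear f \<Longrightarrow> bounded_clinear g \<Longrightarrow> bounded_clinear (\<lambda>x. f x + g x)"
  by (simp add: bounded_clinear_def bounded_linear_add scaleC_add_right)

lemma bounded_clinear_diff:
  "bounded_clinear f \<Longrightarrow> bounded_clinear g \<Longrightarrow> bounded_clinear (\<lambda>x. f x - g x)"
  by (simp add: bounded_clinear_def bounded_linear_sub complex_vs.scale_right_diff_distrib)

lemma bounded_clinear_minus: "bounded_clinear f \<Longrightarrow> bounded_clinear (\<lambda>x. - f x)"
  by (simp add: bounded_clinear_def bounded_linear_minus)

lemma bounded_clinear_ident: "bounded_clinear (\<lambda>x. x)"
  by (simp add: bounded_clinear_def bounded_linear_ident)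

lemma bounded_clinear_scaleC: "bounded_clinear (\<lambda>x. c *\<^sub>C x)"
  by (rule bounded_clinear_intro[of _ "cmod c"])
    (simp_all add: clinear_iff scaleC_add_right norm_scaleC mult.commute)

lemma bounded_clinear_scaleR:
  assumes "bounded_clinear f" shows "bounded_clinear (\<lambda>x. r *\<^sub>R f x)"
  using bounded_clinear_compose[OF bounded_clinear_scaleC assms, of "complex_of_real r"]
  by (simp add: scaleC_of_real)

lemma bounded_clinear_fst: "bounded_clinear fst"
  and bounded_clinear_snd: "bounded_clinear snd"
  by (simp_all add: bounded_clinear_def bounded_linear_fst bounded_linear_snd scaleC_prod_def)

lemma bounded_clinear_Pair:
  "bounded_clinear f \<Longrightarrow> bounded_clinear g \<Longrightarrow> bounded_clinear (\<lambda>x. (f x, g x))"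
  by (simp add: bounded_clinear_def bounded_linear_Pair scaleC_prod_def)

lemma csubspace_subspace: "csubspace M \<Longrightarrow> subspace M"
  by (auto simp: complex_vs.subspace_def subspace_def scaleC_of_real[symmetric])

text \<open>The imaginary part of \<open>cinner x m\<close> is
  \<open>inner x (\<i> *\<^sub>C m)\<close>, and \<open>M\<close> contains
  \<open>\<i> *\<^sub>C m\<close> together with \<open>m\<close>.\<close>

lemma csubspace_inner_zero_iff:
  assumes "csubspace M"
  shows "(\<forall>m\<in>M. cinner x m = 0) \<longleftrightarrow> (\<forall>m\<in>M. inner x m = 0)"
  using assms by (auto simp: cinner_eq_inner complex_eq_iff complex_vs.subspace_def)

lemma csubspace_range: "clinear f \<Longrightarrow> csubspace (range f)"
  using complex_vs_pair.linear_subspace_image[of f UNIV] by simp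

lemma csubspace_vimage: "clinear f \<Longrightarrow> csubspace S \<Longrightarrow> csubspace (f -` S)"
  by (rule complex_vs_pair.linear_subspace_vimage)

lemma csubspace_closure:
  assumes S: "csubspace S"
  shows "csubspace (closure S)"
proof (rule complex_vs.subspaceI)
  have "subspace (closure S)" using S by (intro subspace_closure csubspace_subspace)
  then show "0 \<in> closure S" "\<And>x y. x \<in> closure S \<Longrightarrow> y \<in> closure S \<Longrightarrow> x + y \<in> closure S"
    by (simp_all add: subspace_0 subspace_add)
  fix c x assume "x \<in> closure S"
  then obtain u where u: "\<And>n. u n \<in> S" "u \<longlonglongrightarrow> x" unfolding closure_sequential by blast
  have "(\<lambda>n. c *\<^sub>C u n) \<longlonglongrightarrow> c *\<^sub>C x"
    by (rule bounded_linear.tendsto[OF bounded_clinear_bounded_linear[OF bounded_clinear_scaleC] u(2)])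
  moreover have "c *\<^sub>C u n \<in> S" for n using u(1) S by (simp add: complex_vs.subspace_scale)
  ultimately show "c *\<^sub>C x \<in> closure S"
    unfolding closure_sequential by (intro exI[of _ "\<lambda>n. c *\<^sub>C u n"]) auto
qed

lemma bounded_clinear_hproj:
  assumes M: "closed M" "csubspace M"
  shows "bounded_clinear (hproj M)"
proof -
  note RM = M(1) csubspace_subspace[OF M(2)]
  have "hproj M (c *\<^sub>C x) = c *\<^sub>C hproj M x" for c x
  proof (rule hproj_unique[OF RM])
    show "c *\<^sub>C hproj M x \<in> M" by (simp add: hproj_in RM M complex_vs.subspace_scale)
    fix m assume "m \<in> M"
    then have "cnj c *\<^sub>C m \<in> M" by (simp add: M complex_vs.subspace_scale)
    from hproj_orthogonal[OF RM this, of x]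
    show "inner (c *\<^sub>C x - c *\<^sub>C hproj M x) m = 0"
      by (simp add: inner_scaleC_left complex_vs.scale_right_diff_distrib[symmetric])
  qed
  with bounded_linear_hproj[OF RM] show ?thesis by (simp add: bounded_clinear_def)
qed

section \<open>Closed ranges\<close>

lemma continuous_on_cinner_scaleC:
  fixes w :: "'a::complex_hilbert_space"
  shows "continuous_on UNIV (\<lambda>y. (cinner y w / complex_of_real r) *\<^sub>C w)"
proof -
  have eq: "(\<lambda>y. (cinner y w / complex_of_real r) *\<^sub>C w)
      = (\<lambda>y. (inner y w / r) *\<^sub>R w + (inner y (\<i> *\<^sub>C w) / r) *\<^sub>R (\<i> *\<^sub>C w))"
  proof
    fix y
    have "cinner y w / complex_of_real r
        = complex_of_real (inner y w / r) + complex_of_real (inner y (\<i> *\<^sub>C w) / r) * \<i>"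
      by (simp add: cinner_eq_inner complex_eq_iff)
    then show "(cinner y w / complex_of_real r) *\<^sub>C w
        = (inner y w / r) *\<^sub>R w + (inner y (\<i> *\<^sub>C w) / r) *\<^sub>R (\<i> *\<^sub>C w)"
      by (simp only: scaleC_add_left scaleC_scaleC[symmetric] scaleC_of_real)
  qed
  show ?thesis by (subst eq) (auto simp: divide_inverse intro!: continuous_intros)
qed

text \<open>With \<open>w\<close> the part of \<open>v\<close> orthogonal to \<open>L\<close>,
  membership of \<open>y\<close> means that the part of \<open>y\<close> orthogonal to
  \<open>L\<close> equals \<open>k y *\<^sub>C w\<close>, an equation between continuous functions
  of \<open>y\<close>. If \<open>v\<close> lies in \<open>L\<close>, then \<open>w = 0\<close> and
  the equation describes \<open>L\<close> itself.\<close>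

lemma closed_csubspace_plus_line:
  fixes L :: "'a::complex_hilbert_space set"
  assumes L: "closed L" "csubspace L"
  shows "closed {x + c *\<^sub>C v | x c. x \<in> L}"
proof -
  note RL = L(1) csubspace_subspace[OF L(2)]
  interpret Q: Vector_Spaces.linear scaleC scaleC "hproj L"
    using bounded_clinear_hproj[OF L] by (rule bounded_clinear_clinear)
  define w where "w = v - hproj L v"
  define k where "k y = cinner y w / complex_of_real ((norm w)\<^sup>2)" for y
  have orth: "cinner l w = 0" if "l \<in> L" for l
  proof -
    have "cinner w l = 0"
      using csubspace_inner_zero_iff[OF L(2), of w] hproj_orthogonal[OF RL, of _ v] that
      by (auto simp: w_def)
    then show ?thesis using cinner_commute[of l w] by simp
  qed
  have v: "v = hproj L v + w" by (simp add: w_def)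
  have "{x + c *\<^sub>C v | x c. x \<in> L} = {y. y - hproj L y = k y *\<^sub>C w}" (is "?A = ?B")
  proof
    show "?A \<subseteq> ?B"
    proof
      fix y assume "y \<in> ?A"
      then obtain x c where y: "y = x + c *\<^sub>C v" "x \<in> L" by auto
      have l: "x + c *\<^sub>C hproj L v \<in> L"
        using y(2) L(2) by (simp add: hproj_in RL complex_vs.subspace_add complex_vs.subspace_scale)
      have y': "y = (x + c *\<^sub>C hproj L v) + c *\<^sub>C w"
        using y(1) by (simp add: w_def complex_vs.scale_right_diff_distrib)
      have "hproj L y = x + c *\<^sub>C hproj L v"
        using y by (simp add: Q.add Q.scale hproj_ident RL)
      then have "y - hproj L y = c *\<^sub>C w" using y' by simp
      moreover have "cinner y w = c * complex_of_real ((norm w)\<^sup>2)"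
        unfolding y' by (simp add: cinner_add_left[of "x + c *\<^sub>C hproj L v"] orth[OF l]
            cinner_scaleC_left cinner_self)
      then have "k y *\<^sub>C w = c *\<^sub>C w"
        by (cases "w = 0") (simp_all add: k_def)
      ultimately show "y \<in> ?B" by (simp only: mem_Collect_eq)
    qed
    show "?B \<subseteq> ?A"
    proof
      fix y assume "y \<in> ?B"
      then have "y = (hproj L y - k y *\<^sub>C hproj L v) + k y *\<^sub>C v"
        by (simp add: w_def complex_vs.scale_right_diff_distrib algebra_simps)
      moreover have "hproj L y - k y *\<^sub>C hproj L v \<in> L"
        using L(2) by (simp add: hproj_in RL complex_vs.subspace_diff complex_vs.subspace_scale)
      ultimately show "y \<in> ?A" by blast
    qed
  qed
  moreover have "closed ?B"
    unfolding k_def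
    by (intro closed_Collect_eq continuous_on_diff continuous_on_id continuous_on_cinner_scaleC
        linear_continuous_on bounded_linear_hproj RL)
  ultimately show ?thesis by simp
qed

lemma closed_csubspace_plus_span:
  fixes L :: "'a::complex_hilbert_space set"
  assumes "finite F" and L: "closed L" "csubspace L"
  shows "closed {x + y | x y. x \<in> L \<and> y \<in> cspan F}"
  using assms(1)
proof (induction F)
  case empty
  then show ?case using L by simp
next
  case (insert v F)
  let ?S = "{x + y | x y. x \<in> L \<and> y \<in> cspan F}"
  have "csubspace ?S"
    using L(2) by (intro complex_vs.subspace_sums complex_vs.subspace_span)
  from closed_csubspace_plus_line[OF insert.IH this, of v]
  have "closed {x + c *\<^sub>C v | x c. x \<in> ?S}" .
  moreover have "{x + c *\<^sub>C v | x c. x \<in> ?S} = {x + y | x y. x \<in> L \<and> y \<in> cspan (insert v F)}"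
    (is "?A = ?B")
  proof
    show "?A \<subseteq> ?B"
    proof
      fix z assume "z \<in> ?A"
      then obtain x y c where z: "z = x + y + c *\<^sub>C v" "x \<in> L" "y \<in> cspan F" by blast
      then have "y + c *\<^sub>C v \<in> cspan (insert v F)"
        unfolding complex_vs.span_insert by (auto intro!: exI[of _ c])
      moreover have "z = x + (y + c *\<^sub>C v)" using z by (simp add: add.assoc)
      ultimately show "z \<in> ?B" using z(2) by blast
    qed
    show "?B \<subseteq> ?A"
    proof
      fix z assume "z \<in> ?B"
      then obtain x y where z: "z = x + y" "x \<in> L" "y \<in> cspan (insert v F)" by blast
      then obtain c where c: "y - c *\<^sub>C v \<in> cspan F"
        unfolding complex_vs.span_insert by blast
      have "z = (x + (y - c *\<^sub>C v)) + c *\<^sub>C v" using z by simp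
      moreover have "x + (y - c *\<^sub>C v) \<in> ?S" using z(2) c by blast
      ultimately show "z \<in> ?A" by blast
    qed
  qed
  ultimately show ?case by simp
qed

lemma closed_if_finite_quotient:
  assumes L: "closed L" "csubspace L" and W: "csubspace W" "L \<subseteq> W" and n: "has_quotient_dim W L n"
  shows "closed W"
proof -
  obtain B where B: "finite B" "quotient_basis W L B"
    using n by (auto simp: has_quotient_dim_def)
  have BW: "cspan B \<subseteq> W"
    using B(2) complex_vs.span_minimal[OF _ W(1)] by (auto simp: quotient_basis_def)
  have "W = {x + y | x y. x \<in> L \<and> y \<in> cspan B}" (is "_ = ?S")
  proof
    show "W \<subseteq> ?S"
    proof
      fix x assume "x \<in> W"
      then obtain b where "b \<in> cspan B" "x - b \<in> L" using B(2) by (auto simp: quotient_basis_def)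
      moreover have "x = (x - b) + b" by simp
      ultimately show "x \<in> ?S" by blast
    qed
    show "?S \<subseteq> W" using BW W complex_vs.subspace_add[OF W(1)] by blast
  qed
  then show ?thesis using closed_csubspace_plus_span[OF B(1) L] by simp
qed

text \<open>
  Add to the operator the projections onto a finite-dimensional complement of its range in \<open>K\<close> and
  onto the orthogonal complement of \<open>K\<close>. The result is onto, so small vectors have small preimages;
  hence the component of a limit of range vectors along the complement of the range vanishes.
\<close>

lemma closed_range_if_finite_quotient:
  assumes f: "bounded_clinear f" and K: "closed K" "csubspace K" "range f \<subseteq> K"
    and n: "has_quotient_dim K (range f) n"
  shows "closed (range f)"
proof -
  note RK = K(1) csubspace_subspace[OF K(2)]
  interpret f: bounded_linear f using f by (rule bounded_clinear_bounded_linear)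
  obtain B where B: "finite B" "quotient_basis K (range f) B"
    using n by (auto simp: has_quotient_dim_def)
  define G where "G = cspan B"
  have GK: "G \<subseteq> K"
    using B(2) complex_vs.span_minimal[OF _ K(2)] by (auto simp: quotient_basis_def G_def)
  have Gf: "G \<inter> range f = {0}" using B(2) by (simp add: quotient_basis_def G_def)
  have cG: "csubspace G" unfolding G_def by (rule complex_vs.subspace_span)
  have "closed G"
    using closed_csubspace_plus_span[OF B(1), of "{0}"]
    by (simp add: G_def complex_vs.subspace_single_0)
  note RG = this csubspace_subspace[OF cG]
  interpret PG: bounded_linear "hproj G" by (rule bounded_linear_hproj[OF RG])
  interpret PK: bounded_linear "hproj K" by (rule bounded_linear_hproj[OF RK])
  \<comment> \<open>The argument has the shape \<open>((x, b), y)\<close>: \<open>x\<close> is sent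
    through the operator, \<open>b\<close> onto the complement \<open>G\<close> of the range,
    \<open>y\<close> onto the orthogonal complement of \<open>K\<close>.\<close>
  define g where "g u = f (fst (fst u)) + hproj G (snd (fst u)) + (snd u - hproj K (snd u))" for u
  have g: "bounded_linear g"
    unfolding g_def
    by (intro bounded_linear_add bounded_linear_sub bounded_linear_compose[OF f.bounded_linear]
        bounded_linear_compose[OF PG.bounded_linear] bounded_linear_compose[OF PK.bounded_linear]
        bounded_linear_compose[OF bounded_linear_fst bounded_linear_fst]
        bounded_linear_compose[OF bounded_linear_snd bounded_linear_fst] bounded_linear_snd)
  have "surj g"
  proof (rule surjI[where f = "\<lambda>y. SOME u. g u = y"], rule someI_ex)
    fix y
    have "hproj K y \<in> K" by (rule hproj_in[OF RK])
    then obtain b where b: "b \<in> G" "hproj K y - b \<in> range f"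
      using B(2) by (auto simp: quotient_basis_def G_def)
    then obtain x where x: "hproj K y - b = f x" by blast
    have "g ((x, b), y) = y"
      by (simp add: g_def hproj_ident[OF RG b(1)] x[symmetric])
    then show "\<exists>u. g u = y" by blast
  qed
  then obtain C where C: "\<And>y. \<exists>u. g u = y \<and> norm u \<le> C * norm y"
    using surjective_bounded_preimage[OF g] by blast
  have "y \<in> range f" if y: "y \<in> closure (range f)" for y
  proof -
    have "y \<in> K" using y K closure_minimal[OF K(3,1)] by auto
    then obtain q where q: "q \<in> G" "y - q \<in> range f"
      using B(2) by (auto simp: quotient_basis_def G_def)
    then obtain x0 where x0: "y - q = f x0" by blast
    have small: "norm q \<le> \<bar>C\<bar> * e" if e: "e > 0" for e
    proof -
      obtain x where x: "dist (f x) y < e"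
        using y e by (auto simp: closure_approachable)
      define r where "r = y - f x"
      obtain u where u: "g u = r" "norm u \<le> C * norm r" using C by blast
      define a z w where "a = fst (fst u)" and "z = snd (fst u)" and "w = snd u - hproj K (snd u)"
      have r: "f a + hproj G z + w = r" using u(1) by (simp add: g_def a_def z_def w_def)
      have fK: "f v \<in> K" for v using K(3) by blast
      have zG: "hproj G z \<in> G" by (rule hproj_in[OF RG])
      have "r \<in> K" using \<open>y \<in> K\<close> fK complex_vs.subspace_diff[OF K(2)] by (simp add: r_def)
      moreover have "w = r - (f a + hproj G z)" using r by (simp add: algebra_simps)
      ultimately have "w \<in> K"
        using fK zG GK complex_vs.subspace_diff[OF K(2)] complex_vs.subspace_add[OF K(2)] by auto
      then have "inner w w = 0" unfolding w_def by (rule hproj_orthogonal[OF RK])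
      \<comment> \<open>Both \<open>q\<close> and \<open>hproj G z\<close> are representatives in
        \<open>G\<close> of one coset of \<open>range f\<close>, hence equal; this bounds the fixed
        vector \<open>q\<close> by the arbitrarily small \<open>r\<close>.\<close>
      then have "q - hproj G z = f (a + (x - x0))"
        using r x0 by (simp add: r_def f.add f.diff algebra_simps)
      moreover have "q - hproj G z \<in> G" using q(1) zG complex_vs.subspace_diff[OF cG] by blast
      ultimately have "q - hproj G z \<in> G \<inter> range f" by simp
      then have "q = hproj G z" using Gf by simp
      then have "norm q \<le> norm z" using hproj_norm_le[OF RG, of z] by simp
      also have "\<dots> \<le> norm (fst u)" unfolding z_def by (metis norm_snd_le prod.collapse)
      also have "\<dots> \<le> norm u" by (metis norm_fst_le prod.collapse)
      also have "\<dots> \<le> C * norm r" by (rule u)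
      also have "\<dots> \<le> \<bar>C\<bar> * e"
        using x by (intro mult_mono) (auto simp: r_def dist_norm norm_minus_commute)
      finally show ?thesis .
    qed
    have "norm q \<le> e" if "e > 0" for e
    proof -
      have "norm q \<le> \<bar>C\<bar> * (e / (\<bar>C\<bar> + 1))" using that by (intro small) simp
      also have "\<dots> = (\<bar>C\<bar> / (\<bar>C\<bar> + 1)) * e" by simp
      also have "\<dots> \<le> 1 * e" using that by (intro mult_right_mono) auto
      finally show ?thesis by simp
    qed
    then have "norm q \<le> 0" by (meson dense_ge)
    then show ?thesis using q by simp
  qed
  then have "closure (range f) \<subseteq> range f" by blast
  then show ?thesis by (simp add: closure_subset_eq)
qed

section \<open>Positive operators and their square roots\<close>

text \<open>Complex polarization: a real quadratic form means that
  \<open>inner (A x) (\<i> *\<^sub>C x)\<close> vanishes, and expanding this at \<open>x + y\<close>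
  with \<open>y = - \<i> *\<^sub>C z\<close> yields symmetry. Conversely symmetry makes that number
  equal to its own negative. Positive operators can then be treated with the real inner product
  alone.\<close>

lemma positive_operator_iff:
  "positive_operator A \<longleftrightarrow>
    bounded_clinear A \<and> (\<forall>x y. inner (A x) y = inner x (A y)) \<and> (\<forall>x. 0 \<le> inner (A x) x)"
proof
  assume A: "positive_operator A"
  then have lin: "A (x + y) = A x + A y" "A (c *\<^sub>C x) = c *\<^sub>C A x" for x y c
    using bounded_clinear_clinear[of A] by (auto simp: positive_operator_def clinear_iff)
  have real: "inner (A x) (\<i> *\<^sub>C x) = 0" for x
    using A by (auto simp: positive_operator_def cinner_eq_inner complex_is_Real_iff)
  have "inner (A x) z = inner x (A z)" for x z
  proof -
    define y where "y = - \<i> *\<^sub>C z"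
    have z: "z = \<i> *\<^sub>C y" by (simp add: y_def scaleC_scaleC)
    have "inner (A x) z + inner (A y) (\<i> *\<^sub>C x) = 0"
      using real[of "x + y"] real[of x] real[of y]
      by (simp add: z lin scaleC_add_right inner_add_left inner_add_right)
    moreover have "inner (A y) (\<i> *\<^sub>C x) = - inner x (A z)"
    proof -
      have "inner (A y) (\<i> *\<^sub>C x) = inner (- \<i> *\<^sub>C A y) x"
        using inner_scaleC_left[of "- \<i>" "A y" x] by simp
      also have "\<dots> = - inner (A z) x" by (simp add: z lin)
      finally show ?thesis by (simp add: inner_commute)
    qed
    ultimately show ?thesis by simp
  qed
  then show "bounded_clinear A \<and> (\<forall>x y. inner (A x) y = inner x (A y)) \<and> (\<forall>x. 0 \<le> inner (A x) x)"
    using A by (auto simp: positive_operator_def inner_eq_Re_cinner)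
next
  assume A: "bounded_clinear A \<and> (\<forall>x y. inner (A x) y = inner x (A y)) \<and> (\<forall>x. 0 \<le> inner (A x) x)"
  have "inner (A x) (\<i> *\<^sub>C x) = 0" for x
  proof -
    have "inner (A x) (\<i> *\<^sub>C x) = inner x (\<i> *\<^sub>C A x)"
      using A by (auto simp: bounded_clinear_def)
    also have "\<dots> = - inner (A x) (\<i> *\<^sub>C x)"
      using inner_scaleC_left[of "- \<i>" x "A x"] by (simp add: inner_commute)
    finally show ?thesis by simp
  qed
  then have "cinner (A x) x \<in> \<real>" for x
    by (simp add: cinner_eq_inner complex_is_Real_iff)
  with A show "positive_operator A"
    unfolding positive_operator_def inner_eq_Re_cinner[symmetric] by blast
qed

lemma positive_operator_bounded_clinear: "positive_operator A \<Longrightarrow> bounded_clinear A"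
  and positive_operator_symmetric: "positive_operator A \<Longrightarrow> inner (A x) y = inner x (A y)"
  and positive_operator_nonneg: "positive_operator A \<Longrightarrow> 0 \<le> inner (A x) x"
  unfolding positive_operator_iff by blast+

text \<open>Provides the contraction \<open>B = 1 - A\<close> for the iteration. Positivity tested
  at \<open>x - A x\<close>, with \<open>norm (A (A x)) \<le> norm (A x)\<close>, gives
  \<open>(norm (A x))\<^sup>2 \<le> inner (A x) x\<close>; now expand
  \<open>(norm (x - A x))\<^sup>2\<close>.\<close>

lemma positive_contraction_complement:
  assumes A: "positive_operator A" and le: "\<And>x. norm (A x) \<le> norm x"
  shows "norm (x - A x) \<le> norm x"
proof -
  interpret A: bounded_linear A
    using A by (intro bounded_clinear_bounded_linear positive_operator_bounded_clinear)
  have "0 \<le> inner (A (x - A x)) (x - A x)" by (rule positive_operator_nonneg[OF A])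
  also have "\<dots> = inner (A x) x - 2 * (norm (A x))\<^sup>2 + inner (A (A x)) (A x)"
    using positive_operator_symmetric[OF A, of "A x" x]
    by (simp add: A.diff inner_diff_left inner_diff_right power2_norm_eq_inner)
  also have "inner (A (A x)) (A x) \<le> norm (A (A x)) * norm (A x)" by (rule norm_cauchy_schwarz)
  also have "\<dots> \<le> (norm (A x))\<^sup>2"
    using le[of "A x"] by (simp add: power2_eq_square mult_right_mono)
  finally have "(norm (A x))\<^sup>2 \<le> inner (A x) x" by simp
  then have "(norm (x - A x))\<^sup>2 \<le> (norm x)\<^sup>2"
    using positive_operator_nonneg[OF A, of x]
    by (simp add: power2_norm_eq_inner inner_diff_left inner_diff_right inner_commute)
  then show ?thesis by (rule power2_le_imp_le) simp
qed

text \<open>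
  For a contraction \<open>B\<close> the iteration converges to a solution \<open>Y\<close> of \<open>Y = (B + Y\<^sup>2) / 2\<close>, that is
  of \<open>(1 - Y)\<^sup>2 = 1 - B\<close>; its increments are dominated by those of the scalar iteration with \<open>B = 1\<close>.
\<close>

primrec sqrt_iter :: "('a::complex_hilbert_space \<Rightarrow> 'a) \<Rightarrow> nat \<Rightarrow> 'a \<Rightarrow> 'a" where
  "sqrt_iter B 0 = (\<lambda>x. 0)"
| "sqrt_iter B (Suc n) = (\<lambda>x. (1/2) *\<^sub>R (B x + sqrt_iter B n (sqrt_iter B n x)))"

primrec sqrt_majorant :: "nat \<Rightarrow> real" where
  "sqrt_majorant 0 = 0"
| "sqrt_majorant (Suc n) = (1 + (sqrt_majorant n)\<^sup>2) / 2"

lemma sqrt_majorant_bounds: "0 \<le> sqrt_majorant n" "sqrt_majorant n \<le> 1"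
proof -
  have "0 \<le> sqrt_majorant n \<and> sqrt_majorant n \<le> 1"
    by (induction n) (auto simp: power_le_one)
  then show "0 \<le> sqrt_majorant n" "sqrt_majorant n \<le> 1" by auto
qed

lemma sqrt_majorant_mono: "sqrt_majorant n \<le> sqrt_majorant (Suc n)"
proof -
  have "0 \<le> (1 - sqrt_majorant n)\<^sup>2" by simp
  then show ?thesis by (simp add: power2_eq_square algebra_simps)
qed

lemma Cauchy_sqrt_majorant: "Cauchy sqrt_majorant"
proof -
  have "incseq sqrt_majorant" by (rule incseq_SucI) (rule sqrt_majorant_mono)
  then obtain L where "sqrt_majorant \<longlonglongrightarrow> L"
    using incseq_convergent[of sqrt_majorant 1] sqrt_majorant_bounds(2) by blast
  then show ?thesis by (intro convergent_Cauchy) (auto simp: convergent_def)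
qed

context
  fixes B :: "'a::complex_hilbert_space \<Rightarrow> 'a"
  assumes B: "bounded_clinear B" and B_le: "\<And>x. norm (B x) \<le> norm x"
begin

lemma sqrt_iter_bounded_clinear: "bounded_clinear (sqrt_iter B n)"
proof (induction n)
  case 0
  then show ?case by (simp add: bounded_clinear_def bounded_linear_zero)
next
  case (Suc n)
  show ?case
    using bounded_clinear_scaleR[OF bounded_clinear_add[OF B bounded_clinear_compose[OF Suc Suc]], of "1/2"]
    by simp
qed

text \<open>The iterates are polynomials in \<open>B\<close>. Passing to the limit, the square root
  inherits this commutation, on which its uniqueness depends.\<close>

lemma sqrt_iter_commute:
  assumes C: "bounded_clinear C" "\<And>x. C (B x) = B (C x)"
  shows "C (sqrt_iter B n x) = sqrt_iter B n (C x)"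
proof -
  interpret C: bounded_linear C using C(1) by (rule bounded_clinear_bounded_linear)
  show ?thesis by (induction n arbitrary: x) (simp_all add: C.zero C.add C.scaleR C(2))
qed

lemma sqrt_iter_commute_iter:
  "sqrt_iter B m (sqrt_iter B n x) = sqrt_iter B n (sqrt_iter B m x)"
proof (rule sqrt_iter_commute[OF sqrt_iter_bounded_clinear])
  show "sqrt_iter B m (B x) = B (sqrt_iter B m x)" for x
    using sqrt_iter_commute[OF B refl] by simp
qed

lemma sqrt_iter_norm_le: "norm (sqrt_iter B n x) \<le> sqrt_majorant n * norm x"
proof (induction n arbitrary: x)
  case (Suc n)
  have "norm (sqrt_iter B n (sqrt_iter B n x)) \<le> sqrt_majorant n * norm (sqrt_iter B n x)"
    by (rule Suc)
  also have "\<dots> \<le> sqrt_majorant n * (sqrt_majorant n * norm x)"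
    by (intro mult_left_mono Suc sqrt_majorant_bounds)
  finally have "norm (B x) + norm (sqrt_iter B n (sqrt_iter B n x)) \<le> (1 + (sqrt_majorant n)\<^sup>2) * norm x"
    using B_le[of x] by (simp add: power2_eq_square algebra_simps)
  then have "norm (B x + sqrt_iter B n (sqrt_iter B n x)) \<le> (1 + (sqrt_majorant n)\<^sup>2) * norm x"
    using norm_triangle_ineq order_trans by blast
  then show ?case by simp
qed simp

text \<open>Iterates commute, so the difference of their squares factors as
  \<open>(?Y + ?Z) (?Y - ?Z)\<close>. Its bound \<open>(?a + ?b) * (?a - ?b)\<close>, halved, is
  exactly the next increment of the majorant.\<close>

lemma sqrt_iter_Suc_diff_le:
  "norm (sqrt_iter B (Suc n) x - sqrt_iter B n x)
    \<le> (sqrt_majorant (Suc n) - sqrt_majorant n) * norm x"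
proof (induction n arbitrary: x)
  case 0
  then show ?case using B_le[of x] by simp
next
  case (Suc n)
  let ?Y = "sqrt_iter B (Suc n)" and ?Z = "sqrt_iter B n"
  let ?a = "sqrt_majorant (Suc n)" and ?b = "sqrt_majorant n"
  interpret Y: bounded_linear ?Y by (intro bounded_clinear_bounded_linear sqrt_iter_bounded_clinear)
  interpret Z: bounded_linear ?Z by (intro bounded_clinear_bounded_linear sqrt_iter_bounded_clinear)
  define v where "v = ?Y x - ?Z x"
  have v: "norm v \<le> (?a - ?b) * norm x" unfolding v_def by (rule Suc)
  have "sqrt_iter B (Suc (Suc n)) x - ?Y x = (1/2) *\<^sub>R (?Y (?Y x) - ?Z (?Z x))"
    by (simp only: sqrt_iter.simps(2)[of B "Suc n"] sqrt_iter.simps(2)[of B n, THEN fun_cong, of x]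
        scaleR_diff_right[symmetric] add_diff_cancel_left)
  also have "?Y (?Y x) - ?Z (?Z x) = ?Y v + ?Z v"
    using sqrt_iter_commute_iter[of "Suc n" n x] by (simp add: v_def Y.diff Z.diff del: sqrt_iter.simps)
  finally have "norm (sqrt_iter B (Suc (Suc n)) x - ?Y x) = (1/2) * norm (?Y v + ?Z v)" by simp
  also have "norm (?Y v + ?Z v) \<le> norm (?Y v) + norm (?Z v)" by (rule norm_triangle_ineq)
  also have "\<dots> \<le> ?a * norm v + ?b * norm v"
    by (intro add_mono sqrt_iter_norm_le)
  also have "\<dots> = (?a + ?b) * norm v" by (simp only: distrib_right)
  also have "\<dots> \<le> (?a + ?b) * ((?a - ?b) * norm x)"
    by (intro mult_left_mono v add_nonneg_nonneg sqrt_majorant_bounds)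
  also have "(1/2) * \<dots> = (sqrt_majorant (Suc (Suc n)) - ?a) * norm x"
    unfolding sqrt_majorant.simps(2)[of "Suc n"]
    by (subst (4) sqrt_majorant.simps(2)) (simp add: power2_eq_square algebra_simps del: sqrt_majorant.simps(2))
  finally show ?case by simp
qed

lemma sqrt_iter_diff_le:
  assumes "n \<le> m"
  shows "norm (sqrt_iter B m x - sqrt_iter B n x) \<le> (sqrt_majorant m - sqrt_majorant n) * norm x"
  using assms
proof (induction m rule: dec_induct)
  case (step m)
  have "norm (sqrt_iter B (Suc m) x - sqrt_iter B n x)
      \<le> norm (sqrt_iter B (Suc m) x - sqrt_iter B m x) + norm (sqrt_iter B m x - sqrt_iter B n x)"
    by (rule norm_diff_triangle_le[OF order_refl order_refl])
  also have "\<dots> \<le> (sqrt_majorant (Suc m) - sqrt_majorant m) * norm x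
      + (sqrt_majorant m - sqrt_majorant n) * norm x"
    by (intro add_mono sqrt_iter_Suc_diff_le step.IH)
  also have "\<dots> = (sqrt_majorant (Suc m) - sqrt_majorant n) * norm x"
    by (simp only: distrib_right[symmetric]) simp
  finally show ?case .
qed simp

lemma Cauchy_sqrt_iter: "Cauchy (\<lambda>n. sqrt_iter B n x)"
proof (rule metric_CauchyI)
  fix e :: real assume e: "0 < e"
  then obtain N where N: "\<And>m n. m \<ge> N \<Longrightarrow> n \<ge> N \<Longrightarrow> dist (sqrt_majorant m) (sqrt_majorant n) < e / (norm x + 1)"
    using metric_CauchyD[OF Cauchy_sqrt_majorant, of "e / (norm x + 1)"]
    by (metis add_nonneg_pos divide_pos_pos norm_ge_zero zero_less_one)
  have "dist (sqrt_iter B m x) (sqrt_iter B n x) < e" if mn: "m \<ge> N" "n \<ge> N" for m n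
  proof -
    have "norm (sqrt_iter B m x - sqrt_iter B n x) \<le> \<bar>sqrt_majorant m - sqrt_majorant n\<bar> * norm x"
    proof (cases "n \<le> m")
      case True
      from sqrt_iter_diff_le[OF this, of x] show ?thesis
        by (rule order_trans) (intro mult_right_mono, auto)
    next
      case False
      then have "m \<le> n" by simp
      from sqrt_iter_diff_le[OF this, of x] show ?thesis
        by (subst norm_minus_commute, elim order_trans) (intro mult_right_mono, auto)
    qed
    also have "\<dots> \<le> (e / (norm x + 1)) * norm x"
      using N[OF mn] by (intro mult_right_mono) (auto simp: dist_real_def)
    also have "\<dots> < e"
    proof -
      have "0 < norm x + 1" by (simp add: add_nonneg_pos)
      then show ?thesis using e by (simp add: divide_less_eq)
    qed
    finally show ?thesis by (simp add: dist_norm)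
  qed
  then show "\<exists>M. \<forall>m\<ge>M. \<forall>n\<ge>M. dist (sqrt_iter B m x) (sqrt_iter B n x) < e" by blast
qed

lemma sqrt_iter_limit:
  obtains Y where "bounded_clinear Y" "\<And>x. norm (Y x) \<le> norm x" "\<And>x. Y x = (1/2) *\<^sub>R (B x + Y (Y x))"
    "\<And>C x. bounded_clinear C \<Longrightarrow> (\<And>x. C (B x) = B (C x)) \<Longrightarrow> C (Y x) = Y (C x)"
    "(\<forall>x y. inner (B x) y = inner x (B y)) \<longrightarrow> (\<forall>x y. inner (Y x) y = inner x (Y y))"
proof -
  define Y where "Y x = lim (\<lambda>n. sqrt_iter B n x)" for x
  have Y: "(\<lambda>n. sqrt_iter B n x) \<longlonglongrightarrow> Y x" for x
    unfolding Y_def using Cauchy_sqrt_iter Cauchy_convergent convergent_LIMSEQ_iff by blast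
  have lin: "sqrt_iter B n (x + y) = sqrt_iter B n x + sqrt_iter B n y"
    "sqrt_iter B n (c *\<^sub>C x) = c *\<^sub>C sqrt_iter B n x"
    "sqrt_iter B n (x - y) = sqrt_iter B n x - sqrt_iter B n y" for n x y c
    using sqrt_iter_bounded_clinear[of n]
    by (auto simp: bounded_clinear_def linear_simps)
  have contraction: "norm (sqrt_iter B n x) \<le> norm x" for n x
    using sqrt_iter_norm_le[of n x] sqrt_majorant_bounds[of n]
      mult_right_mono[of "sqrt_majorant n" 1 "norm x"] by simp
  have Y_le: "norm (Y x) \<le> norm x * 1" for x
    using LIMSEQ_le_const2[OF tendsto_norm[OF Y[of x]]] contraction by auto
  have "Y (x + y) = Y x + Y y" for x y
    using tendsto_add[OF Y[of x] Y[of y]] Y[of "x + y"] by (simp add: lin LIMSEQ_unique)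
  moreover have "Y (c *\<^sub>C x) = c *\<^sub>C Y x" for c x
    using bounded_linear.tendsto[OF bounded_clinear_bounded_linear[OF bounded_clinear_scaleC] Y[of x], of c]
      Y[of "c *\<^sub>C x"] by (simp add: lin LIMSEQ_unique)
  ultimately have Yl: "bounded_clinear Y"
    by (intro bounded_clinear_intro[OF _ Y_le]) (simp add: clinear_iff)
  \<comment> \<open>Both factors vary with \<open>n\<close>. As all iterates are contractions,
    replacing the inner one by its limit costs at most
    \<open>norm (sqrt_iter B n x - Y x)\<close>.\<close>
  have YY: "(\<lambda>n. sqrt_iter B n (sqrt_iter B n x)) \<longlonglongrightarrow> Y (Y x)" for x
  proof -
    have "(\<lambda>n. sqrt_iter B n (sqrt_iter B n x - Y x)) \<longlonglongrightarrow> 0"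
    proof (rule Lim_null_comparison)
      show "\<forall>\<^sub>F n in sequentially. norm (sqrt_iter B n (sqrt_iter B n x - Y x)) \<le> norm (sqrt_iter B n x - Y x)"
        using contraction by simp
      show "(\<lambda>n. norm (sqrt_iter B n x - Y x)) \<longlonglongrightarrow> 0"
        using Y[of x] LIM_zero tendsto_norm_zero by blast
    qed
    from tendsto_add[OF this Y[of "Y x"]] show ?thesis by (simp add: lin)
  qed
  have "Y x = (1/2) *\<^sub>R (B x + Y (Y x))" for x
  proof -
    have "(\<lambda>n. sqrt_iter B (Suc n) x) \<longlonglongrightarrow> (1/2) *\<^sub>R (B x + Y (Y x))"
      unfolding sqrt_iter.simps(2) by (intro tendsto_intros YY)
    moreover have "(\<lambda>n. sqrt_iter B (Suc n) x) \<longlonglongrightarrow> Y x"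
      using Y by (rule LIMSEQ_Suc)
    ultimately show ?thesis by (rule LIMSEQ_unique[symmetric])
  qed
  moreover have "C (Y x) = Y (C x)" if C: "bounded_clinear C" "\<And>x. C (B x) = B (C x)" for C x
  proof -
    have "(\<lambda>n. C (sqrt_iter B n x)) \<longlonglongrightarrow> C (Y x)"
      by (rule bounded_linear.tendsto[OF bounded_clinear_bounded_linear[OF C(1)] Y])
    then show ?thesis using Y[of "C x"] by (simp add: sqrt_iter_commute[OF C] LIMSEQ_unique)
  qed
  moreover have "inner (Y x) y = inner x (Y y)" if sym: "\<And>x y. inner (B x) y = inner x (B y)" for x y
  proof -
    have "inner (sqrt_iter B n x) y = inner x (sqrt_iter B n y)" for n x y
      by (induction n arbitrary: x y) (simp_all add: inner_add_left inner_add_right sym)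
    then show ?thesis
      using tendsto_inner[OF Y[of x] tendsto_const[of y]] tendsto_inner[OF tendsto_const[of x] Y[of y]]
      by (simp add: LIMSEQ_unique)
  qed
  ultimately show thesis using Yl Y_le by (intro that[of Y]) auto
qed

end

text \<open>The root is \<open>S = 1 - Y\<close> for the limit \<open>Y\<close> belonging to
  \<open>B = 1 - A\<close>; it is positive because \<open>Y\<close> is a symmetric
  contraction.\<close>

lemma positive_contraction_sqrt_exists:
  assumes A: "positive_operator A" and le: "\<And>x. norm (A x) \<le> norm x"
  obtains S where "positive_operator S" "\<And>x. S (S x) = A x"
    "\<And>C x. bounded_clinear C \<Longrightarrow> (\<And>x. C (A x) = A (C x)) \<Longrightarrow> C (S x) = S (C x)"
proof -
  define B where "B x = x - A x" for x
  have B: "bounded_clinear B"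
    unfolding B_def by (intro bounded_clinear_diff bounded_clinear_ident positive_operator_bounded_clinear A)
  have B_le: "norm (B x) \<le> norm x" for x
    unfolding B_def by (rule positive_contraction_complement[OF A le])
  obtain Y where Y: "bounded_clinear Y" and Y_le: "\<And>x. norm (Y x) \<le> norm x"
    and fix_Y: "\<And>x. Y x = (1/2) *\<^sub>R (B x + Y (Y x))"
    and com: "\<And>C x. bounded_clinear C \<Longrightarrow> (\<And>x. C (B x) = B (C x)) \<Longrightarrow> C (Y x) = Y (C x)"
    and sym: "(\<forall>x y. inner (B x) y = inner x (B y)) \<longrightarrow> (\<forall>x y. inner (Y x) y = inner x (Y y))"
    using sqrt_iter_limit[OF B B_le] by blast
  interpret Y: bounded_linear Y using Y by (rule bounded_clinear_bounded_linear)
  have symB: "inner (B x) y = inner x (B y)" for x y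
    by (simp add: B_def inner_diff_left inner_diff_right positive_operator_symmetric[OF A])
  define S where "S x = x - Y x" for x
  have "bounded_clinear S"
    unfolding S_def by (intro bounded_clinear_diff bounded_clinear_ident Y)
  moreover have "inner (S x) y = inner x (S y)" for x y
    by (simp add: S_def inner_diff_left inner_diff_right sym[rule_format, OF symB])
  moreover have "0 \<le> inner (S x) x" for x
  proof -
    have "inner (Y x) x \<le> norm (Y x) * norm x" by (rule norm_cauchy_schwarz)
    also have "\<dots> \<le> norm x * norm x" by (intro mult_right_mono Y_le) simp
    also have "\<dots> = inner x x" by (simp add: power2_norm_eq_inner[symmetric] power2_eq_square)
    finally show ?thesis by (simp add: S_def inner_diff_left)
  qed
  ultimately have "positive_operator S" by (simp add: positive_operator_iff)
  moreover have "S (S x) = A x" for x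
  proof -
    have "2 *\<^sub>R Y x = B x + Y (Y x)" by (subst fix_Y) simp
    then have "Y x + Y x = B x + Y (Y x)" by (simp add: scaleR_2)
    then show ?thesis by (simp add: S_def B_def Y.diff algebra_simps)
  qed
  moreover have "C (S x) = S (C x)" if C: "bounded_clinear C" "\<And>x. C (A x) = A (C x)" for C x
  proof -
    interpret C: bounded_linear C using C(1) by (rule bounded_clinear_bounded_linear)
    have "C (Y x) = Y (C x)"
      using C by (intro com) (simp_all add: B_def C.diff)
    then show ?thesis by (simp add: S_def C.diff)
  qed
  ultimately show thesis by (rule that)
qed

lemma positive_operator_scaleR:
  assumes "positive_operator A" "0 \<le> r"
  shows "positive_operator (\<lambda>x. r *\<^sub>R A x)"
  unfolding positive_operator_iff
proof (intro conjI allI)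
  show "bounded_clinear (\<lambda>x. r *\<^sub>R A x)"
    by (intro bounded_clinear_scaleR positive_operator_bounded_clinear assms)
  show "inner (r *\<^sub>R A x) y = inner x (r *\<^sub>R A y)" for x y
    by (simp add: positive_operator_symmetric[OF assms(1)])
  show "0 \<le> inner (r *\<^sub>R A x) x" for x
    using positive_operator_nonneg[OF assms(1), of x] assms(2) by simp
qed

lemma positive_operator_sqrt_exists:
  assumes A: "positive_operator A"
  obtains S where "positive_operator S" "\<And>x. S (S x) = A x"
    "\<forall>C. bounded_clinear C \<longrightarrow> (\<forall>x. C (A x) = A (C x)) \<longrightarrow> (\<forall>x. C (S x) = S (C x))"
proof -
  interpret A: bounded_linear A
    by (intro bounded_clinear_bounded_linear positive_operator_bounded_clinear A)
  obtain K where K: "K > 0" "\<And>x. norm (A x) \<le> norm x * K"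
    using A.pos_bounded by blast
  \<comment> \<open>Dividing by the bound \<open>K\<close> makes the operator a contraction; the
    factor \<open>sqrt K\<close> undoes this for the root.\<close>
  define A' where "A' x = (1 / K) *\<^sub>R A x" for x
  have A': "positive_operator A'"
    unfolding A'_def using K by (intro positive_operator_scaleR A) simp
  have le: "norm (A' x) \<le> norm x" for x
    using K(1) K(2)[of x] by (simp add: A'_def field_simps)
  obtain S where S: "positive_operator S" "\<And>x. S (S x) = A' x"
    and com: "\<And>C x. bounded_clinear C \<Longrightarrow> (\<And>x. C (A' x) = A' (C x)) \<Longrightarrow> C (S x) = S (C x)"
    using positive_contraction_sqrt_exists[OF A' le] by blast
  interpret S: bounded_linear S
    by (intro bounded_clinear_bounded_linear positive_operator_bounded_clinear S)
  show thesis
  proof (rule that)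
    show "positive_operator (\<lambda>x. sqrt K *\<^sub>R S x)"
      using K S by (intro positive_operator_scaleR) auto
    show "sqrt K *\<^sub>R S (sqrt K *\<^sub>R S x) = A x" for x
      using K(1) by (simp add: S.scaleR S(2) A'_def)
    have "C (sqrt K *\<^sub>R S x) = sqrt K *\<^sub>R S (C x)"
      if C: "bounded_clinear C" "\<forall>x. C (A x) = A (C x)" for C x
    proof -
      interpret C: bounded_linear C using C(1) by (rule bounded_clinear_bounded_linear)
      have "C (S x) = S (C x)"
        by (rule com[OF C(1)]) (simp add: A'_def C.scaleR C(2))
      then show ?thesis by (simp add: C.scaleR)
    qed
    then show "\<forall>C. bounded_clinear C \<longrightarrow> (\<forall>x. C (A x) = A (C x))
        \<longrightarrow> (\<forall>x. C (sqrt K *\<^sub>R S x) = sqrt K *\<^sub>R S (C x))" by blast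
  qed
qed

lemma positive_operator_inner_eq_0:
  assumes A: "positive_operator A" and x: "inner (A x) x = 0"
  shows "A x = 0"
proof -
  obtain S where S: "positive_operator S" "\<And>x. S (S x) = A x"
    by (rule positive_operator_sqrt_exists[OF A], rule that)
  interpret S: bounded_linear S
    by (intro bounded_clinear_bounded_linear positive_operator_bounded_clinear S)
  have "inner (S x) (S x) = inner (A x) x"
    using positive_operator_symmetric[OF S(1), of "S x" x] by (simp add: S(2))
  with x have "S x = 0" by simp
  then show ?thesis using S(2)[of x] S.zero by simp
qed

text \<open>Any positive root \<open>R\<close> of \<open>A\<close> commutes with \<open>A\<close>,
  hence with the constructed root \<open>S\<close>. For \<open>y = S x - R x\<close> this gives
  \<open>S y + R y = 0\<close>; positivity forces \<open>S y = R y = 0\<close>, and then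
  \<open>inner y y = inner x (S y - R y) = 0\<close>.\<close>

lemma positive_operator_sqrt_unique:
  assumes P: "positive_operator P" and Q: "positive_operator Q" and eq: "\<And>x. P (P x) = Q (Q x)"
  shows "P = Q"
proof -
  define A where "A x = P (P x)" for x
  have A: "positive_operator A"
    unfolding positive_operator_iff A_def
  proof (intro conjI allI)
    show "bounded_clinear (\<lambda>x. P (P x))"
      using positive_operator_bounded_clinear[OF P] by (rule bounded_clinear_compose) (rule positive_operator_bounded_clinear[OF P])
    show sym: "inner (P (P x)) y = inner x (P (P y))" for x y
      by (simp add: positive_operator_symmetric[OF P])
    show "0 \<le> inner (P (P x)) x" for x
      by (subst positive_operator_symmetric[OF P]) simp
  qed
  obtain S where S: "positive_operator S" "\<And>x. S (S x) = A x"
    and com: "\<forall>C. bounded_clinear C \<longrightarrow> (\<forall>x. C (A x) = A (C x)) \<longrightarrow> (\<forall>x. C (S x) = S (C x))"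
    by (rule positive_operator_sqrt_exists[OF A]) (rule that)
  interpret S: bounded_linear S
    by (intro bounded_clinear_bounded_linear positive_operator_bounded_clinear S)
  have "R x = S x" if R: "positive_operator R" and RR: "\<And>x. R (R x) = A x" for R x
  proof -
    interpret R: bounded_linear R
      by (intro bounded_clinear_bounded_linear positive_operator_bounded_clinear R)
    have RS: "R (S x) = S (R x)" for x
      using com positive_operator_bounded_clinear[OF R] by (simp add: RR[symmetric])
    define y where "y = S x - R x"
    have Sy: "S y + R y = 0" by (simp add: y_def S.diff R.diff RS RR S)
    have "inner (S y) y + inner (R y) y = 0"
      using Sy by (simp add: inner_add_left[symmetric])
    then have "inner (S y) y = 0" "inner (R y) y = 0"
      using positive_operator_nonneg[OF S(1), of y] positive_operator_nonneg[OF R, of y] by simp_all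
    then have "S y = 0" "R y = 0"
      using positive_operator_inner_eq_0 S(1) R by blast+
    then have "inner y y = 0"
      using positive_operator_symmetric[OF S(1), of x y] positive_operator_symmetric[OF R, of x y]
      by (simp add: y_def inner_diff_left)
    then show ?thesis by (simp add: y_def)
  qed
  from this[OF P] this[OF Q] have "P x = Q x" for x
    using A_def eq by metis
  then show ?thesis by (rule ext)
qed

lemma operator_sqrt:
  assumes "positive_operator A"
  shows positive_operator_sqrt: "positive_operator (operator_sqrt A)"
    and operator_sqrt_sqrt: "operator_sqrt A (operator_sqrt A x) = A x"
proof -
  obtain S where S: "positive_operator S" "\<And>x. S (S x) = A x"
    by (rule positive_operator_sqrt_exists[OF assms], rule that)
  have "operator_sqrt A = S"
    unfolding operator_sqrt_def
  proof (rule the_equality)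
    show "positive_operator S \<and> S \<circ> S = A" using S by auto
    fix Q assume Q: "positive_operator Q \<and> Q \<circ> Q = A"
    then have "Q (Q x) = S (S x)" for x using S(2) by (auto simp: fun_eq_iff)
    with Q S(1) show "Q = S" by (intro positive_operator_sqrt_unique) auto
  qed
  with S show "positive_operator (operator_sqrt A)" "operator_sqrt A (operator_sqrt A x) = A x"
    by auto
qed

section \<open>Adjoints and the joint polar decomposition\<close>

text \<open>The adjoint for the real inner product is automatically complex linear, because the
  operator is, and it then satisfies the complex identity as well.\<close>

lemma cadjoint:
  assumes T: "bounded_clinear T"
  shows cinner_cadjoint: "cinner (T x) y = cinner x (cadjoint T y)"
    and bounded_clinear_cadjoint: "bounded_clinear (cadjoint T)"
proof -
  obtain S where S: "bounded_linear S" "\<And>x y. inner (T x) y = inner x (S y)"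
    using adjoint_exists[OF bounded_clinear_bounded_linear[OF T]] by blast
  have Tc: "T (c *\<^sub>C x) = c *\<^sub>C T x" for c x
    using T by (simp add: bounded_clinear_def)
  have Sc: "S (c *\<^sub>C y) = c *\<^sub>C S y" for c y
  proof -
    have "inner z (S (c *\<^sub>C y)) = inner z (c *\<^sub>C S y)" for z
      using inner_scaleC_left[of "cnj c" "T z" y] inner_scaleC_left[of "cnj c" z "S y"]
      by (simp add: S(2)[symmetric] Tc)
    then show ?thesis using vector_eq_ldot by blast
  qed
  have adj: "cinner (T x) y = cinner x (S y)" for x y
    by (simp add: cinner_eq_inner S(2) Sc[symmetric])
  have "cadjoint T = S"
    unfolding cadjoint_def
  proof (rule the_equality)
    show "\<forall>x y. cinner (T x) y = cinner x (S y)" using adj by blast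
    fix S' assume S': "\<forall>x y. cinner (T x) y = cinner x (S' y)"
    show "S' = S"
    proof
      fix y
      have "inner z (S' y) = inner z (S y)" for z
        using S'[rule_format, of z y] by (simp add: adj inner_eq_Re_cinner)
      then show "S' y = S y" using vector_eq_ldot by blast
    qed
  qed
  then show "cinner (T x) y = cinner x (cadjoint T y)" "bounded_clinear (cadjoint T)"
    using adj S(1) Sc by (auto simp: bounded_clinear_def)
qed

lemma inner_cadjoint: "bounded_clinear T \<Longrightarrow> inner (T x) y = inner x (cadjoint T y)"
  by (simp add: inner_eq_Re_cinner cinner_cadjoint)

lemma bounded_clinear_column:
  "bounded_clinear T1 \<Longrightarrow> bounded_clinear T2 \<Longrightarrow> bounded_clinear (column (T1, T2))"
  by (simp add: column_def bounded_clinear_Pair)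

lemma joint_modulus:
  assumes T: "bounded_clinear T1" "bounded_clinear T2"
  shows positive_joint_modulus: "positive_operator (joint_modulus (T1, T2))"
    and norm_joint_modulus: "norm (joint_modulus (T1, T2) x) = norm (column (T1, T2) x)"
proof -
  let ?A = "\<lambda>x. cadjoint T1 (T1 x) + cadjoint T2 (T2 x)"
  have flip: "inner (cadjoint T x) y = inner x (T y)" if "bounded_clinear T" for T :: "'a \<Rightarrow> 'a" and x y
    using inner_cadjoint[OF that, of y x] by (simp add: inner_commute)
  have A: "positive_operator ?A"
    unfolding positive_operator_iff
  proof (intro conjI allI)
    show "bounded_clinear ?A"
      by (rule bounded_clinear_add;
          rule bounded_clinear_compose[OF bounded_clinear_cadjoint]; rule T)
    show "inner (?A x) y = inner x (?A y)" for x y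
      by (simp add: inner_add_left inner_add_right flip T inner_cadjoint[OF T(1), symmetric]
          inner_cadjoint[OF T(2), symmetric])
    show "0 \<le> inner (?A x) x" for x
      by (simp add: inner_add_left flip T)
  qed
  have P: "joint_modulus (T1, T2) = operator_sqrt ?A" by (simp add: joint_modulus_def)
  show pos: "positive_operator (joint_modulus (T1, T2))"
    unfolding P by (rule positive_operator_sqrt[OF A])
  have "inner (joint_modulus (T1, T2) x) (joint_modulus (T1, T2) x) = inner x (?A x)"
    unfolding positive_operator_symmetric[OF pos] unfolding P operator_sqrt_sqrt[OF A] ..
  also have "\<dots> = inner (column (T1, T2) x) (column (T1, T2) x)"
    by (simp add: inner_add_right inner_cadjoint T column_def)
  finally show "norm (joint_modulus (T1, T2) x) = norm (column (T1, T2) x)"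
    by (simp add: norm_eq_sqrt_inner)
qed

section \<open>Existence and uniqueness of the polar decomposition\<close>

lemma bounded_clinear_eq_on_closure:
  assumes f: "bounded_clinear f" and g: "bounded_clinear g"
    and eq: "\<And>x. x \<in> S \<Longrightarrow> f x = g x" and x: "x \<in> closure S"
  shows "f x = g x"
proof -
  obtain u where u: "\<And>n. u n \<in> S" "u \<longlonglongrightarrow> x" using x unfolding closure_sequential by blast
  have "(\<lambda>n. f (u n)) \<longlonglongrightarrow> f x"
    by (rule bounded_linear.tendsto[OF bounded_clinear_bounded_linear[OF f] u(2)])
  moreover have "(\<lambda>n. f (u n)) \<longlonglongrightarrow> g x"
    using bounded_linear.tendsto[OF bounded_clinear_bounded_linear[OF g] u(2)] by (simp add: eq u(1))
  ultimately show ?thesis by (rule LIMSEQ_unique)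
qed

context
  fixes P :: "'a::complex_hilbert_space \<Rightarrow> 'a"
  assumes P: "positive_operator P"
begin

lemma csubspace_closure_range:
  "csubspace (closure (range P))" "closed (closure (range P))" "subspace (closure (range P))"
  using csubspace_closure[OF csubspace_range[OF bounded_clinear_clinear[OF positive_operator_bounded_clinear[OF P]]]]
  by (auto intro: csubspace_subspace)

lemma kernel_complement_hproj: "P (x - hproj (closure (range P)) x) = 0"
proof -
  have "inner (P (x - hproj (closure (range P)) x)) z = 0" for z
  proof -
    have "P z \<in> closure (range P)" by (rule subsetD[OF closure_subset]) simp
    from hproj_orthogonal[OF csubspace_closure_range(2,3) this, of x] show ?thesis
      by (simp add: positive_operator_symmetric[OF P])
  qed
  then show ?thesis using inner_eq_zero_iff by blast
qed

text \<open>The space is the orthogonal sum of the closure of \<open>range P\<close> and the kernel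
  of \<open>P\<close>. Used for the uniqueness of the polar part and for the criss-cross
  identity.\<close>

lemma bounded_clinear_eq_if_eq_on_range_kernel:
  assumes V: "bounded_clinear V" and W: "bounded_clinear W"
    and range: "\<And>x. V (P x) = W (P x)" and kernel: "\<And>x. P x = 0 \<Longrightarrow> V x = W x"
  shows "V x = W x"
proof -
  interpret V: bounded_linear V by (rule bounded_clinear_bounded_linear[OF V])
  interpret W: bounded_linear W by (rule bounded_clinear_bounded_linear[OF W])
  let ?m = "hproj (closure (range P)) x"
  have "V ?m = W ?m"
    by (rule bounded_clinear_eq_on_closure[OF V W _ hproj_in[OF csubspace_closure_range(2,3)]])
      (auto simp: range)
  moreover have "V (x - ?m) = W (x - ?m)"
    by (rule kernel[OF kernel_complement_hproj])
  ultimately show ?thesis by (simp add: V.diff W.diff)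
qed

end

context
  fixes P :: "'a::complex_hilbert_space \<Rightarrow> 'a" and T :: "'a \<Rightarrow> 'b::complex_hilbert_space"
  assumes P: "positive_operator P" and T: "bounded_clinear T"
    and norm_eq: "\<And>x. norm (P x) = norm (T x)"
begin

text \<open>The isometry from the range of \<open>P\<close> onto that of \<open>T\<close> is extended by closing its graph.\<close>

lemma polar_isometry_exists:
  obtains W where "bounded_clinear W" "\<And>x. W (P x) = T x" "\<And>x. P x = 0 \<Longrightarrow> W x = 0"
    "\<And>x. x \<in> closure (range P) \<Longrightarrow> norm (W x) = norm x"
proof -
  note RM = csubspace_closure_range(2,3)[OF P]
  note Pb = positive_operator_bounded_clinear[OF P]
  interpret P: bounded_linear P by (rule bounded_clinear_bounded_linear[OF Pb])
  interpret T: bounded_linear T by (rule bounded_clinear_bounded_linear[OF T])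
  define G where "G = closure (range (\<lambda>z. (P z, T z)))"
  have G: "csubspace G"
    unfolding G_def
    by (intro csubspace_closure csubspace_range bounded_clinear_clinear bounded_clinear_Pair Pb T)
  \<comment> \<open>Equality of norms is a closed condition, so it persists on \<open>G\<close>; for
    the linear subspace \<open>G\<close> it says that \<open>G\<close> is the graph of an
    isometry.\<close>
  have "closed {w::'a \<times> 'b. norm (fst w) = norm (snd w)}"
    by (intro closed_Collect_eq continuous_intros)
  then have "G \<subseteq> {w. norm (fst w) = norm (snd w)}"
    unfolding G_def by (intro closure_minimal) (auto simp: norm_eq)
  then have iso: "norm u = norm v" if "(u, v) \<in> G" for u v
    using that by auto
  have uniq: "v = v'" if "(u, v) \<in> G" "(u, v') \<in> G" for u v v'
  proof -
    have "(u, v) - (u, v') \<in> G" using that by (rule complex_vs.subspace_diff[OF G])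
    then show ?thesis using iso[of 0 "v - v'"] by simp
  qed
  have ex: "\<exists>v. (m, v) \<in> G" if "m \<in> closure (range P)" for m
  proof -
    obtain u where u: "\<And>n. u n \<in> range P" "u \<longlonglongrightarrow> m"
      using \<open>m \<in> closure (range P)\<close> unfolding closure_sequential by blast
    have "\<exists>w. u n = P w" for n using u(1)[of n] by blast
    then obtain z where z: "\<And>n. u n = P (z n)" by metis
    have "dist (T (z i)) (T (z j)) = dist (u i) (u j)" for i j
      by (simp add: dist_norm z P.diff[symmetric] T.diff[symmetric] norm_eq)
    then have "Cauchy (\<lambda>n. T (z n))"
      using LIMSEQ_imp_Cauchy[OF u(2)] by (simp add: Cauchy_def)
    then obtain v where v: "(\<lambda>n. T (z n)) \<longlonglongrightarrow> v"
      using Cauchy_convergent convergent_def by blast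
    have "(\<lambda>n. (P (z n), T (z n))) \<longlonglongrightarrow> (m, v)"
      using u(2) v by (intro tendsto_Pair) (simp_all add: z[symmetric])
    then have "(m, v) \<in> G"
      unfolding G_def closure_sequential by (intro exI[of _ "\<lambda>n. (P (z n), T (z n))"]) auto
    then show ?thesis ..
  qed
  \<comment> \<open>Projecting first extends the isometry by zero to the orthogonal complement of
    the closure of \<open>range P\<close>, which is the kernel of \<open>P\<close>.\<close>
  define W where "W x = (SOME v. (hproj (closure (range P)) x, v) \<in> G)" for x
  have W: "(hproj (closure (range P)) x, W x) \<in> G" for x
    unfolding W_def using ex[OF hproj_in[OF RM]] by (rule someI_ex)
  have W_eq: "W x = v" if "(hproj (closure (range P)) x, v) \<in> G" for x v
    using uniq[OF W that] .
  interpret Q: bounded_linear "hproj (closure (range P))" by (rule bounded_linear_hproj[OF RM])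
  have Qc: "hproj (closure (range P)) (c *\<^sub>C x) = c *\<^sub>C hproj (closure (range P)) x" for c x
    using bounded_clinear_hproj[OF RM(1) csubspace_closure_range(1)[OF P]] by (simp add: bounded_clinear_def)
  show thesis
  proof (rule that)
    show "bounded_clinear W"
    proof (rule bounded_clinear_intro)
      show "clinear W"
        unfolding clinear_iff
      proof (intro conjI allI)
        fix x y c
        show "W (x + y) = W x + W y"
          using complex_vs.subspace_add[OF G W[of x] W[of y]] by (intro W_eq) (simp add: Q.add)
        show "W (c *\<^sub>C x) = c *\<^sub>C W x"
          using complex_vs.subspace_scale[OF G W[of x], of c]
          by (intro W_eq) (simp add: Qc scaleC_prod_def)
      qed
      show "norm (W x) \<le> norm x * 1" for x
        using iso[OF W[of x]] hproj_norm_le[OF RM, of x] by simp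
    qed
    show "W (P x) = T x" for x
    proof (rule W_eq)
      have "P x \<in> closure (range P)" by (rule subsetD[OF closure_subset]) simp
      moreover have "(P x, T x) \<in> G" unfolding G_def by (rule subsetD[OF closure_subset]) simp
      ultimately show "(hproj (closure (range P)) (P x), T x) \<in> G" by (simp add: hproj_ident[OF RM])
    qed
    show "W x = 0" if x: "P x = 0" for x
    proof (rule W_eq)
      have "inner x m = 0" if "m \<in> closure (range P)" for m
      proof -
        have "closed {m. inner x m = 0}" by (intro closed_Collect_eq continuous_intros)
        then have "closure (range P) \<subseteq> {m. inner x m = 0}"
          by (intro closure_minimal) (auto simp: positive_operator_symmetric[OF P, symmetric] x)
        then show ?thesis using that by auto
      qed
      then have "hproj (closure (range P)) x = 0" by (simp add: hproj_eq_0_iff[OF RM])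
      then show "(hproj (closure (range P)) x, 0) \<in> G" using complex_vs.subspace_0[OF G] by (simp add: zero_prod_def)
    qed
    show "norm (W x) = norm x" if "x \<in> closure (range P)" for x
      using iso[OF W[of x]] by (simp add: hproj_ident[OF RM that])
  qed
qed

text \<open>The component of \<open>x\<close> orthogonal to \<open>range P\<close> lies in the
  kernel of \<open>W\<close>. If \<open>x\<close> is orthogonal to that kernel, the component
  vanishes and \<open>x\<close> lies where \<open>W\<close> is isometric; if \<open>W x = 0\<close>,
  the other component vanishes.\<close>

lemma polar_isometry_partial_isometry:
  assumes W: "bounded_clinear W" "\<And>x. P x = 0 \<Longrightarrow> W x = 0"
    "\<And>x. x \<in> closure (range P) \<Longrightarrow> norm (W x) = norm x"
  shows "partial_isometry W" "W x = 0 \<longleftrightarrow> P x = 0"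
proof -
  note RM = csubspace_closure_range(2,3)[OF P]
  interpret W: bounded_linear W by (rule bounded_clinear_bounded_linear[OF W(1)])
  interpret P: bounded_linear P
    by (rule bounded_clinear_bounded_linear[OF positive_operator_bounded_clinear[OF P]])
  show "partial_isometry W"
    unfolding partial_isometry_def
  proof (intro conjI allI impI W(1))
    fix x assume x: "\<forall>y\<in>W -` {0}. cinner x y = 0"
    define y where "y = x - hproj (closure (range P)) x"
    have "W y = 0" unfolding y_def by (rule W(2)[OF kernel_complement_hproj[OF P]])
    then have "inner x y = 0" using x by (simp add: inner_eq_Re_cinner)
    moreover have "inner (hproj (closure (range P)) x) y = 0"
      using hproj_orthogonal[OF RM hproj_in[OF RM], of x x] by (simp add: y_def inner_commute)
    ultimately have "inner y y = 0" by (simp add: y_def inner_diff_left)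
    then have "x = hproj (closure (range P)) x" by (simp add: y_def)
    then have "x \<in> closure (range P)" using hproj_in[OF RM, of x] by simp
    then show "norm (W x) = norm x" by (rule W(3))
  qed
  show "W x = 0 \<longleftrightarrow> P x = 0"
  proof
    assume Wx: "W x = 0"
    have k: "P (x - hproj (closure (range P)) x) = 0" by (rule kernel_complement_hproj[OF P])
    have "W (hproj (closure (range P)) x) = 0" using W(2)[OF k] Wx by (simp add: W.diff)
    then have "hproj (closure (range P)) x = 0" using W(3)[OF hproj_in[OF RM], of x] by simp
    then show "P x = 0" using k by simp
  qed (rule W(2))
qed

end

text \<open>Resolves the definite descriptions once and for all: the argument about Koszul complexes
  uses only these properties of \<open>R\<close>, \<open>V1\<close> and \<open>V2\<close>.\<close>

lemma spherical_aluthge_factorization: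
  assumes T: "bounded_clinear T1" "bounded_clinear T2"
  obtains R V1 V2 where "positive_operator R" "bounded_clinear V1" "bounded_clinear V2"
    "\<And>x. T1 x = V1 (R (R x))" "\<And>x. T2 x = V2 (R (R x))"
    "\<And>x. R x = 0 \<Longrightarrow> V1 x = 0" "\<And>x. R x = 0 \<Longrightarrow> V2 x = 0"
    "\<And>x. norm (R (R x)) = norm (column (T1, T2) x)"
    "spherical_aluthge (T1, T2) = (\<lambda>x. R (V1 (R x)), \<lambda>x. R (V2 (R x)))"
proof -
  define P where "P = joint_modulus (T1, T2)"
  have P: "positive_operator P" unfolding P_def by (rule positive_joint_modulus[OF T])
  have norm_eq: "norm (P x) = norm (column (T1, T2) x)" for x
    unfolding P_def by (rule norm_joint_modulus[OF T])
  have colT: "bounded_clinear (column (T1, T2))" by (rule bounded_clinear_column[OF T])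
  obtain W where W: "bounded_clinear W" "\<And>x. W (P x) = column (T1, T2) x" "\<And>x. P x = 0 \<Longrightarrow> W x = 0"
    "\<And>x. x \<in> closure (range P) \<Longrightarrow> norm (W x) = norm x"
    using polar_isometry_exists[OF P colT norm_eq] by blast
  define V1 V2 where "V1 x = fst (W x)" and "V2 x = snd (W x)" for x
  have colV: "column (V1, V2) = W" by (simp add: column_def V1_def V2_def)
  have colU: "column (U1, U2) x = 0 \<longleftrightarrow> U1 x = 0 \<and> U2 x = 0" for U1 U2 :: "'a \<Rightarrow> 'a" and x
    by (simp add: column_def zero_prod_def)
  note pW = polar_isometry_partial_isometry[OF P colT norm_eq W(1,3,4)]
  have is_polar: "is_joint_polar_part (T1, T2) (V1, V2)"
    unfolding is_joint_polar_part_def prod.case P_def[symmetric] colV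
  proof (intro conjI)
    show "column (T1, T2) = W \<circ> P" by (auto simp: W(2))
    show "partial_isometry W" by (rule pW)
    have ker: "T1 x = 0 \<and> T2 x = 0 \<longleftrightarrow> P x = 0" "V1 x = 0 \<and> V2 x = 0 \<longleftrightarrow> P x = 0" for x
      using norm_eq[of x] colU[of T1 T2 x] colU[of V1 V2 x] pW(2)[of x] colV by auto
    show "T1 -` {0} \<inter> T2 -` {0} = V1 -` {0} \<inter> V2 -` {0}" "V1 -` {0} \<inter> V2 -` {0} = P -` {0}"
      using ker by auto
  qed
  \<comment> \<open>The column of any other polar part agrees with \<open>W\<close> on
    \<open>range P\<close> by the factorization, and on the kernel of \<open>P\<close> by the kernel
    condition.\<close>
  have "V = (V1, V2)" if V: "is_joint_polar_part (T1, T2) V" for V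
  proof -
    obtain U1 U2 where V_eq: "V = (U1, U2)" by fastforce
    note U = V[unfolded V_eq is_joint_polar_part_def prod.case P_def[symmetric]]
    have U0: "column (U1, U2) x = 0" if "P x = 0" for x
    proof -
      have "x \<in> U1 -` {0} \<inter> U2 -` {0}" using U that by auto
      then show ?thesis by (simp add: colU)
    qed
    have bU: "bounded_clinear (column (U1, U2))" using U by (simp add: partial_isometry_def)
    have "column (U1, U2) (P x) = W (P x)" for x
      using U W(2)[of x] by (metis comp_apply)
    then have "column (U1, U2) x = W x" for x
      by (rule bounded_clinear_eq_if_eq_on_range_kernel[OF P bU W(1)]) (simp add: U0 W(3))
    then have "U1 x = V1 x \<and> U2 x = V2 x" for x
      by (simp add: colV[symmetric] column_def)
    then show ?thesis by (auto simp: V_eq)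
  qed
  with is_polar have part: "joint_polar_part (T1, T2) = (V1, V2)"
    unfolding joint_polar_part_def by (rule the_equality)
  define R where "R = operator_sqrt P"
  have R: "positive_operator R" unfolding R_def by (rule positive_operator_sqrt[OF P])
  have RR: "R (R x) = P x" for x unfolding R_def by (rule operator_sqrt_sqrt[OF P])
  interpret R: bounded_linear R
    by (rule bounded_clinear_bounded_linear[OF positive_operator_bounded_clinear[OF R]])
  have ker: "P x = 0" if "R x = 0" for x
    using that RR[of x] R.zero by simp
  show thesis
  proof (rule that[OF R])
    show "bounded_clinear V1" "bounded_clinear V2"
      unfolding V1_def V2_def
      using W(1) bounded_clinear_fst bounded_clinear_snd by (auto intro: bounded_clinear_compose)
    show "T1 x = V1 (R (R x))" "T2 x = V2 (R (R x))" for x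
      by (simp_all add: RR V1_def V2_def W(2) column_def)
    show "V1 x = 0" "V2 x = 0" if "R x = 0" for x
      using W(3)[OF ker[OF that]] by (simp_all add: V1_def V2_def)
    show "norm (R (R x)) = norm (column (T1, T2) x)" for x
      by (simp add: RR norm_eq)
    show "spherical_aluthge (T1, T2) = (\<lambda>x. R (V1 (R x)), \<lambda>x. R (V2 (R x)))"
      by (simp add: spherical_aluthge_def part P_def[symmetric] R_def[symmetric] Let_def comp_def)
  qed
qed

section \<open>Homology of the Koszul complex\<close>

text \<open>Closed ranges are deliberately absent: the comparisons of homology are then purely
  algebraic, and closedness is recovered in \<open>fredholm_pair_iff_koszul_dims\<close>.\<close>

definition koszul_dims :: "'a::complex_hilbert_space operator_pair \<Rightarrow> nat \<Rightarrow> nat \<Rightarrow> nat \<Rightarrow> bool" where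
  "koszul_dims S a b c \<longleftrightarrow>
    has_quotient_dim (column S -` {0}) {0} a \<and>
    has_quotient_dim (koszul_row S -` {0}) (range (column S)) b \<and>
    has_quotient_dim UNIV (range (koszul_row S)) c"

lemma clinear_column: "clinear S1 \<Longrightarrow> clinear S2 \<Longrightarrow> clinear (column (S1, S2))"
  by (simp add: clinear_iff column_def scaleC_prod_def)

lemma clinear_koszul_row: "clinear S1 \<Longrightarrow> clinear S2 \<Longrightarrow> clinear (koszul_row (S1, S2))"
  by (simp add: clinear_iff koszul_row_def scaleC_prod_def scaleC_add_right
      complex_vs.scale_right_diff_distrib split: prod.splits)

lemma bounded_clinear_koszul_row:
  assumes "bounded_clinear S1" "bounded_clinear S2"
  shows "bounded_clinear (koszul_row (S1, S2))"
  using bounded_clinear_add[OF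
      bounded_clinear_minus[OF bounded_clinear_compose[OF assms(2) bounded_clinear_fst]]
      bounded_clinear_compose[OF assms(1) bounded_clinear_snd]]
  by (simp add: koszul_row_def case_prod_unfold)

lemma column_zero_iff: "column (S1, S2) x = 0 \<longleftrightarrow> S1 x = 0 \<and> S2 x = 0"
  by (simp add: column_def zero_prod_def)

lemma koszul_row_zero_iff: "koszul_row (S1, S2) (x, y) = 0 \<longleftrightarrow> S1 y = S2 x"
  by (auto simp: koszul_row_def algebra_simps)

lemma koszul_spaces:
  assumes "clinear S1" "clinear S2"
  shows "csubspace (column (S1, S2) -` {0})" "csubspace (koszul_row (S1, S2) -` {0})"
    "csubspace (range (column (S1, S2)))" "csubspace (range (koszul_row (S1, S2)))"
  using assms
  by (auto intro!: csubspace_vimage csubspace_range clinear_column clinear_koszul_row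
      complex_vs.subspace_single_0)

lemma range_column_subset:
  assumes "\<And>x. S1 (S2 x) = S2 (S1 x)"
  shows "range (column (S1, S2)) \<subseteq> koszul_row (S1, S2) -` {0}"
  using assms by (auto simp: column_def koszul_row_zero_iff)

lemma fredholm_pair_iff_koszul_dims:
  assumes S: "bounded_clinear S1" "bounded_clinear S2" "\<And>x. S1 (S2 x) = S2 (S1 x)"
  shows "fredholm_pair (S1, S2) \<longleftrightarrow> (\<exists>a b c. koszul_dims (S1, S2) a b c)"
proof
  assume "\<exists>a b c. koszul_dims (S1, S2) a b c"
  then obtain a b c where d: "koszul_dims (S1, S2) a b c" by blast
  note row = bounded_clinear_koszul_row[OF S(1,2)] and col = bounded_clinear_column[OF S(1,2)]
  note spaces = koszul_spaces[OF S(1,2)[THEN bounded_clinear_clinear]]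
  have "closed (koszul_row (S1, S2) -` {0})"
    by (intro continuous_closed_vimage linear_continuous_at bounded_clinear_bounded_linear row) simp
  then have "closed (range (column (S1, S2)))"
    using d by (intro closed_range_if_finite_quotient[OF col _ spaces(2) range_column_subset[of S1 S2, OF S(3)]])
      (auto simp: koszul_dims_def)
  moreover have "closed (range (koszul_row (S1, S2)))"
    using d by (intro closed_range_if_finite_quotient[OF row, of UNIV]) (auto simp: koszul_dims_def)
  ultimately show "fredholm_pair (S1, S2)"
    using d by (auto simp: fredholm_pair_def koszul_dims_def finite_dim_quotient_iff)
qed (auto simp: fredholm_pair_def koszul_dims_def finite_dim_quotient_iff)

lemma fredholm_index_eq:
  assumes "clinear S1" "clinear S2" "koszul_dims (S1, S2) a b c"
  shows "fredholm_index (S1, S2) = int a - int b + int c"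
proof -
  note sp = koszul_spaces[OF assms(1,2)] and d = assms(3)[unfolded koszul_dims_def]
  have "quotient_dim (column (S1, S2) -` {0}) {0} = a"
    using d by (intro quotient_dim_eqI) auto
  moreover have "quotient_dim (koszul_row (S1, S2) -` {0}) (range (column (S1, S2))) = b"
    using d sp by (intro quotient_dim_eqI) auto
  moreover have "quotient_dim UNIV (range (koszul_row (S1, S2))) = c"
    using d sp by (intro quotient_dim_eqI) auto
  ultimately show ?thesis by (simp add: fredholm_index_def)
qed

text \<open>On the quotients \<open>F\<close> and \<open>G\<close> compose to the scalar
  \<open>c\<close> both ways, so \<open>G\<close> divided by \<open>c\<close> inverts the map
  induced by \<open>F\<close>.\<close>

lemma has_quotient_dim_inverse_up_to_scale:
  assumes F: "clinear F" and G: "clinear G" and c: "c \<noteq> 0"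
    and K: "csubspace K" and L: "csubspace L" "L \<subseteq> K" and K': "csubspace K'" and L': "csubspace L'"
    and F_maps: "\<And>x. x \<in> K \<Longrightarrow> F x \<in> K'" "\<And>x. x \<in> L \<Longrightarrow> F x \<in> L'"
    and G_maps: "\<And>y. y \<in> K' \<Longrightarrow> G y \<in> K" "\<And>y. y \<in> L' \<Longrightarrow> G y \<in> L"
    and GF: "\<And>x. x \<in> K \<Longrightarrow> G (F x) - c *\<^sub>C x \<in> L"
    and FG: "\<And>y. y \<in> K' \<Longrightarrow> F (G y) - c *\<^sub>C y \<in> L'"
  shows "has_quotient_dim K' L' n \<longleftrightarrow> has_quotient_dim K L n"
proof (rule has_quotient_dim_iso[OF F K L L'])
  interpret F: Vector_Spaces.linear scaleC scaleC F by fact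
  show "F x \<in> K'" if "x \<in> K" for x using that by (rule F_maps)
  show "F x \<in> L' \<longleftrightarrow> x \<in> L" if x: "x \<in> K" for x
  proof
    assume "F x \<in> L'"
    then have "G (F x) - (G (F x) - c *\<^sub>C x) \<in> L"
      by (intro complex_vs.subspace_diff[OF L(1)] GF x G_maps)
    then have "c *\<^sub>C x \<in> L" by simp
    from complex_vs.subspace_scale[OF L(1) this, of "inverse c"] show "x \<in> L"
      using c by (simp add: scaleC_scaleC)
  qed (rule F_maps)
  show "\<exists>x\<in>K. y - F x \<in> L'" if y: "y \<in> K'" for y
  proof
    show "inverse c *\<^sub>C G y \<in> K" using complex_vs.subspace_scale[OF K G_maps(1)[OF y]] .
    have "y - F (inverse c *\<^sub>C G y) = - inverse c *\<^sub>C (F (G y) - c *\<^sub>C y)"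
      using c by (simp add: F.scale complex_vs.scale_right_diff_distrib scaleC_scaleC)
    then show "y - F (inverse c *\<^sub>C G y) \<in> L'"
      using complex_vs.subspace_scale[OF L' FG[OF y], of "- inverse c"] by simp
  qed
qed

text \<open>
  Each of the two operators of a commuting pair is null-homotopic on its Koszul complex. Hence chain
  maps \<open>f\<close> and \<open>g\<close> whose composites are a nonzero scalar up to such an operator are mutually
  inverse on homology, up to the scalar.
\<close>

lemma koszul_dims_homotopy_equivalence:
  fixes S1 S2 S1' S2' :: "'a::complex_hilbert_space \<Rightarrow> 'a"
  assumes S: "clinear S1" "clinear S2" "\<And>x. S1 (S2 x) = S2 (S1 x)"
    and S': "clinear S1'" "clinear S2'" "\<And>x. S1' (S2' x) = S2' (S1' x)"
    and f: "clinear f" "\<And>x. f (S1 x) = S1' (f x)" "\<And>x. f (S2 x) = S2' (f x)"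
    and g: "clinear g" "\<And>x. g (S1' x) = S1 (g x)" "\<And>x. g (S2' x) = S2 (g x)"
    and c: "c \<noteq> 0"
    and N: "\<And>x. g (f x) - c *\<^sub>C x = N x" "\<And>x. f (g x) - c *\<^sub>C x = N' x"
    and null: "N = (\<lambda>x. 0) \<and> N' = (\<lambda>x. 0) \<or> N = S1 \<and> N' = S1' \<or> N = S2 \<and> N' = S2'"
  shows "koszul_dims (S1', S2') p q r \<longleftrightarrow> koszul_dims (S1, S2) p q r"
proof -
  let ?ff = "\<lambda>u. (f (fst u), f (snd u))" and ?gg = "\<lambda>u. (g (fst u), g (snd u))"
  have ff: "clinear ?ff" and gg: "clinear ?gg"
    using f(1) g(1) by (simp_all add: clinear_iff scaleC_prod_def)
  interpret f: Vector_Spaces.linear scaleC scaleC f by fact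
  interpret g: Vector_Spaces.linear scaleC scaleC g by fact
  have null_col: "A x = 0" if "column (A1, A2) x = 0" "A = (\<lambda>x. 0) \<or> A = A1 \<or> A = A2"
    for A A1 A2 :: "'a \<Rightarrow> 'a" and x
    using that by (auto simp: column_zero_iff)
  \<comment> \<open>Explicit homotopy: on a cycle \<open>A1 y = A2 x\<close>, so applying
    \<open>A1\<close> to both entries gives the column of \<open>x\<close>, and applying
    \<open>A2\<close> gives the column of \<open>y\<close>.\<close>
  have null_mid: "(A x, A y) \<in> range (column (A1, A2))"
    if "koszul_row (A1, A2) (x, y) = 0" "A = (\<lambda>x. 0) \<or> A = A1 \<or> A = A2" "clinear A1" "clinear A2"
    for A A1 A2 :: "'a \<Rightarrow> 'a" and x y
  proof -
    have "(0, 0) = column (A1, A2) 0"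
      using complex_vs_pair.linear_0 that(3,4) by (auto simp: column_def)
    moreover have "A1 y = A2 x" using that(1) by (simp add: koszul_row_zero_iff)
    then have "(A1 x, A1 y) = column (A1, A2) x" "(A2 x, A2 y) = column (A1, A2) y"
      by (simp_all add: column_def)
    ultimately show ?thesis using that(2) by (auto simp del: Pair_inject)
  qed
  have null_row: "A x \<in> range (koszul_row (A1, A2))"
    if "A = (\<lambda>x. 0) \<or> A = A1 \<or> A = A2" "clinear A1" "clinear A2" for A A1 A2 :: "'a \<Rightarrow> 'a" and x
  proof -
    interpret A1: Vector_Spaces.linear scaleC scaleC A1 by fact
    interpret A2: Vector_Spaces.linear scaleC scaleC A2 by fact
    have "0 = koszul_row (A1, A2) (0, 0)" "A1 x = koszul_row (A1, A2) (0, x)"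
      "A2 x = koszul_row (A1, A2) (- x, 0)"
      by (simp_all add: koszul_row_def A1.zero A2.zero A2.neg)
    then show ?thesis using that(1) by auto
  qed
  note sp = koszul_spaces[OF S(1,2)] and sp' = koszul_spaces[OF S'(1,2)]
  have nulls: "N = (\<lambda>x. 0) \<or> N = S1 \<or> N = S2" "N' = (\<lambda>x. 0) \<or> N' = S1' \<or> N' = S2'"
    using null by auto
  have "has_quotient_dim (column (S1', S2') -` {0}) {0} p
      \<longleftrightarrow> has_quotient_dim (column (S1, S2) -` {0}) {0} p"
  proof (rule has_quotient_dim_inverse_up_to_scale[OF f(1) g(1) c])
    show "g (f x) - c *\<^sub>C x \<in> {0}" if "x \<in> column (S1, S2) -` {0}" for x
      using null_col[OF _ nulls(1), of x] that by (simp add: N)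
    show "f (g x) - c *\<^sub>C x \<in> {0}" if "x \<in> column (S1', S2') -` {0}" for x
      using null_col[OF _ nulls(2), of x] that by (simp add: N)
    show "f x \<in> column (S1', S2') -` {0}" if "x \<in> column (S1, S2) -` {0}" for x
      using that by (simp add: column_zero_iff f(2,3)[symmetric] f.zero)
    show "g x \<in> column (S1, S2) -` {0}" if "x \<in> column (S1', S2') -` {0}" for x
      using that by (simp add: column_zero_iff g(2,3)[symmetric] g.zero)
    show "{0} \<subseteq> column (S1, S2) -` {0}" using complex_vs.subspace_0[OF sp(1)] by simp
  qed (use sp(1) sp'(1) in \<open>auto simp: f.zero g.zero complex_vs.subspace_single_0\<close>)
  moreover have "has_quotient_dim (koszul_row (S1', S2') -` {0}) (range (column (S1', S2'))) q
      \<longleftrightarrow> has_quotient_dim (koszul_row (S1, S2) -` {0}) (range (column (S1, S2))) q"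
  proof (rule has_quotient_dim_inverse_up_to_scale[OF ff gg c sp(2,3) range_column_subset[of S1 S2, OF S(3)] sp'(2,3)])
    fix u :: "'a \<times> 'a"
    obtain x y where u: "u = (x, y)" by fastforce
    show "?gg (?ff u) - c *\<^sub>C u \<in> range (column (S1, S2))" if "u \<in> koszul_row (S1, S2) -` {0}"
      using null_mid[OF _ nulls(1) S(1,2), of x y] that by (simp add: u scaleC_prod_def N)
    show "?ff (?gg u) - c *\<^sub>C u \<in> range (column (S1', S2'))" if "u \<in> koszul_row (S1', S2') -` {0}"
      using null_mid[OF _ nulls(2) S'(1,2), of x y] that by (simp add: u scaleC_prod_def N)
    show "?ff u \<in> koszul_row (S1', S2') -` {0}" if "u \<in> koszul_row (S1, S2) -` {0}"
      using that by (simp add: u koszul_row_zero_iff f(2,3)[symmetric])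
    show "?gg u \<in> koszul_row (S1, S2) -` {0}" if "u \<in> koszul_row (S1', S2') -` {0}"
      using that by (simp add: u koszul_row_zero_iff g(2,3)[symmetric])
    show "?ff u \<in> range (column (S1', S2'))" if "u \<in> range (column (S1, S2))"
      using that by (auto simp: column_def f)
    show "?gg u \<in> range (column (S1, S2))" if "u \<in> range (column (S1', S2'))"
      using that by (auto simp: column_def g)
  qed
  moreover have "has_quotient_dim UNIV (range (koszul_row (S1', S2'))) r
      \<longleftrightarrow> has_quotient_dim UNIV (range (koszul_row (S1, S2))) r"
  proof (rule has_quotient_dim_inverse_up_to_scale[OF f(1) g(1) c complex_vs.subspace_UNIV sp(4) _
        complex_vs.subspace_UNIV sp'(4)])
    show "g (f x) - c *\<^sub>C x \<in> range (koszul_row (S1, S2))" for x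
      using null_row[OF nulls(1) S(1,2)] by (simp add: N)
    show "f (g x) - c *\<^sub>C x \<in> range (koszul_row (S1', S2'))" for x
      using null_row[OF nulls(2) S'(1,2)] by (simp add: N)
    fix x
    have "f (koszul_row (S1, S2) u) = koszul_row (S1', S2') (?ff u)" for u
      by (simp add: koszul_row_def case_prod_unfold f.diff f)
    then show "f x \<in> range (koszul_row (S1', S2'))" if "x \<in> range (koszul_row (S1, S2))"
      using that by auto
    have "g (koszul_row (S1', S2') u) = koszul_row (S1, S2) (?gg u)" for u
      by (simp add: koszul_row_def case_prod_unfold g.diff g)
    then show "g x \<in> range (koszul_row (S1, S2))" if "x \<in> range (koszul_row (S1', S2'))"
      using that by auto
  qed auto
  ultimately show ?thesis by (simp add: koszul_dims_def)
qed

text \<open>Second isomorphism theorem, induced by the inclusion of \<open>K\<close> into the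
  sum.\<close>

lemma has_quotient_dim_sum:
  assumes K: "csubspace K" and L: "csubspace L"
  shows "has_quotient_dim {x + y | x y. x \<in> L \<and> y \<in> K} L n \<longleftrightarrow> has_quotient_dim K (K \<inter> L) n"
proof (rule has_quotient_dim_iso[OF complex_vs.linear_ident K _ _ L])
  show "csubspace (K \<inter> L)" by (rule complex_vs.subspace_inter[OF K L])
  show "x \<in> {x + y | x y. x \<in> L \<and> y \<in> K}" if "x \<in> K" for x
    using that complex_vs.subspace_0[OF L] by force
  show "\<exists>x\<in>K. y - x \<in> L" if "y \<in> {x + y | x y. x \<in> L \<and> y \<in> K}" for y
    using that by force
qed auto

lemma has_quotient_dim_Times:
  fixes N :: "'a::complex_hilbert_space set"
  assumes N: "csubspace N" "has_quotient_dim N {0} n"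
  shows "has_quotient_dim (N \<times> N) {0} (n + n)"
proof (rule has_quotient_dim_tower)
  have 0: "0 \<in> N" by (rule complex_vs.subspace_0[OF N(1)])
  show sp: "csubspace (N \<times> {0 :: 'a})"
    using N(1) by (auto simp: complex_vs.subspace_def scaleC_prod_def zero_prod_def)
  have NN: "csubspace (N \<times> N)"
    using N(1) by (auto simp: complex_vs.subspace_def scaleC_prod_def zero_prod_def)
  have "has_quotient_dim (N \<times> {0 :: 'a}) {0} n \<longleftrightarrow> has_quotient_dim N {0} n"
  proof (rule has_quotient_dim_iso[where f = "\<lambda>x. (x, 0)"])
    show "clinear (\<lambda>x. (x, 0 :: 'a))" by (simp add: clinear_iff scaleC_prod_def)
    show "csubspace {0 :: 'a \<times> 'a}" by (rule complex_vs.subspace_single_0)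
  qed (use N 0 in \<open>auto simp: zero_prod_def\<close>)
  then show "has_quotient_dim (N \<times> {0 :: 'a}) {0} n" using N(2) by simp
  have "has_quotient_dim N {0} n \<longleftrightarrow> has_quotient_dim (N \<times> N) (N \<times> {0 :: 'a}) n"
  proof (rule has_quotient_dim_iso[where f = snd])
    show "clinear snd" by (rule bounded_clinear_clinear[OF bounded_clinear_snd])
    show "\<exists>x\<in>N \<times> N. y - snd x \<in> {0}" if "y \<in> N" for y
      using that 0 by (intro bexI[of _ "(0, y)"]) auto
  qed (use NN sp 0 in \<open>auto simp: complex_vs.subspace_single_0\<close>)
  then show "has_quotient_dim (N \<times> N) (N \<times> {0 :: 'a}) n" using N(2) by simp
  show "csubspace {0 :: 'a \<times> 'a}" by (rule complex_vs.subspace_single_0)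
  show "{0} \<subseteq> N \<times> {0 :: 'a}" "N \<times> {0 :: 'a} \<subseteq> N \<times> N" using 0 by (auto simp: zero_prod_def)
qed

text \<open>Keeps only the Euler characteristic, the one quantity that survives the passage to a
  compression; existence of some \<open>i\<close> still encodes the Fredholm property.\<close>

definition koszul_index :: "'a::complex_hilbert_space operator_pair \<Rightarrow> int \<Rightarrow> bool" where
  "koszul_index S i \<longleftrightarrow> (\<exists>a b c. koszul_dims S a b c \<and> i = int a - int b + int c)"

lemma fredholm_pair_iff_koszul_index:
  assumes "bounded_clinear S1" "bounded_clinear S2" "\<And>x. S1 (S2 x) = S2 (S1 x)"
  shows "fredholm_pair (S1, S2) \<longleftrightarrow> (\<exists>i. koszul_index (S1, S2) i)"
  using fredholm_pair_iff_koszul_dims[of S1 S2, OF assms] by (auto simp: koszul_index_def)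

lemma koszul_index_fredholm_index:
  assumes "clinear S1" "clinear S2" "koszul_index (S1, S2) i"
  shows "fredholm_index (S1, S2) = i"
  using assms fredholm_index_eq[OF assms(1,2)] by (auto simp: koszul_index_def)

section \<open>Compression modulo a finite-dimensional joint kernel\<close>

lemma subset_sum_set:
  fixes L K :: "'a::monoid_add set"
  assumes "0 \<in> K"
  shows "L \<subseteq> {x + y | x y. x \<in> L \<and> y \<in> K}"
  using assms by force

text \<open>Images of the two complexes are compared through common enlargements: adding
  \<open>N \<times> N\<close> to the column ranges gives one space \<open>E\<close>, adding
  \<open>N\<close> to the row ranges gives one space \<open>F\<close>. All successive quotients that
  differ are subquotients of \<open>N\<close> or \<open>N \<times> N\<close>, hence
  finite-dimensional, so either pair can be the one assumed to have finite homology.\<close>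

lemma koszul_index_compression:
  fixes T1 T2 q :: "'a::complex_hilbert_space \<Rightarrow> 'a"
  assumes T: "clinear T1" "clinear T2" "\<And>x. T1 (T2 x) = T2 (T1 x)"
    and N: "column (T1, T2) -` {0} = N" "has_quotient_dim N {0} n"
    and q: "clinear q" "\<And>x. q x = 0 \<longleftrightarrow> x \<in> N" "\<And>x. q (q x) = q x"
  shows "koszul_index (\<lambda>x. q (T1 x), \<lambda>x. q (T2 x)) i \<longleftrightarrow> koszul_index (T1, T2) i"
proof -
  interpret T1: Vector_Spaces.linear scaleC scaleC T1 by fact
  interpret T2: Vector_Spaces.linear scaleC scaleC T2 by fact
  interpret q: Vector_Spaces.linear scaleC scaleC q by fact
  define D1 D2 where "D1 x = q (T1 x)" and "D2 x = q (T2 x)" for x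
  have D: "clinear D1" "clinear D2"
    using T q(1) by (simp_all add: D1_def D2_def clinear_iff)
  note sp = koszul_spaces[OF T(1,2)] and sp' = koszul_spaces[OF D]
  have N_sub: "csubspace N" using sp(1) by (simp add: N(1))
  note N0 = complex_vs.subspace_0[OF N_sub]
  have N_iff: "x \<in> N \<longleftrightarrow> T1 x = 0 \<and> T2 x = 0" for x
    by (simp add: N(1)[symmetric] column_zero_iff)
  have diff_N: "x - q x \<in> N" for x by (simp add: q(2)[symmetric] q.diff q(3))
  have q_N: "q x = 0" if "q x \<in> N" for x using that q(2)[of "q x"] q(3) by simp
  have NN: "csubspace (N \<times> N)"
    using N_sub by (auto simp: complex_vs.subspace_def scaleC_prod_def zero_prod_def)
  define W B Z where "W = range (koszul_row (T1, T2))" and "B = range (column (T1, T2))"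
    and "Z = koszul_row (T1, T2) -` {0}"
  define W' B' Z' where "W' = range (koszul_row (D1, D2))" and "B' = range (column (D1, D2))"
    and "Z' = koszul_row (D1, D2) -` {0}"
  note subs = sp(2-4)[folded W_def B_def Z_def] sp'(2-4)[folded W'_def B'_def Z'_def]
  define E where "E = {x + y | x y. x \<in> B \<and> y \<in> N \<times> N}"
  define F where "F = {x + y | x y. x \<in> W \<and> y \<in> N}"
  have E_sub: "csubspace E" unfolding E_def by (intro complex_vs.subspace_sums subs NN)
  have F_sub: "csubspace F" unfolding F_def by (intro complex_vs.subspace_sums subs N_sub)
  have row_D: "koszul_row (D1, D2) u = q (koszul_row (T1, T2) u)" for u
    by (simp add: koszul_row_def D1_def D2_def case_prod_unfold q.diff)
  have col_D: "column (T1, T2) x - column (D1, D2) x \<in> N \<times> N" for x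
    using diff_N by (simp add: column_def D1_def D2_def)
  have E_alt: "E = {x + y | x y. x \<in> B' \<and> y \<in> N \<times> N}"
  proof (intro set_eqI iffI)
    fix u assume "u \<in> E"
    then obtain x v where u: "u = column (T1, T2) x + v" "v \<in> N \<times> N"
      unfolding E_def B_def by blast
    then have "u = column (D1, D2) x + ((column (T1, T2) x - column (D1, D2) x) + v)" by simp
    then show "u \<in> {x + y | x y. x \<in> B' \<and> y \<in> N \<times> N}"
      using complex_vs.subspace_add[OF NN col_D u(2)] unfolding B'_def by blast
  next
    fix u assume "u \<in> {x + y | x y. x \<in> B' \<and> y \<in> N \<times> N}"
    then obtain x v where u: "u = column (D1, D2) x + v" "v \<in> N \<times> N"
      unfolding B'_def by blast
    then have "u = column (T1, T2) x + (v - (column (T1, T2) x - column (D1, D2) x))" by simp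
    then show "u \<in> E"
      using complex_vs.subspace_diff[OF NN u(2) col_D] unfolding E_def B_def by blast
  qed
  have F_alt: "F = {x + y | x y. x \<in> W' \<and> y \<in> N}"
  proof (intro set_eqI iffI)
    fix u assume "u \<in> F"
    then obtain x v where u: "u = koszul_row (T1, T2) x + v" "v \<in> N"
      unfolding F_def W_def by blast
    then have "u = koszul_row (D1, D2) x + ((koszul_row (T1, T2) x - q (koszul_row (T1, T2) x)) + v)"
      by (simp add: row_D)
    then show "u \<in> {x + y | x y. x \<in> W' \<and> y \<in> N}"
      using complex_vs.subspace_add[OF N_sub diff_N u(2)] unfolding W'_def by blast
  next
    fix u assume "u \<in> {x + y | x y. x \<in> W' \<and> y \<in> N}"
    then obtain x v where u: "u = koszul_row (D1, D2) x + v" "v \<in> N"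
      unfolding W'_def by blast
    then have "u = koszul_row (T1, T2) x + (v - (koszul_row (T1, T2) x - q (koszul_row (T1, T2) x)))"
      by (simp add: row_D)
    then show "u \<in> F"
      using complex_vs.subspace_diff[OF N_sub u(2) diff_N] unfolding F_def W_def by blast
  qed
  \<comment> \<open>The ranges of the compressed maps consist of values of the projection
    \<open>q\<close>, whose image meets its kernel \<open>N\<close> only in 0. So
    \<open>E / B'\<close> and \<open>F / W'\<close> have the full dimensions of
    \<open>N \<times> N\<close> and \<open>N\<close>.\<close>
  have B'_N: "N \<times> N \<inter> B' = {0}"
  proof -
    have *: "column (D1, D2) x = 0" if "column (D1, D2) x \<in> N \<times> N" for x
      using that q_N by (auto simp: column_def D1_def D2_def zero_prod_def)
    have "u = 0" if u: "u \<in> B'" "u \<in> N \<times> N" for u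
    proof -
      obtain x where "u = column (D1, D2) x" using u(1) unfolding B'_def by blast
      with u(2) * show ?thesis by simp
    qed
    then show ?thesis
      using complex_vs.subspace_0[OF subs(5)] complex_vs.subspace_0[OF NN] by blast
  qed
  have W'_N: "N \<inter> W' = {0}"
  proof -
    have "koszul_row (D1, D2) u = 0" if "koszul_row (D1, D2) u \<in> N" for u
      using that q_N by (simp add: row_D)
    then show ?thesis using complex_vs.subspace_0[OF subs(6)] N0 by (auto simp: W'_def)
  qed
  have BZ: "B \<subseteq> Z" unfolding B_def Z_def by (rule range_column_subset[of T1 T2, OF T(3)])
  have EZ: "E \<subseteq> Z"
  proof
    fix u assume "u \<in> E"
    then obtain x v where u: "u = x + v" "x \<in> B" "v \<in> N \<times> N" unfolding E_def by blast
    have "v \<in> Z" using u(3) by (cases v) (auto simp: Z_def koszul_row_zero_iff N_iff)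
    moreover have "x \<in> Z" using u(2) BZ by (rule rev_subsetD)
    ultimately show "u \<in> Z" unfolding u(1) by (rule complex_vs.subspace_add[OF subs(1), rotated])
  qed
  have BE: "B \<subseteq> E" unfolding E_def by (rule subset_sum_set[OF complex_vs.subspace_0[OF NN]])
  have B'E: "B' \<subseteq> E" unfolding E_alt by (rule subset_sum_set[OF complex_vs.subspace_0[OF NN]])
  have WF: "W \<subseteq> F" unfolding F_def by (rule subset_sum_set[OF N0])
  have W'F: "W' \<subseteq> F" unfolding F_alt by (rule subset_sum_set[OF N0])
  have ZZ': "Z \<subseteq> Z'" by (auto simp: Z_def Z'_def row_D q.zero)

  have "{0} \<subseteq> N \<times> N \<inter> B" "{0} \<subseteq> N \<inter> W"
    using complex_vs.subspace_0[OF NN] N0 complex_vs.subspace_0[OF subs(2)]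
      complex_vs.subspace_0[OF subs(3)] by auto
  note zero_in = this
  have NB_sub: "csubspace (N \<times> N \<inter> B)" and NW_sub: "csubspace (N \<inter> W)"
    by (intro complex_vs.subspace_inter NN N_sub subs)+
  \<comment> \<open>The relations \<open>k = m + a\<close> and \<open>n = j + c\<close> are the ones
    that produce the cancellation in the Euler characteristic.\<close>
  obtain k m a where k: "has_quotient_dim (N \<times> N) {0} k"
    and m: "has_quotient_dim (N \<times> N) (N \<times> N \<inter> B) m"
    and a: "has_quotient_dim (N \<times> N \<inter> B) {0} a" and k_eq: "k = m + a"
    using has_quotient_dim_split[OF NN NB_sub complex_vs.subspace_single_0 zero_in(1) _
        has_quotient_dim_Times[OF N_sub N(2)]] has_quotient_dim_Times[OF N_sub N(2)] by blast
  obtain j c where j: "has_quotient_dim N (N \<inter> W) j"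
    and c: "has_quotient_dim (N \<inter> W) {0} c" and n_eq: "n = j + c"
    using has_quotient_dim_split[OF N_sub NW_sub complex_vs.subspace_single_0 zero_in(2) _ N(2)] by blast
  have EB: "has_quotient_dim E B m"
    unfolding E_def using has_quotient_dim_sum[OF NN subs(2)] m by simp
  have EB': "has_quotient_dim E B' k"
    unfolding E_alt using has_quotient_dim_sum[OF NN subs(5)] k by (simp add: B'_N)
  have FW: "has_quotient_dim F W j"
    unfolding F_def using has_quotient_dim_sum[OF N_sub subs(3)] j by simp
  have FW': "has_quotient_dim F W' n"
    unfolding F_alt using has_quotient_dim_sum[OF N_sub subs(6)] N(2) by (simp add: W'_N)
  \<comment> \<open>The new cycles in the middle: the row map of \<open>T\<close> sends
    \<open>Z'\<close> onto \<open>N \<inter> W\<close>, with kernel \<open>Z\<close>.\<close>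
  have "has_quotient_dim (N \<inter> W) {0} c \<longleftrightarrow> has_quotient_dim Z' Z c"
  proof (rule has_quotient_dim_iso[OF clinear_koszul_row[OF T(1,2)] subs(4) subs(1) ZZ'])
    show "koszul_row (T1, T2) u \<in> N \<inter> W" if "u \<in> Z'" for u
      using that by (simp add: Z'_def row_D q(2) W_def)
    show "\<exists>u\<in>Z'. y - koszul_row (T1, T2) u \<in> {0}" if y: "y \<in> N \<inter> W" for y
    proof -
      obtain u where "y = koszul_row (T1, T2) u" using y by (auto simp: W_def)
      with y show ?thesis by (intro bexI[of _ u]) (auto simp: Z'_def row_D q(2))
    qed
  qed (auto simp: Z_def complex_vs.subspace_single_0)
  with c have Z'Z: "has_quotient_dim Z' Z c" by simp
  define X where "X = column (D1, D2) -` {0}"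
  have X_iff: "x \<in> X \<longleftrightarrow> column (T1, T2) x \<in> N \<times> N" for x
    by (simp add: X_def column_zero_iff D1_def D2_def q(2)) (simp add: column_def)
  have X_sub: "csubspace X" unfolding X_def by (rule sp'(1))
  have NX: "N \<subseteq> X"
  proof
    fix x assume "x \<in> N"
    then have "column (T1, T2) x = 0" by (simp add: N_iff column_zero_iff)
    then show "x \<in> X" using complex_vs.subspace_0[OF NN] by (simp only: X_iff)
  qed
  \<comment> \<open>The enlarged joint kernel: the column map of \<open>T\<close> sends
    \<open>X\<close> onto \<open>N \<times> N \<inter> B\<close>, with kernel
    \<open>N\<close>.\<close>
  have "has_quotient_dim (N \<times> N \<inter> B) {0} a \<longleftrightarrow> has_quotient_dim X N a"
  proof (rule has_quotient_dim_iso[OF clinear_column[OF T(1,2)] X_sub N_sub NX])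
    show "column (T1, T2) x \<in> N \<times> N \<inter> B" if "x \<in> X" for x
      using that unfolding X_iff B_def by blast
    show "column (T1, T2) x \<in> {0} \<longleftrightarrow> x \<in> N" for x
      by (simp add: N_iff column_zero_iff)
    show "\<exists>x\<in>X. y - column (T1, T2) x \<in> {0}" if y: "y \<in> N \<times> N \<inter> B" for y
    proof -
      obtain x where "y = column (T1, T2) x" using y by (auto simp: B_def)
      with y show ?thesis by (intro bexI[of _ x]) (simp_all only: X_iff, simp_all)
    qed
  qed (rule complex_vs.subspace_single_0)
  with a have "has_quotient_dim X N a" by simp
  then have X0: "has_quotient_dim X {0} (a + n)"
    using has_quotient_dim_tower[OF N_sub complex_vs.subspace_single_0 _ NX _ N(2)] N0 by simp
  have FU: "F \<subseteq> UNIV" by simp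

  \<comment> \<open>The second Euler characteristic minus the first is
    \<open>a - c - k + m + n - j\<close>, which is 0 by \<open>k = m + a\<close> and
    \<open>n = j + c\<close>. The shared unknowns \<open>e\<close> and \<open>w\<close> drop
    out.\<close>
  have dims: "koszul_dims (T1, T2) n (e + m) (w + j) \<and> koszul_dims (D1, D2) (a + n) (c + (e + k)) (w + n)"
    if e: "has_quotient_dim Z E e" and w: "has_quotient_dim UNIV F w" for e w
    unfolding koszul_dims_def W_def[symmetric] B_def[symmetric] Z_def[symmetric]
      W'_def[symmetric] B'_def[symmetric] Z'_def[symmetric] X_def[symmetric] N(1)
  proof (intro conjI N(2) X0)
    show "has_quotient_dim Z B (e + m)" by (rule has_quotient_dim_tower[OF E_sub subs(2) BE EZ e EB])
    show "has_quotient_dim UNIV W (w + j)" by (rule has_quotient_dim_tower[OF F_sub subs(3) WF FU w FW])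
    have ZB': "has_quotient_dim Z B' (e + k)" by (rule has_quotient_dim_tower[OF E_sub subs(5) B'E EZ e EB'])
    show "has_quotient_dim Z' B' (c + (e + k))"
      by (rule has_quotient_dim_tower[OF subs(1) subs(5) _ ZZ' Z'Z ZB']) (use B'E EZ in blast)
    show "has_quotient_dim UNIV W' (w + n)" by (rule has_quotient_dim_tower[OF F_sub subs(6) W'F FU w FW'])
  qed
  have unique: "p = p' \<and> s = s' \<and> r = r'"
    if "koszul_dims (S1, S2) p s r" "koszul_dims (S1, S2) p' s' r'" "clinear S1" "clinear S2"
    for S1 S2 :: "'a \<Rightarrow> 'a" and p s r p' s' r'
    using that koszul_spaces[OF that(3,4)] complex_vs.subspace_single_0
    unfolding koszul_dims_def by (meson has_quotient_dim_unique)
  have "koszul_index (D1, D2) i \<longleftrightarrow> koszul_index (T1, T2) i"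
  proof
    assume "koszul_index (T1, T2) i"
    then obtain p s r where d: "koszul_dims (T1, T2) p s r" and i: "i = int p - int s + int r"
      by (auto simp: koszul_index_def)
    then have "has_quotient_dim Z B s" "has_quotient_dim UNIV W r"
      by (simp_all add: koszul_dims_def Z_def B_def W_def)
    then obtain e w where ew: "has_quotient_dim Z E e" "has_quotient_dim UNIV F w"
      using has_quotient_dim_split[OF subs(1) E_sub subs(2) BE EZ]
        has_quotient_dim_split[OF complex_vs.subspace_UNIV F_sub subs(3) WF FU] by metis
    have "p = n" "s = e + m" "r = w + j"
      using unique[OF d dims[OF ew, THEN conjunct1] T(1,2)] by auto
    then have "i = int (a + n) - int (c + (e + k)) + int (w + n)" using i k_eq n_eq by simp
    then show "koszul_index (D1, D2) i"
      unfolding koszul_index_def using dims[OF ew] by blast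
  next
    assume "koszul_index (D1, D2) i"
    then obtain p s r where d: "koszul_dims (D1, D2) p s r" and i: "i = int p - int s + int r"
      by (auto simp: koszul_index_def)
    then have s: "has_quotient_dim Z' B' s" and r: "has_quotient_dim UNIV W' r"
      by (simp_all add: koszul_dims_def Z'_def B'_def W'_def)
    have B'Z: "B' \<subseteq> Z" using B'E EZ by blast
    obtain e' where e': "has_quotient_dim Z B' e'"
      using has_quotient_dim_split[OF subs(4) subs(1) subs(5) B'Z ZZ' s] by blast
    obtain e w where ew: "has_quotient_dim Z E e" "has_quotient_dim UNIV F w"
      using has_quotient_dim_split[OF subs(1) E_sub subs(5) B'E EZ e']
        has_quotient_dim_split[OF complex_vs.subspace_UNIV F_sub subs(6) W'F FU r] by metis
    have "p = a + n" "s = c + (e + k)" "r = w + n"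
      using unique[OF d dims[OF ew, THEN conjunct2] D] by auto
    then have "i = int n - int (e + m) + int (w + j)" using i k_eq n_eq by simp
    then show "koszul_index (T1, T2) i"
      unfolding koszul_index_def using dims[OF ew] by blast
  qed
  then show ?thesis unfolding D1_def D2_def by simp
qed

section \<open>The spherical Aluthge transform\<close>

lemma positive_operator_square_zero_iff:
  assumes R: "positive_operator R"
  shows "R (R x) = 0 \<longleftrightarrow> R x = 0"
proof
  assume "R (R x) = 0"
  then have "inner (R x) (R x) = 0"
    using positive_operator_symmetric[OF R, of "R x" x] by simp
  then show "R x = 0" by simp
next
  interpret R: bounded_linear R
    by (rule bounded_clinear_bounded_linear[OF positive_operator_bounded_clinear[OF R]])
  assume "R x = 0"
  then show "R (R x) = 0" by (simp add: R.zero)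
qed

lemma positive_operator_square:
  assumes R: "positive_operator R"
  shows "positive_operator (\<lambda>x. R (R x))"
  unfolding positive_operator_iff
proof (intro conjI allI)
  show "bounded_clinear (\<lambda>x. R (R x))"
    by (rule bounded_clinear_compose; rule positive_operator_bounded_clinear[OF R])
  show "inner (R (R x)) y = inner x (R (R y))" for x y
    by (simp add: positive_operator_symmetric[OF R])
  show "0 \<le> inner (R (R x)) x" for x
    by (subst positive_operator_symmetric[OF R]) simp
qed

text \<open>In fact the two ranges coincide: projecting \<open>R x\<close> onto
  \<open>range (R R)\<close> leaves a remainder \<open>R (x - R z)\<close> that \<open>R R\<close>
  annihilates; since \<open>R R\<close> and \<open>R\<close> have the same kernel, peeling off
  factors shows that the remainder is 0.\<close>

lemma closed_range_sqrt:
  assumes R: "positive_operator R" and P: "closed (range (\<lambda>x. R (R x)))"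
  shows "closed (range R)"
proof -
  let ?P = "\<lambda>x. R (R x)"
  note PP = positive_operator_square[OF R]
  interpret R: bounded_linear R
    by (rule bounded_clinear_bounded_linear[OF positive_operator_bounded_clinear[OF R]])
  have clo: "closure (range ?P) = range ?P" using P by (rule closure_closed)
  have "R x \<in> range ?P" for x
  proof -
    let ?m = "hproj (closure (range ?P)) (R x)"
    have "?m \<in> range ?P"
      using hproj_in[OF csubspace_closure_range(2,3)[OF PP], of "R x"] by (simp only: clo)
    then obtain z where z: "?m = R (R z)" by blast
    have "?P (R x - ?m) = 0" by (rule kernel_complement_hproj[OF PP])
    then have "R (R x - ?m) = 0" by (simp add: positive_operator_square_zero_iff[OF R])
    then have "R (R (x - R z)) = 0" by (simp only: z R.diff)
    then have "R (x - R z) = 0" by (simp add: positive_operator_square_zero_iff[OF R])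
    then have "R x = R (R z)" by (simp add: R.diff)
    then show ?thesis by blast
  qed
  then have "range R = range ?P" by blast
  with P show ?thesis by simp
qed

text \<open>Equal norms turn convergence of \<open>f (x n)\<close> into convergence of
  \<open>g (x n)\<close> and back. Applied with \<open>R R\<close> as \<open>f\<close> and the
  column of \<open>T\<close> as \<open>g\<close>.\<close>

lemma closed_range_norm_eq:
  fixes f :: "'a::real_normed_vector \<Rightarrow> 'b::real_normed_vector" and g :: "'a \<Rightarrow> 'c::banach"
  assumes f: "bounded_linear f" and g: "bounded_linear g"
    and eq: "\<And>x. norm (f x) = norm (g x)" and g_closed: "closed (range g)"
  shows "closed (range f)"
  unfolding closed_sequential_limits
proof (intro allI impI)
  interpret f: bounded_linear f by fact
  interpret g: bounded_linear g by fact
  fix u y assume "(\<forall>n. u n \<in> range f) \<and> u \<longlonglongrightarrow> y"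
  then have u: "\<And>n. u n \<in> range f" "u \<longlonglongrightarrow> y" by auto
  have "\<exists>x. u n = f x" for n using u(1)[of n] by blast
  then obtain x where x: "\<And>n. u n = f (x n)" by metis
  have "dist (g (x i)) (g (x j)) = dist (u i) (u j)" for i j
    by (simp add: dist_norm x f.diff[symmetric] g.diff[symmetric] eq)
  then have "Cauchy (\<lambda>n. g (x n))"
    using LIMSEQ_imp_Cauchy[OF u(2)] by (simp add: Cauchy_def)
  then obtain w where w: "(\<lambda>n. g (x n)) \<longlonglongrightarrow> w"
    using Cauchy_convergent convergent_def by blast
  have "w \<in> range g" using closed_sequentially[OF g_closed _ w] by simp
  then obtain z where z: "w = g z" by blast
  have "(\<lambda>n. norm (g (x n) - g z)) \<longlonglongrightarrow> 0"
    using w tendsto_norm_zero LIM_zero unfolding z by blast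
  then have "(\<lambda>n. norm (u n - f z)) \<longlonglongrightarrow> 0"
    by (simp add: x f.diff[symmetric] g.diff[symmetric] eq)
  then have "u \<longlonglongrightarrow> f z" using LIM_zero_iff tendsto_norm_zero_iff by blast
  then have "y = f z" using u(2) LIMSEQ_unique by blast
  then show "y \<in> range f" by simp
qed

text \<open>The hypothesis \<open>com\<close> is the commutation of the original pair, written
  through the factorization: it says that both sides agree on the range of \<open>R R\<close>. On
  the kernel of \<open>R R\<close>, which is that of \<open>R\<close>, both vanish.\<close>

lemma aluthge_criss_cross:
  assumes R: "positive_operator R" and V: "bounded_clinear V1" "bounded_clinear V2"
    and kernel: "\<And>x. R x = 0 \<Longrightarrow> V1 x = 0" "\<And>x. R x = 0 \<Longrightarrow> V2 x = 0"
    and com: "\<And>x. V1 (R (R (V2 (R (R x))))) = V2 (R (R (V1 (R (R x)))))"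
  shows "V1 (R (R (V2 x))) = V2 (R (R (V1 x)))"
proof -
  note Rb = positive_operator_bounded_clinear[OF R]
  interpret R: bounded_linear R by (rule bounded_clinear_bounded_linear[OF Rb])
  interpret V1: bounded_linear V1 by (rule bounded_clinear_bounded_linear[OF V(1)])
  interpret V2: bounded_linear V2 by (rule bounded_clinear_bounded_linear[OF V(2)])
  have b: "bounded_clinear (\<lambda>x. A (R (R (C x))))" if "bounded_clinear A" "bounded_clinear C" for A C
    using bounded_clinear_compose[OF that(1) bounded_clinear_compose[OF Rb bounded_clinear_compose[OF Rb that(2)]]] .
  show ?thesis
  proof (rule bounded_clinear_eq_if_eq_on_range_kernel[OF positive_operator_square[OF R] b[OF V] b[OF V(2,1)]])
    fix x assume "R (R x) = 0"
    then have "R x = 0" by (simp add: positive_operator_square_zero_iff[OF R])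
    then show "V1 (R (R (V2 x))) = V2 (R (R (V1 x)))"
      by (simp add: kernel R.zero V1.zero V2.zero)
  qed (rule com)
qed

text \<open>
  Let \<open>Q\<close> be the projection onto the range of \<open>R\<close>. Then \<open>R + (1 - Q)\<close> is bijective and intertwines
  the compression \<open>(Q T1, Q T2)\<close> with the Aluthge transform.
\<close>

lemma koszul_index_aluthge_closed_range:
  fixes R V1 V2 :: "'a::complex_hilbert_space \<Rightarrow> 'a"
  assumes R: "positive_operator R" and V: "bounded_clinear V1" "bounded_clinear V2"
    and kernel: "\<And>x. R x = 0 \<Longrightarrow> V1 x = 0" "\<And>x. R x = 0 \<Longrightarrow> V2 x = 0"
    and com: "\<And>x. V1 (R (R (V2 x))) = V2 (R (R (V1 x)))"
    and joint_kernel: "\<And>x. V1 (R (R x)) = 0 \<and> V2 (R (R x)) = 0 \<longleftrightarrow> R x = 0"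
    and closed: "closed (range R)" and n: "has_quotient_dim (R -` {0}) {0} n"
  shows "koszul_index (\<lambda>x. R (V1 (R x)), \<lambda>x. R (V2 (R x))) i
    \<longleftrightarrow> koszul_index (\<lambda>x. V1 (R (R x)), \<lambda>x. V2 (R (R x))) i"
proof -
  note Rb = positive_operator_bounded_clinear[OF R]
  have lin: "clinear R" "clinear V1" "clinear V2" using Rb V by (simp_all add: bounded_clinear_clinear)
  interpret R: Vector_Spaces.linear scaleC scaleC R by fact
  interpret V1: Vector_Spaces.linear scaleC scaleC V1 by fact
  interpret V2: Vector_Spaces.linear scaleC scaleC V2 by fact
  have RR: "closed (range R)" "csubspace (range R)" "subspace (range R)"
    using closed csubspace_range[OF lin(1)] by (auto intro: csubspace_subspace)
  define Q where "Q = hproj (range R)"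
  have Q: "clinear Q"
    unfolding Q_def by (intro bounded_clinear_clinear bounded_clinear_hproj RR)
  interpret Q: Vector_Spaces.linear scaleC scaleC Q by fact
  have Q_range: "Q x \<in> range R" for x unfolding Q_def by (rule hproj_in[OF RR(1,3)])
  have Q_R: "Q (R x) = R x" for x unfolding Q_def by (rule hproj_ident[OF RR(1,3)]) simp
  have QQ: "Q (Q x) = Q x" for x
  proof -
    obtain z where "Q x = R z" using Q_range by blast
    then show ?thesis by (simp add: Q_R)
  qed
  have R_Q: "R (x - Q x) = 0" for x
    using kernel_complement_hproj[OF R, of x] by (simp add: Q_def closure_closed[OF closed])
  have Q_kernel: "Q x = 0 \<longleftrightarrow> R x = 0" for x
  proof
    assume "Q x = 0"
    with R_Q[of x] show "R x = 0" by simp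
  next
    assume "R x = 0"
    then have "inner x m = 0" if "m \<in> range R" for m
      using that by (auto simp: positive_operator_symmetric[OF R, symmetric])
    then show "Q x = 0" unfolding Q_def by (simp add: hproj_eq_0_iff[OF RR(1,3)])
  qed
  define T1 T2 where "T1 x = V1 (R (R x))" and "T2 x = V2 (R (R x))" for x
  define H1 H2 where "H1 x = R (V1 (R x))" and "H2 x = R (V2 (R x))" for x
  define D1 D2 where "D1 x = Q (T1 x)" and "D2 x = Q (T2 x)" for x
  have T: "clinear T1" "clinear T2" and H: "clinear H1" "clinear H2"
    by (simp_all add: T1_def T2_def H1_def H2_def clinear_iff R.add R.scale V1.add V1.scale
        V2.add V2.scale)
  have D: "clinear D1" "clinear D2"
    using T by (simp_all add: D1_def D2_def clinear_iff Q.add Q.scale)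
  have T_com: "T1 (T2 x) = T2 (T1 x)" for x by (simp add: T1_def T2_def com)
  have H_com: "H1 (H2 x) = H2 (H1 x)" for x by (simp add: H1_def H2_def com)
  \<comment> \<open>Hence \<open>T1\<close> and \<open>T2\<close> absorb a \<open>Q\<close> on their
    right, and the compressions commute because \<open>T1\<close> and \<open>T2\<close> do.\<close>
  have R_eq: "R (Q x) = R x" for x using R_Q[of x] by (simp add: R.diff)
  have D_com: "D1 (D2 x) = D2 (D1 x)" for x
    using T_com[of x] by (simp add: D1_def D2_def T1_def T2_def R_eq)
  define S where "S x = R x + (x - Q x)" for x
  have S: "clinear S"
    by (simp add: S_def clinear_iff R.add R.scale Q.add Q.scale scaleC_add_right
        complex_vs.scale_right_diff_distrib)
  interpret S: Vector_Spaces.linear scaleC scaleC S by fact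
  have Q_S: "Q (S x) = R x" for x by (simp add: S_def Q.add Q.diff Q_R QQ)
  have "inj S"
  proof (rule injI)
    fix x y assume "S x = S y"
    then have *: "S (x - y) = 0" by (simp add: S.diff)
    then have "R (x - y) = 0" using Q_S[of "x - y"] by (simp add: Q.zero)
    moreover from this have "Q (x - y) = 0" by (simp add: Q_kernel)
    ultimately have "x - y = 0" using * by (simp add: S_def del: right_minus_eq)
    then show "x = y" by simp
  qed
  moreover have "surj S"
  proof -
    have "\<exists>x. S x = y" for y
    proof -
      obtain z where z: "Q y = R z" using Q_range by blast
      \<comment> \<open>The preimage of \<open>y\<close> is assembled from two parts:
        \<open>R\<close> maps \<open>Q z\<close> to \<open>R z = Q y\<close>, and the part of
        \<open>y\<close> orthogonal to \<open>range R\<close> is left unchanged by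
        \<open>S\<close>.\<close>
      define u where "u = Q z + (y - Q y)"
      have "R u = Q y" by (simp only: u_def R.add R_Q R_eq add_0_right) (simp only: z)
      moreover have "Q u = Q z" by (simp add: u_def Q.add Q.diff QQ)
      ultimately have "S u = y" by (simp add: S_def) (simp add: u_def)
      then show ?thesis ..
    qed
    then show ?thesis by (metis surjI)
  qed
  ultimately have bij: "bij S" by (simp add: bij_def)
  then obtain G where G: "clinear G" "\<And>x. G (S x) = x"
    using complex_vs_pair.linear_injective_left_inverse[OF S] by (auto simp: bij_def fun_eq_iff)
  have SG: "S (G x) = x" for x
    using G(2) bij by (metis bij_def surjD)
  have R_S: "R (S x) = R (R x)" for x by (simp add: S_def R.add R_Q)
  \<comment> \<open>\<open>S\<close> after \<open>Q\<close> is \<open>R\<close>, and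
    \<open>R\<close> after \<open>S\<close> is \<open>R R\<close>; so \<open>S D\<^sub>j\<close> and
    \<open>H\<^sub>j S\<close> both equal \<open>R V\<^sub>j R R\<close>.\<close>
  have S_T: "S (Q (T x)) = R (T x)" for T :: "'a \<Rightarrow> 'a" and x by (simp add: S_def R_eq QQ)
  have SD: "S (D1 x) = H1 (S x)" "S (D2 x) = H2 (S x)" for x
    by (simp_all add: D1_def D2_def S_T H1_def H2_def R_S T1_def T2_def)
  have GH: "G (H1 x) = D1 (G x)" "G (H2 x) = D2 (G x)" for x
    using SD[of "G x"] G(2) by (simp_all add: SG) metis+
  have "koszul_dims (H1, H2) p q r \<longleftrightarrow> koszul_dims (D1, D2) p q r" for p q r
    by (rule koszul_dims_homotopy_equivalence[OF D D_com H H_com S SD G(1) GH, of 1 "\<lambda>x. 0" "\<lambda>x. 0"])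
      (simp_all add: G(2) SG)
  then have "koszul_index (H1, H2) i \<longleftrightarrow> koszul_index (D1, D2) i"
    by (simp add: koszul_index_def)
  also have "\<dots> \<longleftrightarrow> koszul_index (T1, T2) i"
    unfolding D1_def D2_def
  proof (rule koszul_index_compression[OF T T_com _ n Q])
    show "column (T1, T2) -` {0} = R -` {0}"
      by (auto simp: column_zero_iff T1_def T2_def joint_kernel)
  qed (simp_all add: Q_kernel QQ)
  finally show ?thesis unfolding H1_def H2_def T1_def T2_def .
qed

text \<open>The norm identity serves twice: it identifies the joint kernel of \<open>T\<close> with
  the kernel of \<open>R\<close>, and it transfers closedness from the range of the column to that
  of \<open>R R\<close>.\<close>

lemma koszul_index_aluthge_zero:
  fixes R V1 V2 :: "'a::complex_hilbert_space \<Rightarrow> 'a"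
  assumes R: "positive_operator R" and V: "bounded_clinear V1" "bounded_clinear V2"
    and kernel: "\<And>x. R x = 0 \<Longrightarrow> V1 x = 0" "\<And>x. R x = 0 \<Longrightarrow> V2 x = 0"
    and com: "\<And>x. V1 (R (R (V2 x))) = V2 (R (R (V1 x)))"
    and norm: "\<And>x. norm (R (R x)) = norm (column (\<lambda>x. V1 (R (R x)), \<lambda>x. V2 (R (R x))) x)"
  shows "koszul_index (\<lambda>x. R (V1 (R x)), \<lambda>x. R (V2 (R x))) i
    \<longleftrightarrow> koszul_index (\<lambda>x. V1 (R (R x)), \<lambda>x. V2 (R (R x))) i"
proof -
  note Rb = positive_operator_bounded_clinear[OF R]
  note RRb = bounded_clinear_compose[OF Rb Rb]
  define T1 T2 where "T1 = (\<lambda>x. V1 (R (R x)))" and "T2 = (\<lambda>x. V2 (R (R x)))"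
  define H1 H2 where "H1 = (\<lambda>x. R (V1 (R x)))" and "H2 = (\<lambda>x. R (V2 (R x)))"
  have T: "bounded_clinear T1" "bounded_clinear T2"
    unfolding T1_def T2_def by (rule bounded_clinear_compose[OF V(1) RRb], rule bounded_clinear_compose[OF V(2) RRb])
  have H: "bounded_clinear H1" "bounded_clinear H2"
    unfolding H1_def H2_def
    using bounded_clinear_compose[OF Rb bounded_clinear_compose[OF V(1) Rb]]
      bounded_clinear_compose[OF Rb bounded_clinear_compose[OF V(2) Rb]] by auto
  have T_com: "T1 (T2 x) = T2 (T1 x)" for x by (simp add: T1_def T2_def com)
  have H_com: "H1 (H2 x) = H2 (H1 x)" for x by (simp add: H1_def H2_def com)
  have norm: "norm (R (R x)) = norm (column (T1, T2) x)" for x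
    using norm by (simp add: T1_def T2_def)
  have joint_kernel: "T1 x = 0 \<and> T2 x = 0 \<longleftrightarrow> R x = 0" for x
  proof -
    have "R (R x) = 0 \<longleftrightarrow> column (T1, T2) x = 0"
      using norm[of x] by (metis norm_eq_zero)
    then show ?thesis by (simp add: column_zero_iff positive_operator_square_zero_iff[OF R])
  qed
  have N_sub: "csubspace (R -` {0})"
    by (intro csubspace_vimage bounded_clinear_clinear Rb complex_vs.subspace_single_0)
  have equiv: "koszul_index (H1, H2) i \<longleftrightarrow> koszul_index (T1, T2) i"
    if "closed (range R)" "has_quotient_dim (R -` {0}) {0} n" for n
    unfolding H1_def H2_def T1_def T2_def
    by (rule koszul_index_aluthge_closed_range[OF R V kernel com _ that])
      (simp_all add: joint_kernel[unfolded T1_def T2_def])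
  have "koszul_index (H1, H2) i \<longleftrightarrow> koszul_index (T1, T2) i"
  proof
    assume iT: "koszul_index (T1, T2) i"
    then obtain n where n: "has_quotient_dim (column (T1, T2) -` {0}) {0} n"
      by (auto simp: koszul_index_def koszul_dims_def)
    have "column (T1, T2) -` {0} = R -` {0}"
      by (auto simp: column_zero_iff joint_kernel)
    with n have N: "has_quotient_dim (R -` {0}) {0} n" by simp
    have "fredholm_pair (T1, T2)"
      using iT fredholm_pair_iff_koszul_index[of T1 T2, OF T T_com] by blast
    then have "closed (range (column (T1, T2)))" by (simp add: fredholm_pair_def)
    then have "closed (range (\<lambda>x. R (R x)))"
      by (rule closed_range_norm_eq[rotated 3])
        (intro bounded_clinear_bounded_linear RRb bounded_clinear_column T norm)+
    from closed_range_sqrt[OF R this] show "koszul_index (H1, H2) i" using equiv[OF _ N] iT by blast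
  next
    assume iH: "koszul_index (H1, H2) i"
    then have "fredholm_pair (H1, H2)"
      using fredholm_pair_iff_koszul_index[of H1 H2, OF H H_com] by blast
    then have row: "closed (range (koszul_row (H1, H2)))" by (simp add: fredholm_pair_def)
    obtain a c where a: "has_quotient_dim (column (H1, H2) -` {0}) {0} a"
      and c: "has_quotient_dim UNIV (range (koszul_row (H1, H2))) c"
      using iH by (auto simp: koszul_index_def koszul_dims_def)
    note sp = koszul_spaces[OF H[THEN bounded_clinear_clinear]]
    interpret R: bounded_linear R by (rule bounded_clinear_bounded_linear[OF Rb])
    interpret V1: bounded_linear V1 by (rule bounded_clinear_bounded_linear[OF V(1)])
    interpret V2: bounded_linear V2 by (rule bounded_clinear_bounded_linear[OF V(2)])
    have "R -` {0} \<subseteq> column (H1, H2) -` {0}"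
      by (auto simp: column_zero_iff H1_def H2_def R.zero V1.zero V2.zero)
    then obtain n where N: "has_quotient_dim (R -` {0}) {0} n"
      using has_quotient_dim_subspace[OF sp(1) N_sub _ a] by blast
    \<comment> \<open>Every value of this row map has \<open>R\<close> as its outermost factor, so
      its closed range, of finite codimension in the whole space, lies inside
      \<open>range R\<close>, which is then closed too.\<close>
    have "koszul_row (H1, H2) u = R (V1 (R (snd u)) - V2 (R (fst u)))" for u
      by (simp add: koszul_row_def case_prod_unfold H1_def H2_def R.diff)
    then have sub: "range (koszul_row (H1, H2)) \<subseteq> range R" by auto
    have R_sub: "csubspace (range R)" by (intro csubspace_range bounded_clinear_clinear Rb)
    obtain m where "has_quotient_dim (range R) (range (koszul_row (H1, H2))) m"
      using has_quotient_dim_split[OF complex_vs.subspace_UNIV R_sub sp(4) sub subset_UNIV c] by blast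
    from closed_if_finite_quotient[OF row sp(4) R_sub sub this]
    show "koszul_index (T1, T2) i" using equiv[OF _ N] iH by blast
  qed
  then show ?thesis unfolding H1_def H2_def T1_def T2_def .
qed

text \<open>With \<open>j\<close> such that \<open>l\<^sub>j \<noteq> 0\<close>, the composites of
  \<open>R\<close> and \<open>V\<^sub>j R\<close> minus the scalar \<open>l\<^sub>j\<close> are
  exactly the j-th shifted operators of the two pairs. The criss-cross identity \<open>com\<close>
  is needed for \<open>V\<^sub>j R\<close> to intertwine the component with the other index.\<close>

lemma koszul_index_shift_aluthge:
  fixes R V1 V2 :: "'a::complex_hilbert_space \<Rightarrow> 'a"
  assumes R: "clinear R" and V: "clinear V1" "clinear V2"
    and com: "\<And>x. V1 (R (R (V2 x))) = V2 (R (R (V1 x)))"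
    and l: "l1 \<noteq> 0 \<or> l2 \<noteq> 0"
  shows "koszul_index (shift_pair (\<lambda>x. R (V1 (R x)), \<lambda>x. R (V2 (R x))) (l1, l2)) i
    \<longleftrightarrow> koszul_index (shift_pair (\<lambda>x. V1 (R (R x)), \<lambda>x. V2 (R (R x))) (l1, l2)) i"
proof -
  interpret R: Vector_Spaces.linear scaleC scaleC R by fact
  interpret V1: Vector_Spaces.linear scaleC scaleC V1 by fact
  interpret V2: Vector_Spaces.linear scaleC scaleC V2 by fact
  define T1 T2 where "T1 x = V1 (R (R x)) - l1 *\<^sub>C x" and "T2 x = V2 (R (R x)) - l2 *\<^sub>C x" for x
  define H1 H2 where "H1 x = R (V1 (R x)) - l1 *\<^sub>C x" and "H2 x = R (V2 (R x)) - l2 *\<^sub>C x" for x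
  note simps = T1_def T2_def H1_def H2_def R.add R.scale R.diff V1.add V1.scale V1.diff
    V2.add V2.scale V2.diff complex_vs.scale_right_diff_distrib scaleC_add_right scaleC_scaleC com
    mult.commute
  have T: "clinear T1" "clinear T2" "\<And>x. T1 (T2 x) = T2 (T1 x)"
    by (simp_all add: clinear_iff simps)
  have H: "clinear H1" "clinear H2" "\<And>x. H1 (H2 x) = H2 (H1 x)"
    by (simp_all add: clinear_iff simps)
  have RT: "R (T1 x) = H1 (R x)" "R (T2 x) = H2 (R x)" for x
    by (simp_all add: simps)
  have "koszul_dims (H1, H2) p q r \<longleftrightarrow> koszul_dims (T1, T2) p q r" for p q r
  proof (cases "l1 = 0")
    case False
    show ?thesis
    proof (rule koszul_dims_homotopy_equivalence[OF T H R RT _ _ _ False,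
          where g = "\<lambda>x. V1 (R x)" and N = T1 and N' = H1])
      show "T1 = (\<lambda>x. 0) \<and> H1 = (\<lambda>x. 0) \<or> T1 = T1 \<and> H1 = H1 \<or> T1 = T2 \<and> H1 = H2" by blast
    qed (simp_all add: clinear_iff simps)
  next
    case True
    with l have l2: "l2 \<noteq> 0" by simp
    show ?thesis
    proof (rule koszul_dims_homotopy_equivalence[OF T H R RT _ _ _ l2,
          where g = "\<lambda>x. V2 (R x)" and N = T2 and N' = H2])
      show "T2 = (\<lambda>x. 0) \<and> H2 = (\<lambda>x. 0) \<or> T2 = T1 \<and> H2 = H1 \<or> T2 = T2 \<and> H2 = H2" by blast
    qed (simp_all add: clinear_iff simps)
  qed
  then show ?thesis
    by (simp add: koszul_index_def shift_pair_def T1_def[abs_def] T2_def[abs_def] H1_def[abs_def]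
        H2_def[abs_def])
qed

theorem theorem2p10:
  fixes T1 T2 :: "'a::complex_hilbert_space \<Rightarrow> 'a"
  assumes infinite_dimensional: "\<nexists>B :: 'a set. finite B \<and> complex_vs.span B = UNIV"
    and commuting: "commuting_pair (T1, T2)"
  shows "taylor_essential_spectrum (T1, T2) = taylor_essential_spectrum (spherical_aluthge (T1, T2))
    \<and> (\<forall>l. l \<notin> taylor_essential_spectrum (T1, T2) \<longrightarrow>
        fredholm_index (shift_pair (T1, T2) l)
        = fredholm_index (shift_pair (spherical_aluthge (T1, T2)) l))"
proof -
  have T: "bounded_clinear T1" "bounded_clinear T2"
    and T_com: "T1 (T2 x) = T2 (T1 x)" for x
    using commuting by (auto simp: commuting_pair_def fun_eq_iff)
  obtain R V1 V2 where R: "positive_operator R" and V: "bounded_clinear V1" "bounded_clinear V2"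
    and T_eq: "\<And>x. T1 x = V1 (R (R x))" "\<And>x. T2 x = V2 (R (R x))"
    and kernel: "\<And>x. R x = 0 \<Longrightarrow> V1 x = 0" "\<And>x. R x = 0 \<Longrightarrow> V2 x = 0"
    and norm: "\<And>x. norm (R (R x)) = norm (column (T1, T2) x)"
    and aluthge: "spherical_aluthge (T1, T2) = (\<lambda>x. R (V1 (R x)), \<lambda>x. R (V2 (R x)))"
    by (rule spherical_aluthge_factorization[OF T], rule that)
  note Rb = positive_operator_bounded_clinear[OF R]
  have T_fun: "T1 = (\<lambda>x. V1 (R (R x)))" "T2 = (\<lambda>x. V2 (R (R x)))" using T_eq by auto
  have com: "V1 (R (R (V2 x))) = V2 (R (R (V1 x)))" for x
    by (rule aluthge_criss_cross[OF R V kernel]) (simp_all add: T_eq[symmetric] T_com)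
  define H1 H2 where "H1 = (\<lambda>x. R (V1 (R x)))" and "H2 = (\<lambda>x. R (V2 (R x)))"
  have H: "bounded_clinear H1" "bounded_clinear H2"
    unfolding H1_def H2_def
    using bounded_clinear_compose[OF Rb bounded_clinear_compose[OF V(1) Rb]]
      bounded_clinear_compose[OF Rb bounded_clinear_compose[OF V(2) Rb]] by auto
  have H_com: "H1 (H2 x) = H2 (H1 x)" for x by (simp add: H1_def H2_def com)
  \<comment> \<open>One equivalence for all \<open>i\<close> contains both claims: existence of some
    \<open>i\<close> compares the spectra, its value compares the indices.\<close>
  have index: "koszul_index (shift_pair (H1, H2) l) i \<longleftrightarrow> koszul_index (shift_pair (T1, T2) l) i" for l i
  proof (cases l)
    case (Pair l1 l2)
    show ?thesis
    proof (cases "l1 = 0 \<and> l2 = 0")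
      case True
      have "koszul_index (H1, H2) i \<longleftrightarrow> koszul_index (T1, T2) i"
        unfolding H1_def H2_def T_fun
        by (rule koszul_index_aluthge_zero[OF R V kernel com]) (simp_all add: norm T_fun[symmetric])
      then show ?thesis by (simp add: Pair True shift_pair_def)
    next
      case False
      then show ?thesis
        unfolding Pair H1_def H2_def T_fun
        by (intro koszul_index_shift_aluthge bounded_clinear_clinear Rb V com) auto
    qed
  qed
  have shift: "shift_pair (S1, S2) l = (\<lambda>x. S1 x - fst l *\<^sub>C x, \<lambda>x. S2 x - snd l *\<^sub>C x)"
    for S1 S2 :: "'a \<Rightarrow> 'a" and l
    by (simp add: shift_pair_def case_prod_unfold)
  \<comment> \<open>Stated for an arbitrary bounded commuting pair, since it is needed for the given
    pair and for its transform alike; scalar shifts preserve boundedness and commutation.\<close>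
  have fredholm: "fredholm_pair (shift_pair (S1, S2) l) \<longleftrightarrow> (\<exists>i. koszul_index (shift_pair (S1, S2) l) i)"
    and index_eq: "koszul_index (shift_pair (S1, S2) l) i \<Longrightarrow> fredholm_index (shift_pair (S1, S2) l) = i"
    if S: "bounded_clinear S1" "bounded_clinear S2" "\<And>x. S1 (S2 x) = S2 (S1 x)"
    for S1 S2 :: "'a \<Rightarrow> 'a" and l i
  proof -
    define U1 U2 where "U1 x = S1 x - fst l *\<^sub>C x" and "U2 x = S2 x - snd l *\<^sub>C x" for x
    have U: "bounded_clinear U1" "bounded_clinear U2"
      unfolding U1_def U2_def by (intro bounded_clinear_diff S bounded_clinear_scaleC)+
    have "S1 (x - c *\<^sub>C y) = S1 x - c *\<^sub>C S1 y" "S2 (x - c *\<^sub>C y) = S2 x - c *\<^sub>C S2 y" for x y c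
      using S(1,2) by (auto simp: bounded_clinear_def linear_simps)
    then have U_com: "U1 (U2 x) = U2 (U1 x)" for x
      by (simp add: U1_def U2_def S(3) complex_vs.scale_right_diff_distrib scaleC_scaleC mult.commute)
    have eq: "shift_pair (S1, S2) l = (U1, U2)" by (simp add: shift U1_def[abs_def] U2_def[abs_def])
    show "fredholm_pair (shift_pair (S1, S2) l) \<longleftrightarrow> (\<exists>i. koszul_index (shift_pair (S1, S2) l) i)"
      unfolding eq by (rule fredholm_pair_iff_koszul_index[of U1 U2, OF U U_com])
    show "fredholm_index (shift_pair (S1, S2) l) = i" if "koszul_index (shift_pair (S1, S2) l) i"
      using koszul_index_fredholm_index[OF U[THEN bounded_clinear_clinear]] that unfolding eq by blast
  qed
  have iff: "fredholm_pair (shift_pair (T1, T2) l) \<longleftrightarrow> fredholm_pair (shift_pair (H1, H2) l)" for l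
    by (simp add: fredholm[OF T T_com] fredholm[OF H H_com] index)
  have "fredholm_index (shift_pair (T1, T2) l) = fredholm_index (shift_pair (H1, H2) l)"
    if l: "l \<notin> taylor_essential_spectrum (T1, T2)" for l
  proof -
    have "fredholm_pair (shift_pair (T1, T2) l)" using l by (simp add: taylor_essential_spectrum_def)
    then obtain i where i: "koszul_index (shift_pair (T1, T2) l) i"
      using fredholm[OF T T_com] by blast
    then have "koszul_index (shift_pair (H1, H2) l) i" by (simp add: index)
    then show ?thesis using index_eq[OF T T_com i] index_eq[OF H H_com] by simp
  qed
  then show ?thesis
    unfolding aluthge H1_def[symmetric] H2_def[symmetric] taylor_essential_spectrum_def
    using iff by auto
qed

end
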